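(* Let $\{B(t)\}_{t\ge 0}$ be a standard Brownian motion, let $S(t):=\max_{0\le u\le t}B(u)$, and let $\mathcal A:=\int_0^1 S(t)\,\mathrm dt$. Then for all complex $s$ with $\operatorname{Re} s>-1$, \begin{align*} \mathbb E\,\mathcal A^s &=\frac{\Gamma(s+1)\,\Gamma(s+2/3)}{\Gamma(2/3)\,\Gamma(3s/2+1)}\Bigl(\frac{3}{\sqrt 8}\Bigr)^s\\ &=\frac{\Gamma(s+1)\,\Gamma(s+5/3)}{\Gamma(5/3)\,\Gamma(3s/2+2)}\Bigl(\frac{3}{\sqrt 8}\Bigr)^s\\ &=\frac{2\,\Gamma(1/3)}{3\sqrt\pi}\cdot\frac{\Gamma(3s/2+3/2)}{\Gamma(s+4/3)}\Bigl(\frac{\sqrt 8}{9}\Bigr)^s\\ &=\frac{\Gamma(1/3)}{2^{1/3}\pi}\cdot\frac{\Gamma(s/2+1/2)\,\Gamma(s/2+5/6)}{\Gamma(s/2+2/3)}\Bigl(\frac 23\Bigr)^{s/2}. \end{align*} Further, $\mathbb E\,\mathcal A^s=\infty$ for real $s\le -1$.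
   Context: $\mathcal A$ is the area under the supremum process of Brownian motion on $[0,1]$. Each right-hand side is a meromorphic function of $s$; at removable singularities (e.g. $s=-2/3$ in the first formula) its value is defined by continuity. *)

theory Defs
  imports "HOL-Probability.Probability" "HOL-Complex_Analysis.Complex_Analysis"
begin

text \<open>
  Only the restriction of \<open>B\<close> to times \<open>t \<ge> 0\<close> is constrained. All paths are required to be
  continuous, not just almost all of them, so that running maxima exist at every point of the
  sample space and are measurable even if \<open>M\<close> is not complete.
\<close>

locale standard_brownian_motion = prob_space M
  for M :: "'a measure" and B :: "real \<Rightarrow> 'a \<Rightarrow> real" +
  assumes measurable_B: "\<And>t. 0 \<le> t \<Longrightarrow> B t \<in> borel_measurable M"
    and start_zero: "AE \<omega> in M. B 0 \<omega> = 0"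
    and independent_increments:
      "\<And>(n :: nat) t. 0 \<le> t 0 \<Longrightarrow> mono_on {..n} t \<Longrightarrow>
        indep_vars (\<lambda>_. borel) (\<lambda>i \<omega>. B (t (Suc i)) \<omega> - B (t i) \<omega>) {..<n}"
    and normal_increments:
      "\<And>s t. 0 \<le> s \<Longrightarrow> s < t \<Longrightarrow>
        distributed M lborel (\<lambda>\<omega>. B t \<omega> - B s \<omega>) (normal_density 0 (sqrt (t - s)))"
    and continuous_paths: "\<And>\<omega>. \<omega> \<in> space M \<Longrightarrow> continuous_on {0..} (\<lambda>t. B t \<omega>)"

text \<open>The supremum is a maximum whenever the path is continuous on \<open>{0..t}\<close> and \<open>t \<ge> 0\<close>.\<close>

definition running_max :: "(real \<Rightarrow> 'a \<Rightarrow> real) \<Rightarrow> real \<Rightarrow> 'a \<Rightarrow> real" where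
  "running_max B t \<omega> = (SUP u\<in>{0..t}. B u \<omega>)"

definition sup_area :: "(real \<Rightarrow> 'a \<Rightarrow> real) \<Rightarrow> 'a \<Rightarrow> real" where
  "sup_area B \<omega> = (LBINT t:{0..1}. running_max B t \<omega>)"

text \<open>
  The four meromorphic expressions. As \<open>Gamma\<close> takes the value 0 at its poles and \<open>x / 0 = 0\<close>,
  the values at removable singularities are obtained through \<open>remove_sings\<close>, which replaces
  them by the limits. In the half-plane \<open>Re s > -1\<close> this only matters for \<open>moment_formula1\<close> at
  \<open>s = -2/3\<close>.
\<close>

definition moment_formula1 :: "complex \<Rightarrow> complex" where
  "moment_formula1 = remove_sings (\<lambda>s.
     Gamma (s + 1) * Gamma (s + 2/3) / (Gamma (2/3) * Gamma (3 * s / 2 + 1))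
       * of_real (3 / sqrt 8) powr s)"

definition moment_formula2 :: "complex \<Rightarrow> complex" where
  "moment_formula2 = remove_sings (\<lambda>s.
     Gamma (s + 1) * Gamma (s + 5/3) / (Gamma (5/3) * Gamma (3 * s / 2 + 2))
       * of_real (3 / sqrt 8) powr s)"

definition moment_formula3 :: "complex \<Rightarrow> complex" where
  "moment_formula3 = remove_sings (\<lambda>s.
     of_real (2 * Gamma (1/3) / (3 * sqrt pi))
       * (Gamma (3 * s / 2 + 3/2) / Gamma (s + 4/3))
       * of_real (sqrt 8 / 9) powr s)"

definition moment_formula4 :: "complex \<Rightarrow> complex" where
  "moment_formula4 = remove_sings (\<lambda>s.
     of_real (Gamma (1/3) / (2 powr (1/3) * pi))
       * (Gamma (s / 2 + 1/2) * Gamma (s / 2 + 5/6) / Gamma (s / 2 + 2/3))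
       * (2/3) powr (s / 2))"

end

theory Submission
  imports Defs
begin

text \<open>
  Let \<open>T\<close> be independent of the Brownian motion, with density \<open>t/4 exp (-t/2)\<close>. Then \<open>T\<^sup>3\<^sup>/\<^sup>2 A\<close>
  has the law of \<open>3 G V\<close>, where \<open>G\<close> and \<open>V\<close> are independent Gamma variables with parameters
  \<open>5/3\<close> and 1, and comparing moments gives the second formula. To compare Laplace transforms, let
  \<open>g s y\<close> be the expectation of the integral of \<open>1/2 exp (-t/2 - m \<integral>\<^sub>0\<^sup>t S)\<close> over \<open>t \<ge> 0\<close>, when the
  maximum \<open>S\<close> starts at \<open>s\<close> and the gap between \<open>S\<close> and the path starts at \<open>y\<close>. The maximum is
  constant while the gap is positive, so \<open>g s y = 1/\<kappa>\<^sup>2 + \<chi> exp (-\<kappa> y)\<close> with \<open>\<kappa>\<^sup>2 = 1 + 2 m s\<close>, and the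
  boundary condition \<open>\<partial>\<^sub>s g + \<partial>\<^sub>y g = 0\<close> at \<open>y = 0\<close> says \<open>\<psi>' = \<kappa> \<chi>\<close> for \<open>\<psi> s = g s 0\<close>. The bounded
  solution is \<open>\<psi> s = E (\<kappa>\<^sup>3 + 3 m V) powr (-2/3)\<close>, and its derivative at \<open>s = 0\<close> is essentially the
  Laplace transform of \<open>3 G V\<close>. Stochastic calculus is avoided by evaluating this explicit \<open>g\<close> along
  Gaussian random walks: one step reproduces \<open>g\<close> in expectation up to an error, and the errors add
  up to something that vanishes with the step size.
\<close>

section \<open>The explicit solution\<close>

text \<open>The gap equation behind the form of \<open>g\<close> is
  \<open>g''/2 - (\<kappa>\<^sup>2/2) g + 1/2 = 0\<close>, since the killing rate at maximum
  \<open>s\<close> is \<open>\<kappa>\<^sup>2/2\<close>. At gap 0 it leaves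
  \<open>\<psi> = 1/\<kappa>\<^sup>2 + \<chi>\<close>, so the boundary condition, with
  \<open>\<kappa>\<close> as variable, becomes
  \<open>m d\<psi>/d\<kappa> = \<kappa>\<^sup>2 \<psi> - 1\<close>. Its solutions differ by
  multiples of \<open>exp (\<kappa>\<^sup>3 / (3 m))\<close>, hence only one is bounded:
  \<open>1/m\<close> times the integral of
  \<open>exp ((\<kappa>\<^sup>3 - r\<^sup>3) / (3 m))\<close> over \<open>r \<ge> \<kappa>\<close>.
  The substitution \<open>r\<^sup>3 = \<kappa>\<^sup>3 + 3 m v\<close> turns it into the expectation
  over \<open>V\<close>; this is the origin of the exponent \<open>-2/3\<close>, and one
  differentiation makes it \<open>-5/3\<close>. The passage from walks to the path rests on scaling:
  standardized Gaussian increments have the same law for every step size, so \<open>k\<close> steps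
  of any length are a rescaled grid of \<open>[0,1]\<close>, where continuity of the path gives
  convergence. The four Gamma formulas are linked by Legendre duplication and Gauss
  triplication.\<close>

abbreviation exp_measure :: "real measure" where
  "exp_measure \<equiv> density lborel (exponential_density 1)"

lemma prob_space_exp_measure: "prob_space exp_measure"
  by (rule prob_space_exponential_density) simp

lemma AE_exp_measure_nonneg: "AE v in exp_measure. 0 \<le> v"
  by (subst AE_density) (auto simp: exponential_density_def)

lemma nn_integral_exp_measure:
  assumes [measurable]: "f \<in> borel_measurable borel"
  shows "(\<integral>\<^sup>+v. f v \<partial>exp_measure) = (\<integral>\<^sup>+v. f v * ennreal (exp (-v)) * indicator {0..} v \<partial>lborel)"
  by (subst nn_integral_density)
     (auto intro!: nn_integral_cong simp: exponential_density_def mult_ac split: split_indicator)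

lemma integrable_exp_measure_bounded:
  fixes f :: "real \<Rightarrow> real"
  assumes [measurable]: "f \<in> borel_measurable borel"
    and "\<And>v. 0 \<le> v \<Longrightarrow> \<bar>f v\<bar> \<le> C"
  shows "integrable exp_measure f"
proof -
  interpret prob_space exp_measure by (rule prob_space_exp_measure)
  show ?thesis
    by (rule integrable_const_bound[where B=C])
       (use assms AE_exp_measure_nonneg in \<open>auto elim: eventually_mono\<close>)
qed

text \<open>\<open>psi\<close>, \<open>chi\<close> and \<open>gfun\<close> are the functions \<open>\<psi>\<close>, \<open>\<chi>\<close> and \<open>g\<close> described at the top, and \<open>m\<close> is the
  argument of the Laplace transform.\<close>

definition kap :: "real \<Rightarrow> real \<Rightarrow> real" where
  "kap m s = sqrt (1 + 2 * m * s)"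

definition psi :: "real \<Rightarrow> real \<Rightarrow> real" where
  "psi m s = (\<integral>v. (kap m s ^ 3 + 3 * m * v) powr (-2/3) \<partial>exp_measure)"

definition chi :: "real \<Rightarrow> real \<Rightarrow> real" where
  "chi m s = - 2 * m * (\<integral>v. (kap m s ^ 3 + 3 * m * v) powr (-5/3) \<partial>exp_measure)"

definition gfun :: "real \<Rightarrow> real \<Rightarrow> real \<Rightarrow> real" where
  "gfun m s y = 1 / (kap m s)\<^sup>2 + chi m s * exp (- kap m s * y)"

lemma kap_ge_1: "m \<ge> 0 \<Longrightarrow> s \<ge> 0 \<Longrightarrow> kap m s \<ge> 1"
  by (simp add: kap_def)

lemma kap_sq: "m \<ge> 0 \<Longrightarrow> s \<ge> 0 \<Longrightarrow> (kap m s)\<^sup>2 = 1 + 2 * m * s"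
  by (simp add: kap_def)

lemma powr_neg_le_1: "1 \<le> x \<Longrightarrow> a \<le> 0 \<Longrightarrow> x powr a \<le> (1::real)"
  using powr_mono[of a 0 x] by simp

lemma kap_powr: "m \<ge> 0 \<Longrightarrow> s \<ge> 0 \<Longrightarrow> kap m s powr a = (1 + 2 * m * s) powr (a / 2)"
  by (simp add: kap_def powr_half_sqrt[symmetric] powr_powr)

lemma cube_powr: "k > 0 \<Longrightarrow> (k ^ 3) powr a = (k::real) powr (3 * a)"
  using powr_powr[of k 3 a] by simp

lemma kap_cube: "m \<ge> 0 \<Longrightarrow> s \<ge> 0 \<Longrightarrow> kap m s ^ 3 = (1 + 2 * m * s) powr (3/2)"
  using kap_powr[of m s 3] kap_ge_1[of m s] by (simp add: powr_numeral)

lemma integrable_kap_powr: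
  assumes "m \<ge> 0" "s \<ge> 0" "a \<le> 0"
  shows "integrable exp_measure (\<lambda>v. (kap m s ^ 3 + 3 * m * v) powr a)"
proof (rule integrable_exp_measure_bounded)
  fix v :: real assume "0 \<le> v"
  hence "1 \<le> kap m s ^ 3 + 3 * m * v"
    using one_le_power[OF kap_ge_1[OF assms(1,2)], of 3] assms
    by (smt (verit) mult_nonneg_nonneg)
  thus "\<bar>(kap m s ^ 3 + 3 * m * v) powr a\<bar> \<le> 1"
    using assms by (simp add: powr_neg_le_1)
qed simp

text \<open>The left-hand integrand times \<open>exp (-v)\<close> is the derivative of \<open>- (c + 3 m v) powr (-2/3) exp (-v)\<close>.\<close>

lemma exp_measure_by_parts:
  fixes c m :: real
  assumes c: "c \<ge> 1" and m: "m \<ge> 0"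
  shows "(\<integral>v. (c + 3 * m * v) powr (-2/3) + 2 * m * (c + 3 * m * v) powr (-5/3) \<partial>exp_measure)
    = c powr (-2/3)"
proof -
  define f where "f v = (c + 3 * m * v) powr (-2/3) + 2 * m * (c + 3 * m * v) powr (-5/3)" for v
  have [measurable]: "f \<in> borel_measurable borel" unfolding f_def by measurable
  have pos: "c + 3 * m * v \<ge> 1" if "v \<ge> 0" for v
    using c m that by (smt (verit) mult_nonneg_nonneg)
  have f0: "f v \<ge> 0" for v using m by (simp add: f_def)
  have "(\<integral>\<^sup>+v. ennreal (f v) \<partial>exp_measure)
      = (\<integral>\<^sup>+v. ennreal (f v * exp (-v)) * indicator {0..} v \<partial>lborel)"
    by (subst nn_integral_exp_measure) (auto simp: ennreal_mult'' f0)
  also have "\<dots> = ennreal (0 - (- ((c + 3 * m * 0) powr (-2/3)) * exp (- 0)))"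
  proof (rule nn_integral_FTC_atLeast)
    fix x :: real assume "0 \<le> x"
    note p = pos[OF this]
    show "((\<lambda>v. - ((c + 3 * m * v) powr (-2/3)) * exp (-v)) has_real_derivative f x * exp (- x)) (at x)"
      using p by (auto intro!: derivative_eq_intros simp: f_def algebra_simps)
    show "0 \<le> f x * exp (- x)" using f0 by simp
  next
    have "((\<lambda>v. exp (-v)) \<longlongrightarrow> (0::real)) at_top"
      using exp_at_bot filterlim_uminus_at_bot_at_top by (rule filterlim_compose)
    moreover have "\<forall>\<^sub>F v in at_top. norm (- ((c + 3 * m * v) powr (-2/3)) * exp (-v)) \<le> exp (-v)"
      using eventually_ge_at_top[of 0]
      by eventually_elim (use pos powr_neg_le_1 in \<open>auto simp: abs_mult\<close>)
    ultimately show "((\<lambda>v. - ((c + 3 * m * v) powr (-2/3)) * exp (-v)) \<longlongrightarrow> 0) at_top"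
      by (rule Lim_null_comparison[rotated])
  qed simp
  finally have "(\<integral>\<^sup>+v. ennreal (f v) \<partial>exp_measure) = ennreal (c powr (-2/3))" by simp
  hence "(\<integral>v. f v \<partial>exp_measure) = c powr (-2/3)"
    by (subst integral_eq_nn_integral) (auto simp: f0)
  thus ?thesis by (simp add: f_def)
qed

text \<open>The boundary term \<open>(kap m s ^ 3) powr (-2/3)\<close> of the integration by parts
  is \<open>1 / (kap m s)\<^sup>2\<close>. The identity makes \<open>psi\<close> the value of
  \<open>gfun\<close> at gap 0, which the separate integral definitions do not show.\<close>

lemma psi_eq:
  assumes "m \<ge> 0" "s \<ge> 0"
  shows "psi m s = 1 / (kap m s)\<^sup>2 + chi m s"
proof -
  have k: "kap m s \<ge> 1" by (rule kap_ge_1) fact+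
  have "(kap m s ^ 3) powr (-2/3) = 1 / (kap m s)\<^sup>2"
    using k powr_minus_divide[of "kap m s" 2] by (simp add: cube_powr)
  hence "1 / (kap m s)\<^sup>2 = (\<integral>v. (kap m s ^ 3 + 3 * m * v) powr (-2/3)
      + 2 * m * (kap m s ^ 3 + 3 * m * v) powr (-5/3) \<partial>exp_measure)"
    using exp_measure_by_parts[of "kap m s ^ 3" m] assms k by simp
  also have "\<dots> = psi m s - chi m s"
    unfolding psi_def chi_def using assms
    by (subst Bochner_Integration.integral_add) (auto intro!: integrable_kap_powr integrable_mult_right)
  finally show ?thesis by simp
qed

text \<open>Dropping \<open>3 * m * v\<close> from the base bounds the integral by
  \<open>1 / kap m s ^ 5\<close>. So \<open>chi\<close> absorbs up to five powers of
  \<open>kap\<close>, and the derivatives of \<open>chi m s * exp (- kap m s * y)\<close> in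
  \<open>y\<close> that occur below stay bounded uniformly in \<open>s\<close>.\<close>

lemma chi_bounds:
  assumes "m \<ge> 0" "s \<ge> 0" "n \<le> 5"
  shows "chi m s \<le> 0" "\<bar>chi m s\<bar> * kap m s ^ n \<le> 2 * m"
proof -
  interpret prob_space exp_measure by (rule prob_space_exp_measure)
  define I where "I = (\<integral>v. (kap m s ^ 3 + 3 * m * v) powr (-5/3) \<partial>exp_measure)"
  have k: "kap m s \<ge> 1" by (rule kap_ge_1) fact+
  have I0: "I \<ge> 0" unfolding I_def by (rule integral_nonneg_AE) simp
  have "I \<le> (\<integral>v. (kap m s ^ 3) powr (-5/3) \<partial>exp_measure)"
    unfolding I_def
  proof (rule integral_mono_AE)
    show "AE v in exp_measure. (kap m s ^ 3 + 3 * m * v) powr (-5/3) \<le> (kap m s ^ 3) powr (-5/3)"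
      using AE_exp_measure_nonneg
      by eventually_elim (use k assms in \<open>auto intro!: powr_mono2'\<close>)
  qed (use integrable_kap_powr assms in auto)
  also have "\<dots> = 1 / kap m s ^ 5"
    using k  powr_minus_divide[of "kap m s" 5] prob_space[simplified] by (simp add: cube_powr)
  finally have I1: "I * kap m s ^ 5 \<le> 1" using k by (simp add: field_simps)
  have "I * kap m s ^ n \<le> I * kap m s ^ 5"
    using k I0 assms by (intro mult_left_mono power_increasing) auto
  with I1 have I2: "I * kap m s ^ n \<le> 1" by linarith
  have c: "chi m s = - 2 * m * I" by (simp add: chi_def I_def)
  show "chi m s \<le> 0" using c I0 assms by simp
  have "\<bar>chi m s\<bar> * kap m s ^ n = 2 * m * (I * kap m s ^ n)"
    using c I0 assms by (simp add: abs_mult)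
  also have "\<dots> \<le> 2 * m" using I2 assms mult_left_mono[of "I * kap m s ^ n" 1 "2 * m"] by simp
  finally show "\<bar>chi m s\<bar> * kap m s ^ n \<le> 2 * m" .
qed

text \<open>For fixed \<open>v\<close> the second derivative in \<open>s\<close> is
  \<open>- 2 * m\<^sup>2\<close> times one term plus \<open>10 * m\<^sup>2\<close> times another.
  Both terms lie between 0 and 1 because \<open>p s\<close> is at least 1 and at least
  \<open>(1 + 2 * m * s) powr (3/2)\<close>. Half of 10 is the constant of the bound.\<close>

lemma integrand_taylor:
  fixes m v s d :: real
  assumes m: "m \<ge> 0" and v: "v \<ge> 0" and s: "s \<ge> 0" and d: "d \<ge> 0"
  defines "p \<equiv> \<lambda>s. (1 + 2 * m * s) powr (3/2) + 3 * m * v"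
  shows "\<bar>p (s + d) powr (-2/3) - p s powr (-2/3)
      + 2 * m * d * ((1 + 2 * m * s) powr (1/2) * p s powr (-5/3))\<bar> \<le> 5 * m\<^sup>2 * d\<^sup>2"
proof (cases "d = 0")
  case False
  hence d: "d > 0" using d by simp
  let ?r = "\<lambda>s. 1 + 2 * m * s"
  define D where "D = (\<lambda>k::nat. if k = 0 then (\<lambda>s. p s powr (-2/3))
     else if k = 1 then (\<lambda>s. - 2 * m * (?r s powr (1/2) * p s powr (-5/3)))
     else (\<lambda>s. - 2 * m\<^sup>2 * (?r s powr (-1/2) * p s powr (-5/3))
        + 10 * m\<^sup>2 * (?r s * p s powr (-8/3))))"
  have r1: "?r t \<ge> 1" if "t \<ge> s" for t using m s that by simp
  have p1: "p t \<ge> ?r t powr (3/2)" "p t \<ge> 1" if "t \<ge> s" for t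
  proof -
    show "p t \<ge> ?r t powr (3/2)" using m v by (simp add: p_def)
    moreover have "?r t powr (3/2) \<ge> 1" using r1[OF that] by (simp add: ge_one_powr_ge_zero)
    ultimately show "p t \<ge> 1" by simp
  qed
  have dp: "(p has_real_derivative 3 * m * ?r t powr (1/2)) (at t)" if "t \<ge> s" for t
    unfolding p_def using r1[OF that] by (auto intro!: derivative_eq_intros)
  have dr: "((\<lambda>t. ?r t powr (1/2)) has_real_derivative m * ?r t powr (-1/2)) (at t)" if "t \<ge> s" for t
    using r1[OF that] by (auto intro!: derivative_eq_intros)
  have rr: "?r t powr (1/2) * ?r t powr (1/2) = ?r t" if "t \<ge> s" for t
    using r1[OF that] by (simp flip: powr_add)
  have "\<exists>t. (if s + d < s then s + d < t \<and> t < s else s < t \<and> t < s + d) \<and>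
     p (s + d) powr (-2/3) = (\<Sum>k<2. (D k s / fact k) * ((s + d) - s)^k) + (D 2 t / fact 2) * ((s + d) - s)^2"
  proof (rule Taylor[where a=s and b="s+d" and diff=D])
    show "\<forall>k t. k < 2 \<and> s \<le> t \<and> t \<le> s + d \<longrightarrow> (D k has_real_derivative D (Suc k) t) (at t)"
    proof (intro allI impI, elim conjE)
      fix k t assume k: "k < (2::nat)" and t: "s \<le> t"
      note pp = p1[OF t] and rt = r1[OF t]
      show "(D k has_real_derivative D (Suc k) t) (at t)"
      proof (cases "k = 0")
        case True
        have "((\<lambda>s. p s powr (-2/3)) has_real_derivative D 1 t) (at t)"
          using pp unfolding D_def
          by (auto intro!: derivative_eq_intros dp[OF t] simp: field_simps)
        thus ?thesis using True by (simp add: D_def)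
      next
        case False
        hence k: "k = 1" using k by simp
        have *: "((\<lambda>s. p s powr (-5/3)) has_real_derivative -5/3 * p t powr (-8/3) * (3 * m * ?r t powr (1/2))) (at t)"
          using pp by (auto intro!: derivative_eq_intros dp[OF t])
        have "((\<lambda>s. - 2 * m * (?r s powr (1/2) * p s powr (-5/3))) has_real_derivative 
           - 2 * m * (m * ?r t powr (-1/2) * p t powr (-5/3) + (-5/3 * p t powr (-8/3) * (3 * m * ?r t powr (1/2))) * ?r t powr (1/2))) (at t)"
          by (rule DERIV_cmult[OF DERIV_mult[OF dr[OF t] *]])
        also have "- 2 * m * (m * ?r t powr (-1/2) * p t powr (-5/3) + (-5/3 * p t powr (-8/3) * (3 * m * ?r t powr (1/2))) * ?r t powr (1/2))
           = - 2 * m\<^sup>2 * (?r t powr (-1/2) * p t powr (-5/3)) + 10 * m\<^sup>2 * ((?r t powr (1/2) * ?r t powr (1/2)) * p t powr (-8/3))"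
          by (simp add: algebra_simps power2_eq_square)
        finally show ?thesis using k rr[OF t] by (simp add: D_def)
      qed
    qed
  qed (use d in \<open>auto simp: D_def\<close>)
  then obtain t where t: "s < t" 
    and eq: "p (s + d) powr (-2/3) = (\<Sum>k<2. (D k s / fact k) * d^k) + (D 2 t / fact 2) * d^2"
    using d by auto
  have ts: "t \<ge> s" using t by simp
  have a1: "?r t powr (-1/2) * p t powr (-5/3) \<le> 1 * 1" "?r t powr (-1/2) * p t powr (-5/3) \<ge> 0"
    using r1[OF ts] p1[OF ts] by (intro mult_mono powr_neg_le_1; simp)+ simp
  have "p t powr (-8/3) \<le> (?r t powr (3/2)) powr (-8/3)"
    using p1[OF ts] r1[OF ts] by (intro powr_mono2') auto
  also have "\<dots> = ?r t powr (-4)" by (simp add: powr_powr)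
  also have "\<dots> \<le> ?r t powr (-1)" using r1[OF ts] by (intro powr_mono) auto
  finally have "?r t * p t powr (-8/3) \<le> ?r t * ?r t powr (-1)"
    using r1[OF ts] by (intro mult_left_mono) auto
  also have "\<dots> = 1" using r1[OF ts] by (simp add: powr_minus_divide)
  finally have a2: "?r t * p t powr (-8/3) \<le> 1" .
  have a3: "?r t * p t powr (-8/3) \<ge> 0" using r1[OF ts] by simp
  have "D 2 t = - 2 * (m\<^sup>2 * (?r t powr (-1/2) * p t powr (-5/3))) + 10 * (m\<^sup>2 * (?r t * p t powr (-8/3)))"
    by (simp add: D_def)
  moreover have "m\<^sup>2 * (?r t powr (-1/2) * p t powr (-5/3)) \<le> m\<^sup>2 * 1" "m\<^sup>2 * (?r t powr (-1/2) * p t powr (-5/3)) \<ge> 0"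
    using a1 by (intro mult_left_mono) auto
  moreover have "m\<^sup>2 * (?r t * p t powr (-8/3)) \<le> m\<^sup>2 * 1"
    using a2 by (intro mult_left_mono) auto
  moreover have "m\<^sup>2 * (?r t * p t powr (-8/3)) \<ge> 0"
    by (intro mult_nonneg_nonneg a3) simp
  ultimately have "\<bar>D 2 t\<bar> \<le> 10 * m\<^sup>2" by linarith
  hence "\<bar>D 2 t / 2 * d\<^sup>2\<bar> \<le> 5 * m\<^sup>2 * d\<^sup>2"
    using mult_right_mono[of "\<bar>D 2 t\<bar>" "10 * m\<^sup>2" "d\<^sup>2"] by (simp add: abs_mult)
  moreover have "p (s + d) powr (-2/3) - p s powr (-2/3)
      + 2 * m * d * (?r s powr (1/2) * p s powr (-5/3)) = D 2 t / 2 * d\<^sup>2"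
    using eq by (simp add: D_def numeral_2_eq_2)
  ultimately show ?thesis by simp
qed auto

text \<open>Averaging the pointwise expansion over \<open>v\<close> replaces differentiation under
  the integral, and the linear term becomes \<open>kap m s * chi m s\<close>. This is the boundary
  condition for \<open>psi\<close> with a remainder uniform in \<open>s\<close>.\<close>

lemma psi_taylor:
  assumes m: "m \<ge> 0" and s: "s \<ge> 0" and d: "d \<ge> 0"
  shows "\<bar>psi m (s + d) - psi m s - d * kap m s * chi m s\<bar> \<le> 5 * m\<^sup>2 * d\<^sup>2"
proof -
  interpret prob_space exp_measure by (rule prob_space_exp_measure)
  let ?p = "\<lambda>s v. kap m s ^ 3 + 3 * m * v"
  let ?f = "\<lambda>v. ?p (s + d) v powr (-2/3) - ?p s v powr (-2/3) + 2 * m * d * (kap m s * ?p s v powr (-5/3))"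
  have int: "integrable exp_measure ?f"
    using m s d
    by (intro Bochner_Integration.integrable_add Bochner_Integration.integrable_diff
        integrable_mult_right integrable_kap_powr) auto
  have k1: "kap m s = (1 + 2 * m * s) powr (1/2)"
    using m s by (simp add: kap_def powr_half_sqrt)
  have AE: "AE v in exp_measure. norm (?f v) \<le> 5 * m\<^sup>2 * d\<^sup>2"
    using AE_exp_measure_nonneg
  proof eventually_elim
    case (elim v)
    show ?case using integrand_taylor[OF m elim s d]
      unfolding kap_cube[OF m s] kap_cube[OF m add_nonneg_nonneg[OF s d]] unfolding k1 real_norm_def .
  qed
  have "norm (\<integral>v. ?f v \<partial>exp_measure) \<le> (\<integral>v. 5 * m\<^sup>2 * d\<^sup>2 \<partial>exp_measure)"
    by (rule order_trans[OF integral_norm_bound integral_mono_AE[OF integrable_norm[OF int] _ AE]]) simp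
  hence "norm (\<integral>v. ?f v \<partial>exp_measure) \<le> 5 * m\<^sup>2 * d\<^sup>2"
    using prob_space[simplified] by simp
  moreover have "psi m (s + d) - psi m s - d * kap m s * chi m s = (\<integral>v. ?f v \<partial>exp_measure)"
    unfolding psi_def chi_def using m s d
    by (subst Bochner_Integration.integral_add,
        (intro Bochner_Integration.integrable_diff integrable_mult_right integrable_kap_powr; simp)+,
        subst Bochner_Integration.integral_diff, (intro integrable_kap_powr; simp)+) simp
  ultimately show ?thesis by (simp only: real_norm_def)
qed

section \<open>Error of one step for the explicit solution\<close>

lemma exp_minus_taylor1:
  fixes x :: real
  assumes "x \<ge> 0"
  shows "0 \<le> exp (-x) - 1 + x" "exp (-x) - 1 + x \<le> x\<^sup>2 / 2"
proof -
  show "0 \<le> exp (-x) - 1 + x" using exp_ge_add_one_self[of "-x"] by simp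
  show "exp (-x) - 1 + x \<le> x\<^sup>2 / 2"
  proof (cases "x = 0")
    case False
    have "\<exists>t. (if x < 0 then x < t \<and> t < 0 else 0 < t \<and> t < x) \<and>
       exp (-x) = (\<Sum>k<2. ((-1)^k * exp (-0) / fact k) * (x - 0)^k) + ((-1)^2 * exp (-t) / fact 2) * (x - 0)^2"
      by (rule Taylor[where a=0 and b=x and diff="\<lambda>k t. (-1)^k * exp (-t)"])
         (use False assms in \<open>auto intro!: derivative_eq_intros\<close>)
    then obtain t where t: "t > 0" and "exp (-x) = 1 - x + exp (-t) / 2 * x\<^sup>2"
      using assms by (auto simp: numeral_2_eq_2)
    moreover have "exp (-t) / 2 * x\<^sup>2 \<le> 1 / 2 * x\<^sup>2"
      using t by (intro mult_right_mono) auto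
    ultimately show ?thesis by simp
  qed auto
qed

lemma exp_taylor2:
  fixes a b :: real
  assumes "a \<ge> 0" "b \<ge> 0"
  shows "\<bar>exp (-b) - exp (-a) * (1 + (a - b) + (a - b)\<^sup>2 / 2)\<bar> \<le> \<bar>a - b\<bar> ^ 3 / 6"
proof (cases "a = b")
  case False
  have "\<exists>t. (if b < a then b < t \<and> t < a else a < t \<and> t < b) \<and>
     exp (-b) = (\<Sum>k<3. ((-1)^k * exp (-a) / fact k) * (b - a)^k) + ((-1)^3 * exp (-t) / fact 3) * (b - a)^3"
    by (rule Taylor[where a="min a b" and b="max a b" and diff="\<lambda>k t. (-1)^k * exp (-t)"])
       (use False in \<open>auto intro!: derivative_eq_intros\<close>)
  then obtain t where t0: "if b < a then b < t \<and> t < a else a < t \<and> t < b"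
    and eq: "exp (-b) = (\<Sum>k<3. ((-1)^k * exp (-a) / fact k) * (b - a)^k) + ((-1)^3 * exp (-t) / fact 3) * (b - a)^3"
    by blast
  have t: "t \<ge> 0" using t0 assms by (auto split: if_splits)
  have "exp (-b) - exp (-a) * (1 + (a - b) + (a - b)\<^sup>2 / 2) = - exp (-t) / 6 * (b - a)^3"
    using eq by (simp add: eval_nat_numeral algebra_simps)
  also have "\<bar>\<dots>\<bar> = exp (-t) * (\<bar>a - b\<bar>^3 / 6)"
    by (simp add: abs_mult power_abs abs_minus_commute)
  also have "\<dots> \<le> 1 * (\<bar>a - b\<bar>^3 / 6)" using t by (intro mult_right_mono) auto
  finally show ?thesis by simp
qed auto

text \<open>Here \<open>e\<close> is the increment of the path and \<open>d\<close> the resulting increase of the maximum. The term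
  \<open>\<bar>e\<bar> * d\<close> cannot be improved to third order, but the \<open>d\<close> of a whole path add up to its maximum.\<close>

lemma gfun_step:
  assumes m: "m \<ge> 0" and s: "s \<ge> 0" and y: "y \<ge> 0" and d: "d = max (e - y) 0"
  shows "\<bar>gfun m (s + d) (y - e + d) - gfun m s y
      - chi m s * exp (- kap m s * y) * (kap m s * e + (kap m s)\<^sup>2 * e\<^sup>2 / 2)\<bar>
    \<le> (5 * m\<^sup>2 + 5 * m) * (\<bar>e\<bar> ^ 3 + \<bar>e\<bar> * d)"
proof (cases "e \<le> y")
  case True
  define k where "k = kap m s"
  define X where "X = chi m s"
  have k: "k \<ge> 1" unfolding k_def by (rule kap_ge_1) fact+
  have d0: "d = 0" using d True by simp
  have "gfun m (s + d) (y - e + d) - gfun m s y - X * exp (- k * y) * (k * e + k\<^sup>2 * e\<^sup>2 / 2)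
     = X * (exp (- (k * (y - e))) - exp (- (k * y)) * (1 + (k * y - k * (y - e)) + (k * y - k * (y - e))\<^sup>2 / 2))"
    unfolding gfun_def d0 X_def k_def by (simp add: algebra_simps power_mult_distrib)
  also have "\<bar>\<dots>\<bar> \<le> \<bar>X\<bar> * (\<bar>k * y - k * (y - e)\<bar> ^ 3 / 6)"
    unfolding abs_mult using k y True by (intro mult_left_mono exp_taylor2) auto
  also have "\<dots> = (\<bar>X\<bar> * k ^ 3) * (\<bar>e\<bar> ^ 3 / 6)"
    using k by (simp add: algebra_simps abs_mult power_mult_distrib)
  also have "\<dots> \<le> (2 * m) * (\<bar>e\<bar> ^ 3 / 6)"
    using chi_bounds(2)[OF m s, of 3] unfolding X_def k_def by (intro mult_right_mono) auto
  also have "\<dots> \<le> (5 * m\<^sup>2 + 5 * m) * (\<bar>e\<bar> ^ 3 + \<bar>e\<bar> * d)"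
  proof -
    have "2 * m / 6 * \<bar>e\<bar> ^ 3 \<le> (5 * m\<^sup>2 + 5 * m) * \<bar>e\<bar> ^ 3" using m by (intro mult_right_mono) auto
    thus ?thesis using d0 by simp
  qed
  finally show ?thesis by (simp add: X_def k_def)
next
  case False
  define k where "k = kap m s"
  define X where "X = chi m s"
  have k: "k \<ge> 1" unfolding k_def by (rule kap_ge_1) fact+
  have e: "e = y + d" and d0: "d > 0" using d False by auto
  define E where "E = exp (- (k * y))"
  have E01: "0 \<le> E" "E \<le> 1" using k y by (auto simp: E_def)
  have kd: "kap m (s + d) \<ge> 1" using kap_ge_1[OF m, of "s + d"] s d0 by simp
  \<comment> \<open>The step ends at a new maximum: the gap is 0 again, and \<open>gfun\<close> is
    \<open>psi\<close> there.\<close>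
  have g1: "gfun m (s + d) (y - e + d) = psi m (s + d)"
  proof -
    have "y - e + d = 0" using e by simp
    thus ?thesis using psi_eq[OF m, of "s + d"] s d0 unfolding gfun_def by simp
  qed
  have g2: "gfun m s y = psi m s - X + X * E"
    using psi_eq[OF m s] by (simp add: gfun_def X_def E_def k_def)
  \<comment> \<open>The step \<open>e = y + d\<close> is split at the old maximum. \<open>R1\<close>
    is the error of the boundary condition over \<open>d\<close>, and \<open>R2\<close> the
    expansion error over \<open>y\<close>. The slope terms \<open>d * k * X\<close> from
    \<open>psi\<close> and \<open>d * k * X * E\<close> from the expansion cancel up to
    \<open>X * R3\<close>, which is small because \<open>1 - E \<le> k * y\<close>.
    \<open>R4\<close> collects the second-order terms containing \<open>d\<close>.\<close>
  define R1 where "R1 = psi m (s + d) - psi m s - d * k * X"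
  define R2 where "R2 = 1 - E * (1 + k * y + (k * y)\<^sup>2 / 2)"
  define R3 where "R3 = d * k * (1 - E)"
  define R4 where "R4 = E * k\<^sup>2 * (2 * y * d + d\<^sup>2) / 2"
  have eq: "gfun m (s + d) (y - e + d) - gfun m s y - X * exp (- k * y) * (k * e + k\<^sup>2 * e\<^sup>2 / 2)
     = R1 + X * R2 + X * R3 - X * R4"
  proof -
    have "exp (- k * y) = E" by (simp add: E_def)
    thus ?thesis unfolding g1 g2 R1_def R2_def R3_def R4_def
      unfolding e by (simp only:) (simp add: field_simps power2_eq_square)
  qed
  have y1: "y \<le> \<bar>e\<bar>" and d1: "d \<le> \<bar>e\<bar>" using e y d0 by auto
  have dd: "d\<^sup>2 \<le> \<bar>e\<bar> * d" "y * d \<le> \<bar>e\<bar> * d"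
    using y1 d1 d0 unfolding power2_eq_square by (auto intro!: mult_right_mono)
  have "\<bar>R1\<bar> \<le> 5 * m\<^sup>2 * d\<^sup>2" unfolding R1_def k_def X_def
    using psi_taylor[OF m s, of d] d0 by simp
  also have "\<dots> \<le> 5 * m\<^sup>2 * (\<bar>e\<bar> * d)" using dd by (intro mult_left_mono) auto
  finally have b1: "\<bar>R1\<bar> \<le> 5 * m\<^sup>2 * (\<bar>e\<bar> * d)" .
  have "\<bar>R2\<bar> \<le> (k * y) ^ 3 / 6"
    using exp_taylor2[of "k * y" 0] k y unfolding R2_def E_def by simp
  hence "\<bar>X * R2\<bar> \<le> \<bar>X\<bar> * ((k * y) ^ 3 / 6)" unfolding abs_mult by (intro mult_left_mono) auto
  also have "\<dots> = (\<bar>X\<bar> * k ^ 3) * (y ^ 3 / 6)" by (simp add: power_mult_distrib)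
  also have "\<dots> \<le> (2 * m) * (\<bar>e\<bar> ^ 3 / 6)"
    using chi_bounds(2)[OF m s, of 3] y y1 m unfolding X_def k_def
    by (intro mult_mono[where c="y ^ 3 / 6"] divide_right_mono power_mono) auto
  finally have b2: "\<bar>X * R2\<bar> \<le> (2 * m) * (\<bar>e\<bar> ^ 3 / 6)" .
  have "1 - E \<le> k * y" using exp_ge_add_one_self[of "- (k * y)"] by (simp add: E_def)
  hence "\<bar>R3\<bar> \<le> d * k * (k * y)"
    unfolding R3_def abs_mult using E01 k d0 by (intro mult_mono) auto
  hence "\<bar>X * R3\<bar> \<le> \<bar>X\<bar> * (d * k * (k * y))" unfolding abs_mult by (intro mult_left_mono) auto
  also have "\<dots> = (\<bar>X\<bar> * k\<^sup>2) * (y * d)" by (simp add: power2_eq_square)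
  also have "\<dots> \<le> (2 * m) * (\<bar>e\<bar> * d)"
    using chi_bounds(2)[OF m s, of 2] dd y m d0 unfolding X_def k_def by (rule_tac mult_mono) auto
  finally have b3: "\<bar>X * R3\<bar> \<le> (2 * m) * (\<bar>e\<bar> * d)" .
  have dd4: "y * d + d\<^sup>2 / 2 \<le> \<bar>e\<bar> * d + (\<bar>e\<bar> * d) / 2" using dd by linarith
  have "\<bar>R4\<bar> = E * (k\<^sup>2 * (2 * y * d + d\<^sup>2) / 2)"
    unfolding R4_def using E01 y d0 by (simp add: abs_mult)
  also have "\<dots> \<le> 1 * (k\<^sup>2 * (2 * y * d + d\<^sup>2) / 2)"
    using E01 y d0 by (intro mult_right_mono) auto
  finally have "\<bar>X * R4\<bar> \<le> \<bar>X\<bar> * (k\<^sup>2 * (2 * y * d + d\<^sup>2) / 2)"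
    unfolding abs_mult by (intro mult_left_mono) auto
  also have "\<dots> = (\<bar>X\<bar> * k\<^sup>2) * (y * d + d\<^sup>2 / 2)" by (simp add: algebra_simps)
  also have "\<dots> \<le> (2 * m) * (\<bar>e\<bar> * d + (\<bar>e\<bar> * d) / 2)"
    using chi_bounds(2)[OF m s, of 2] dd y m d0 unfolding X_def k_def
    using dd4 by (rule_tac mult_mono) auto
  finally have b4: "\<bar>X * R4\<bar> \<le> (2 * m) * (\<bar>e\<bar> * d + (\<bar>e\<bar> * d) / 2)" .
  have "\<bar>R1 + X * R2 + X * R3 - X * R4\<bar> \<le> 5 * m\<^sup>2 * (\<bar>e\<bar> * d) + (2 * m) * (\<bar>e\<bar> ^ 3 / 6)
      + (2 * m) * (\<bar>e\<bar> * d) + (2 * m) * (\<bar>e\<bar> * d + (\<bar>e\<bar> * d) / 2)"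
    using b1 b2 b3 b4 by linarith
  also have "\<dots> = (5 * m\<^sup>2 + 5 * m) * (\<bar>e\<bar> * d) + (m / 3) * \<bar>e\<bar> ^ 3" by (simp add: algebra_simps)
  also have "\<dots> \<le> (5 * m\<^sup>2 + 5 * m) * (\<bar>e\<bar> * d) + (5 * m\<^sup>2 + 5 * m) * \<bar>e\<bar> ^ 3"
    using m by (intro add_left_mono mult_right_mono) auto
  finally show ?thesis unfolding eq[unfolded X_def k_def] X_def k_def by (simp add: algebra_simps)
qed

text \<open>A discrete form of the gap equation: discounting by \<open>exp (-x)\<close> and adding
  \<open>h\<close>, the mean of the squared increment, times half the second derivative in
  \<open>y\<close> lowers \<open>g\<close> by \<open>h / 2\<close> up to order
  \<open>h\<^sup>2\<close>. The bound grows linearly in \<open>s\<close> through the square of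
  \<open>kap\<close>, so the mean of the maximum has to be controlled along the walk.\<close>

lemma gfun_discount:
  assumes m: "m \<ge> 0" and s: "s \<ge> 0" and y: "y \<ge> 0" and h: "h \<ge> 0"
  defines "x \<equiv> h * (kap m s)\<^sup>2 / 2"
  shows "\<bar>exp (-x) * gfun m s y + h * (exp (-x) * (chi m s * exp (- kap m s * y)) * (kap m s)\<^sup>2 / 2)
      - gfun m s y + h / 2\<bar> \<le> h\<^sup>2 * ((1 + 2 * m * s) / 8 + m / 2)"
proof -
  define k where "k = kap m s"
  define P where "P = chi m s * exp (- k * y)"
  have k: "k \<ge> 1" unfolding k_def by (rule kap_ge_1) fact+
  have x: "x \<ge> 0" using h by (simp add: x_def)
  have xk: "x = h * k\<^sup>2 / 2" by (simp add: x_def k_def)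
  have g: "gfun m s y = 1 / k\<^sup>2 + P" by (simp add: gfun_def P_def k_def)
  have "exp (-x) * gfun m s y + h * (exp (-x) * P * k\<^sup>2 / 2) - gfun m s y + h / 2
     = (1 / k\<^sup>2) * (exp (-x) - 1 + x) + P * (exp (-x) * (1 + x) - 1)"
    unfolding g xk using k by (simp add: field_simps)
  also have "\<bar>\<dots>\<bar> \<le> \<bar>(1 / k\<^sup>2) * (exp (-x) - 1 + x)\<bar> + \<bar>P * (exp (-x) * (1 + x) - 1)\<bar>"
    by (rule abs_triangle_ineq)
  also have "\<bar>(1 / k\<^sup>2) * (exp (-x) - 1 + x)\<bar> \<le> (1 / k\<^sup>2) * (x\<^sup>2 / 2)"
    unfolding abs_mult using exp_minus_taylor1[OF x] k by (intro mult_mono) auto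
  also have "(1 / k\<^sup>2) * (x\<^sup>2 / 2) = h\<^sup>2 * (k\<^sup>2 / 8)"
    using k by (simp add: xk field_simps power2_eq_square)
  also have "\<bar>P * (exp (-x) * (1 + x) - 1)\<bar> \<le> \<bar>chi m s\<bar> * x\<^sup>2"
  proof -
    have "exp (-x) * (1 + x) \<le> exp (-x) * exp x"
      using exp_ge_add_one_self[of x] by (intro mult_left_mono) auto
    hence 1: "exp (-x) * (1 + x) \<le> 1" by (simp flip: exp_add)
    have "(1 - x) * (1 + x) \<le> exp (-x) * (1 + x)"
      using exp_ge_add_one_self[of "-x"] x by (intro mult_right_mono) auto
    hence 2: "1 - x\<^sup>2 \<le> exp (-x) * (1 + x)" by (simp add: algebra_simps power2_eq_square)
    have 3: "\<bar>P\<bar> \<le> \<bar>chi m s\<bar> * 1"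
      unfolding P_def abs_mult using k y by (intro mult_left_mono) auto
    have "\<bar>P\<bar> * \<bar>exp (-x) * (1 + x) - 1\<bar> \<le> (\<bar>chi m s\<bar> * 1) * x\<^sup>2"
      using 1 2 by (intro mult_mono 3) auto
    thus ?thesis by (simp add: abs_mult)
  qed
  also have "\<bar>chi m s\<bar> * x\<^sup>2 = (\<bar>chi m s\<bar> * k ^ 4) * (h\<^sup>2 / 4)"
    by (simp add: xk power2_eq_square power4_eq_xxxx)
  also have "\<dots> \<le> (2 * m) * (h\<^sup>2 / 4)"
    using chi_bounds(2)[OF m s, of 4] unfolding k_def by (intro mult_right_mono) auto
  finally show ?thesis
    using kap_sq[OF m s] unfolding P_def k_def by (simp add: algebra_simps)
qed

lemma abs_gfun_le:
  assumes m: "m \<ge> 0" and s: "s \<ge> 0" and y: "y \<ge> 0"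
  shows "\<bar>gfun m s y\<bar> \<le> 1 + 2 * m"
proof -
  have k: "kap m s \<ge> 1" by (rule kap_ge_1) fact+
  have "\<bar>chi m s * exp (- kap m s * y)\<bar> \<le> \<bar>chi m s\<bar> * 1"
    unfolding abs_mult using k y by (intro mult_left_mono) auto
  moreover have "\<bar>chi m s\<bar> \<le> 2 * m" using chi_bounds(2)[OF m s, of 0] by simp
  moreover have "\<bar>1 / (kap m s)\<^sup>2\<bar> \<le> 1" using k by (simp add: divide_simps)
  ultimately show ?thesis unfolding gfun_def by linarith
qed

lemma gfun_0: "m \<ge> 0 \<Longrightarrow> s \<ge> 0 \<Longrightarrow> gfun m s 0 = psi m s"
  by (simp add: gfun_def psi_eq)

section \<open>Measurability of the explicit solution\<close>

lemma measurable_kap [measurable]: "kap m \<in> borel_measurable borel"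
  unfolding kap_def[abs_def] by measurable

lemma measurable_chi [measurable]: "chi m \<in> borel_measurable borel"
proof -
  interpret prob_space exp_measure by (rule prob_space_exp_measure)
  have [measurable]: "(\<lambda>s. \<integral>v. (kap m s ^ 3 + 3 * m * v) powr (-5/3) \<partial>exp_measure) \<in> borel_measurable borel"
    by (rule borel_measurable_lebesgue_integral) measurable
  show ?thesis unfolding chi_def[abs_def] by measurable
qed

lemma measurable_gfun [measurable (raw)]:
  assumes [measurable]: "f \<in> borel_measurable N" "g \<in> borel_measurable N"
  shows "(\<lambda>x. gfun m (f x) (g x)) \<in> borel_measurable N"
  unfolding gfun_def by measurable

section \<open>Random walks\<close>

primrec wmax :: "(nat \<Rightarrow> real) \<Rightarrow> nat \<Rightarrow> real" where
  "wmax w 0 = 0"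
| "wmax w (Suc k) = max (wmax w k) (\<Sum>i<Suc k. w i)"

definition wgap :: "(nat \<Rightarrow> real) \<Rightarrow> nat \<Rightarrow> real" where
  "wgap w k = wmax w k - (\<Sum>i<k. w i)"

text \<open>The overshoot of the next position over the old maximum, added to both the maximum and
  the gap; it is the \<open>d\<close> of \<open>gfun_step\<close>.\<close>

definition wincr :: "(nat \<Rightarrow> real) \<Rightarrow> nat \<Rightarrow> real" where
  "wincr w k = max (w k - wgap w k) 0"

lemma wmax_nonneg: "wmax w k \<ge> 0"
  by (induction k) auto

lemma wgap_nonneg: "wgap w k \<ge> 0"
  by (cases k) (auto simp: wgap_def)

lemma wmax_Suc: "wmax w (Suc k) = wmax w k + wincr w k"
  by (simp add: wgap_def wincr_def)

lemma wgap_Suc: "wgap w (Suc k) = wgap w k - w k + wincr w k"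
  by (simp add: wgap_def wincr_def)

lemma wincr_bounds: "0 \<le> wincr w k" "wincr w k \<le> \<bar>w k\<bar>"
  using wgap_nonneg[of w k] by (auto simp: wincr_def)

text \<open>The gap is reflected at 0, which can only shrink its square. Its second moment therefore
  grows no faster than that of a free walk.\<close>

lemma wgap_Suc_sq: "(wgap w (Suc k))\<^sup>2 \<le> (wgap w k - w k)\<^sup>2"
proof -
  have "wgap w (Suc k) = max (wgap w k - w k) 0" by (simp add: wgap_Suc wincr_def)
  thus ?thesis by (auto simp: max_def)
qed

text \<open>Serves to exhibit the state after \<open>k\<close> steps as a function of the first
  \<open>k\<close> increments, hence as independent of the next one.\<close>

lemma wmax_cong: "(\<And>i. i < k \<Longrightarrow> w i = w' i) \<Longrightarrow> wmax w k = wmax w' k"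
proof (induction k)
  case (Suc k)
  have "(\<Sum>i<Suc k. w i) = (\<Sum>i<Suc k. w' i)" by (rule sum.cong) (use Suc.prems in auto)
  moreover have "wmax w k = wmax w' k" using Suc by simp
  ultimately show ?case unfolding wmax.simps by simp
qed simp

lemma wgap_cong: "(\<And>i. i < k \<Longrightarrow> w i = w' i) \<Longrightarrow> wgap w k = wgap w' k"
  unfolding wgap_def by (intro arg_cong2[where f="(-)"] wmax_cong sum.cong) auto

lemma wmax_scale:
  assumes "c \<ge> 0"
  shows "wmax (\<lambda>i. c * w i) k = c * wmax w k"
proof (induction k)
  case (Suc k)
  have "wmax (\<lambda>i. c * w i) (Suc k) = max (c * wmax w k) (c * (\<Sum>i<Suc k. w i))"
    unfolding wmax.simps Suc sum_distrib_left ..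
  also have "\<dots> = c * wmax w (Suc k)"
    unfolding wmax.simps using assms
    by (cases "c = 0") (auto simp: max_def)
  finally show ?case .
qed simp

lemma measurable_wmax:
  assumes "\<And>i. i < k \<Longrightarrow> (\<lambda>x. f x i) \<in> borel_measurable N"
  shows "(\<lambda>x. wmax (f x) k) \<in> borel_measurable N"
  using assms
proof (induction k)
  case (Suc k)
  have [measurable]: "(\<lambda>x. wmax (f x) k) \<in> borel_measurable N" using Suc by simp
  have [measurable]: "(\<lambda>x. \<Sum>i<Suc k. f x i) \<in> borel_measurable N"
    by (rule borel_measurable_sum) (use Suc.prems in auto)
  show ?case unfolding wmax.simps by measurable
qed simp

lemma measurable_wgap:
  assumes "\<And>i. i < k \<Longrightarrow> (\<lambda>x. f x i) \<in> borel_measurable N"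
  shows "(\<lambda>x. wgap (f x) k) \<in> borel_measurable N"
  unfolding wgap_def
  by (intro borel_measurable_diff measurable_wmax borel_measurable_sum assms) auto

text \<open>The discrete counterpart of \<open>exp (-t/2 - m \<integral>\<^sub>0\<^sup>t (s + S))\<close>, with step size \<open>h\<close> and \<open>w\<close> the sequence of
  increments.\<close>

definition wweight :: "real \<Rightarrow> real \<Rightarrow> real \<Rightarrow> (nat \<Rightarrow> real) \<Rightarrow> nat \<Rightarrow> real" where
  "wweight m s h w k = exp (- (real k * h / 2) - m * h * (\<Sum>j<k. s + wmax w j))"

lemma wweight_cong:
  "(\<And>i. i < k \<Longrightarrow> w i = w' i) \<Longrightarrow> wweight m s h w k = wweight m s h w' k"
  unfolding wweight_def
  by (intro arg_cong[where f=exp] arg_cong2[where f="(-)"] arg_cong2[where f="(*)"] sum.cong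
      arg_cong2[where f="(+)"] wmax_cong refl) auto

lemma measurable_wweight:
  assumes "\<And>i. i < k \<Longrightarrow> (\<lambda>x. f x i) \<in> borel_measurable N"
  shows "(\<lambda>x. wweight m s h (f x) k) \<in> borel_measurable N"
proof -
  have [measurable]: "(\<lambda>x. \<Sum>j<k. s + wmax (f x) j) \<in> borel_measurable N"
    by (intro borel_measurable_sum borel_measurable_add measurable_wmax assms) auto
  show ?thesis unfolding wweight_def by measurable
qed

lemma wweight_bounds:
  assumes "m \<ge> 0" "s \<ge> 0" "h \<ge> 0"
  shows "0 \<le> wweight m s h w k" "wweight m s h w k \<le> exp (- (real k * h / 2))" "wweight m s h w k \<le> 1"
proof -
  have "m * h * (\<Sum>j<k. s + wmax w j) \<ge> 0"
    using assms by (intro mult_nonneg_nonneg sum_nonneg add_nonneg_nonneg wmax_nonneg) auto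
  thus "wweight m s h w k \<le> exp (- (real k * h / 2))" by (simp add: wweight_def)
  also have "\<dots> \<le> 1" using assms by simp
  finally show "wweight m s h w k \<le> 1" .
qed (simp add: wweight_def)

text \<open>Half the square of \<open>kap\<close> at the current maximum is the rate
  \<open>1/2 + m * (s + wmax w k)\<close>, so the factor is the \<open>exp (-x)\<close> of
  \<open>gfun_discount\<close>. The exponent uses left endpoints, so the weight with index
  \<open>Suc k\<close> is still a function of the first \<open>k\<close> increments.\<close>

lemma wweight_Suc:
  assumes "m \<ge> 0" "s \<ge> 0"
  shows "wweight m s h w (Suc k) = wweight m s h w k * exp (- (h * (kap m (s + wmax w k))\<^sup>2 / 2))"
proof -
  have "(kap m (s + wmax w k))\<^sup>2 = 1 + 2 * m * (s + wmax w k)"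
    using assms wmax_nonneg[of w k] by (intro kap_sq) auto
  thus ?thesis unfolding wweight_def by (simp add: algebra_simps add_divide_distrib flip: exp_add)
qed

text \<open>The discounted value of \<open>g\<close> along the walk. Its sum with
  \<open>h / 2\<close> times the accumulated weights is a martingale up to small errors, as in the
  Feynman-Kac formula.\<close>

definition wF :: "real \<Rightarrow> real \<Rightarrow> real \<Rightarrow> (nat \<Rightarrow> real) \<Rightarrow> nat \<Rightarrow> real" where
  "wF m s h w k = wweight m s h w k * gfun m (s + wmax w k) (wgap w k)"

text \<open>Linear and quadratic coefficients of the second order expansion of the next value of
  \<^term>\<open>wF\<close> in the increment; they depend on the expectation_past_mult only.\<close>

definition wlin :: "real \<Rightarrow> real \<Rightarrow> real \<Rightarrow> (nat \<Rightarrow> real) \<Rightarrow> nat \<Rightarrow> real" where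
  "wlin m s h w k = wweight m s h w (Suc k)
     * (chi m (s + wmax w k) * exp (- kap m (s + wmax w k) * wgap w k)) * kap m (s + wmax w k)"

definition wquad :: "real \<Rightarrow> real \<Rightarrow> real \<Rightarrow> (nat \<Rightarrow> real) \<Rightarrow> nat \<Rightarrow> real" where
  "wquad m s h w k = wweight m s h w (Suc k)
     * (chi m (s + wmax w k) * exp (- kap m (s + wmax w k) * wgap w k)) * (kap m (s + wmax w k))\<^sup>2 / 2"

text \<open>The decay of \<open>chi\<close> absorbs the powers of \<open>kap\<close>, so both
  coefficients are bounded whatever the walk does, and hence integrable.\<close>

lemma wlin_wquad_bounds:
  assumes "m \<ge> 0" "s \<ge> 0" "h \<ge> 0"
  shows "\<bar>wlin m s h w k\<bar> \<le> 2 * m" "\<bar>wquad m s h w k\<bar> \<le> 2 * m"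
proof -
  define S where "S = s + wmax w k"
  have S: "S \<ge> 0" using assms wmax_nonneg[of w k] by (simp add: S_def)
  define E where "E = wweight m s h w (Suc k)"
  define G where "G = exp (- kap m S * wgap w k)"
  have k: "kap m S \<ge> 1" by (rule kap_ge_1) fact+
  have E: "0 \<le> E" "E \<le> 1" using wweight_bounds[OF assms] by (auto simp: E_def)
  have G: "0 \<le> G" "G \<le> 1" using k wgap_nonneg[of w k] by (auto simp: G_def)
  have EG: "\<bar>E * G\<bar> \<le> 1" using E G by (simp add: abs_mult mult_le_one)
  have *: "\<bar>(E * G) * (chi m S * kap m S ^ n)\<bar> \<le> 2 * m" if "n \<le> 5" for n
  proof -
    have "\<bar>(E * G) * (chi m S * kap m S ^ n)\<bar> \<le> 1 * (\<bar>chi m S\<bar> * kap m S ^ n)"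
      unfolding abs_mult[of "E * G"] using EG k by (intro mult_mono) (auto simp: abs_mult power_abs)
    thus ?thesis using chi_bounds(2)[OF assms(1) S that] by linarith
  qed
  have "wlin m s h w k = (E * G) * (chi m S * kap m S ^ 1)"
    by (simp add: wlin_def E_def G_def S_def)
  thus "\<bar>wlin m s h w k\<bar> \<le> 2 * m" using *[of 1] by simp
  have "wquad m s h w k = ((E * G) * (chi m S * kap m S ^ 2)) / 2"
    by (simp add: wquad_def E_def G_def S_def)
  thus "\<bar>wquad m s h w k\<bar> \<le> 2 * m" using *[of 2] by simp
qed

text \<open>Adds the discounted \<open>gfun_step\<close> to \<open>gfun_discount\<close>; the
  quadratic term of the former and the mean term of the latter combine to the centred
  \<open>(w k)\<^sup>2 - h\<close>. The parameter \<open>eps\<close> trades small increments against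
  rare large ones.\<close>

lemma wF_step:
  assumes "m \<ge> 0" "s \<ge> 0" "h \<ge> 0" and eps: "0 < eps" "eps \<le> 1"
  shows "\<bar>wF m s h w (Suc k) - wF m s h w k + h / 2 * wweight m s h w k
        - wlin m s h w k * w k - wquad m s h w k * ((w k)\<^sup>2 - h)\<bar>
      \<le> (5 * m\<^sup>2 + 5 * m) * (eps * (w k)\<^sup>2 + 2 * (w k) ^ 4 / eps\<^sup>2 + eps * wincr w k)
        + h\<^sup>2 * ((1 + 2 * m * (s + wmax w k)) / 8 + m / 2)"
proof -
  define S where "S = s + wmax w k"
  define e where "e = w k"
  define y where "y = wgap w k"
  define d where "d = wincr w k"
  define E where "E = wweight m s h w k"
  define x where "x = h * (kap m S)\<^sup>2 / 2"
  define C where "C = 5 * m\<^sup>2 + 5 * m"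
  define P where "P = chi m S * exp (- kap m S * y)"
  define R1 where "R1 = gfun m (S + d) (y - e + d) - gfun m S y - P * (kap m S * e + (kap m S)\<^sup>2 * e\<^sup>2 / 2)"
  define R2 where "R2 = exp (-x) * gfun m S y + h * (exp (-x) * P * (kap m S)\<^sup>2 / 2) - gfun m S y + h / 2"
  have S: "S \<ge> 0" using assms wmax_nonneg[of w k] by (simp add: S_def)
  have y: "y \<ge> 0" by (simp add: y_def wgap_nonneg)
  have d: "d = max (e - y) 0" by (simp add: d_def e_def y_def wincr_def)
  have d01: "0 \<le> d" "d \<le> \<bar>e\<bar>" using wincr_bounds[of w k] by (auto simp: d_def e_def)
  have E: "0 \<le> E" "E \<le> 1" using wweight_bounds[OF assms(1-3)] by (auto simp: E_def)
  have x0: "x \<ge> 0" using assms by (simp add: x_def)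
  have C0: "C \<ge> 0" using assms by (simp add: C_def)
  have Suc: "wweight m s h w (Suc k) = E * exp (-x)"
    using wweight_Suc[OF assms(1,2)] by (simp add: E_def x_def S_def)
  have F1: "wF m s h w (Suc k) = E * exp (-x) * gfun m (S + d) (y - e + d)"
    unfolding wF_def Suc unfolding wmax_Suc wgap_Suc by (simp add: S_def d_def y_def e_def add_ac)
  have F0: "wF m s h w k = E * gfun m S y" by (simp add: wF_def E_def S_def y_def)
  have L: "wlin m s h w k = E * exp (-x) * P * kap m S"
    unfolding wlin_def Suc by (simp add: P_def S_def y_def)
  have Q: "wquad m s h w k = E * exp (-x) * P * (kap m S)\<^sup>2 / 2"
    unfolding wquad_def Suc by (simp add: P_def S_def y_def)
  have eq: "wF m s h w (Suc k) - wF m s h w k + h / 2 * E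
        - wlin m s h w k * e - wquad m s h w k * (e\<^sup>2 - h) = E * exp (-x) * R1 + E * R2"
    unfolding F1 F0 L Q R1_def R2_def by (simp add: field_simps)
  have R1: "\<bar>R1\<bar> \<le> C * (\<bar>e\<bar> ^ 3 + \<bar>e\<bar> * d)"
    unfolding R1_def P_def C_def by (rule gfun_step[OF assms(1) S y d])
  have R2: "\<bar>R2\<bar> \<le> h\<^sup>2 * ((1 + 2 * m * S) / 8 + m / 2)"
    unfolding R2_def P_def x_def by (rule gfun_discount[OF assms(1) S y assms(3)])
  have e4: "e ^ 4 = \<bar>e\<bar> ^ 4" "e\<^sup>2 = \<bar>e\<bar>\<^sup>2" by (simp_all add: power_even_abs)
  \<comment> \<open>For \<open>\<bar>e\<bar> \<le> eps\<close> one factor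
    \<open>\<bar>e\<bar>\<close> is replaced by \<open>eps\<close>. Otherwise both terms are at most
    \<open>e ^ 4 / eps\<^sup>2\<close>, hence the factor 2. Only even moments of the increment and a
    multiple of \<open>d\<close> remain.\<close>
  have cube: "\<bar>e\<bar> ^ 3 + \<bar>e\<bar> * d \<le> eps * e\<^sup>2 + 2 * e ^ 4 / eps\<^sup>2 + eps * d"
  proof (cases "\<bar>e\<bar> \<le> eps")
    case True
    have "\<bar>e\<bar> * \<bar>e\<bar>\<^sup>2 \<le> eps * \<bar>e\<bar>\<^sup>2" "\<bar>e\<bar> * d \<le> eps * d"
      using True d01 by (auto intro!: mult_right_mono)
    moreover have "2 * e ^ 4 / eps\<^sup>2 \<ge> 0" by (intro divide_nonneg_nonneg) auto
    moreover have "\<bar>e\<bar> ^ 3 = \<bar>e\<bar> * \<bar>e\<bar>\<^sup>2" by (simp add: power3_eq_cube power2_eq_square)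
    ultimately show ?thesis unfolding e4(2) by linarith
  next
    case False
    hence e: "eps < \<bar>e\<bar>" by simp
    have q: "1 \<le> \<bar>e\<bar>\<^sup>2 / eps\<^sup>2" using e eps power_mono[of eps "\<bar>e\<bar>" 2] by simp
    have "\<bar>e\<bar>\<^sup>2 * 1 \<le> \<bar>e\<bar>\<^sup>2 * (\<bar>e\<bar>\<^sup>2 / eps\<^sup>2)" by (rule mult_left_mono[OF q]) simp
    hence a: "\<bar>e\<bar>\<^sup>2 \<le> e ^ 4 / eps\<^sup>2" unfolding e4(1) by (simp add: power2_eq_square power4_eq_xxxx)
    have b: "\<bar>e\<bar> * d \<le> \<bar>e\<bar>\<^sup>2" unfolding power2_eq_square using d01 by (intro mult_left_mono) auto
    have "\<bar>e\<bar> ^ 3 \<le> \<bar>e\<bar> ^ 4 / eps"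
    proof -
      have "\<bar>e\<bar> ^ 3 * eps \<le> \<bar>e\<bar> ^ 3 * \<bar>e\<bar>" using e by (intro mult_left_mono) auto
      thus ?thesis using eps by (simp add: field_simps power4_eq_xxxx power3_eq_cube)
    qed
    also have "\<dots> \<le> \<bar>e\<bar> ^ 4 / eps\<^sup>2"
      using eps by (intro divide_left_mono) (auto simp: power2_eq_square mult_le_one)
    finally have c: "\<bar>e\<bar> ^ 3 \<le> e ^ 4 / eps\<^sup>2" by (simp only: e4(1))
    have "eps * e\<^sup>2 \<ge> 0" "eps * d \<ge> 0" using eps d01 by auto
    thus ?thesis using a b c by (simp add: add_divide_distrib)
  qed
  have "\<bar>E * exp (-x) * R1 + E * R2\<bar> \<le> \<bar>E * exp (-x) * R1\<bar> + \<bar>E * R2\<bar>" by (rule abs_triangle_ineq)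
  also have "\<bar>E * exp (-x) * R1\<bar> \<le> 1 * (C * (\<bar>e\<bar> ^ 3 + \<bar>e\<bar> * d))"
    unfolding abs_mult[of _ R1] using E x0 by (intro mult_mono R1) (auto simp: abs_mult mult_le_one)
  also have "\<bar>E * R2\<bar> \<le> 1 * (h\<^sup>2 * ((1 + 2 * m * S) / 8 + m / 2))"
    unfolding abs_mult using E by (intro mult_mono R2) auto
  also have "C * (\<bar>e\<bar> ^ 3 + \<bar>e\<bar> * d) \<le> C * (eps * e\<^sup>2 + 2 * e ^ 4 / eps\<^sup>2 + eps * d)"
    by (rule mult_left_mono[OF cube C0])
  finally show ?thesis using eq by (simp add: E_def e_def d_def S_def C_def)
qed

text \<open>The estimates for the walk see the increments through independence and the moments of a
  centred normal law of variance \<open>h\<close>; normality itself enters later, through scaling.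
  The number of steps is finite so that it can be coupled to \<open>h\<close>.\<close>

locale walk = prob_space M for M :: "'a measure" +
  fixes \<eta> :: "nat \<Rightarrow> 'a \<Rightarrow> real" and h :: real and N :: nat
  assumes indep: "indep_vars (\<lambda>_. borel) \<eta> {..<N}"
    and h_nonneg: "h \<ge> 0"
    and integrable_fourth: "\<And>i. i < N \<Longrightarrow> integrable M (\<lambda>\<omega>. \<eta> i \<omega> ^ 4)"
    and moment_1: "\<And>i. i < N \<Longrightarrow> expectation (\<eta> i) = 0"
    and moment_2: "\<And>i. i < N \<Longrightarrow> expectation (\<lambda>\<omega>. (\<eta> i \<omega>)\<^sup>2) = h"
    and moment_4: "\<And>i. i < N \<Longrightarrow> expectation (\<lambda>\<omega>. \<eta> i \<omega> ^ 4) = 3 * h\<^sup>2"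
begin

abbreviation W :: "'a \<Rightarrow> nat \<Rightarrow> real" where "W \<omega> \<equiv> (\<lambda>i. \<eta> i \<omega>)"

lemma measurable_eta: "i < N \<Longrightarrow> \<eta> i \<in> borel_measurable M"
  using indep unfolding indep_vars_def by auto

lemma integrable_eta_power:
  assumes "i < N" "n \<le> 4"
  shows "integrable M (\<lambda>\<omega>. \<eta> i \<omega> ^ n)"
proof (rule Bochner_Integration.integrable_bound)
  show "integrable M (\<lambda>\<omega>. 1 + \<eta> i \<omega> ^ 4)" using integrable_fourth[OF assms(1)] by simp
  show "AE \<omega> in M. norm (\<eta> i \<omega> ^ n) \<le> norm (1 + \<eta> i \<omega> ^ 4)"
  proof (rule AE_I2)
    fix \<omega>
    have "\<bar>\<eta> i \<omega>\<bar> ^ n \<le> 1 + \<bar>\<eta> i \<omega>\<bar> ^ 4"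
    proof (cases "\<bar>\<eta> i \<omega>\<bar> \<le> 1")
      case True
      hence "\<bar>\<eta> i \<omega>\<bar> ^ n \<le> 1" by (simp add: power_le_one)
      thus ?thesis by (smt (verit) zero_le_power abs_ge_zero)
    next
      case False
      hence "\<bar>\<eta> i \<omega>\<bar> ^ n \<le> \<bar>\<eta> i \<omega>\<bar> ^ 4" using assms(2) by (intro power_increasing) auto
      thus ?thesis by simp
    qed
    thus "norm (\<eta> i \<omega> ^ n) \<le> norm (1 + \<eta> i \<omega> ^ 4)" by (simp add: power_abs power_even_abs)
  qed
  show "(\<lambda>\<omega>. \<eta> i \<omega> ^ n) \<in> borel_measurable M"
    using measurable_eta[OF assms(1)] by measurable
qed

text \<open>\<open>G\<close> looks only at the indices below \<open>k\<close>, and disjoint blocks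
  of independent variables are independent. This stands in for conditioning on the past.\<close>

lemma expectation_past_mult:
  assumes k: "k < N" and G: "G \<in> borel_measurable (PiM {..<k} (\<lambda>_. borel))"
    and cong: "\<And>w w'. (\<And>i. i < k \<Longrightarrow> w i = w' i) \<Longrightarrow> G w = G w'"
    and int: "integrable M (\<lambda>\<omega>. G (W \<omega>))" and n: "n \<le> 4"
  shows "integrable M (\<lambda>\<omega>. G (W \<omega>) * \<eta> k \<omega> ^ n)"
    and "expectation (\<lambda>\<omega>. G (W \<omega>) * \<eta> k \<omega> ^ n) = expectation (\<lambda>\<omega>. G (W \<omega>)) * expectation (\<lambda>\<omega>. \<eta> k \<omega> ^ n)"
proof -
  have [measurable]: "(\<lambda>w. w k ^ n) \<in> borel_measurable (PiM {k} (\<lambda>_. borel :: real measure))"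
    by (intro borel_measurable_power measurable_component_singleton) auto
  have "indep_var (PiM {..<k} (\<lambda>_. borel)) (\<lambda>\<omega>. restrict (\<lambda>i. \<eta> i \<omega>) {..<k})
        (PiM {k} (\<lambda>_. borel)) (\<lambda>\<omega>. restrict (\<lambda>i. \<eta> i \<omega>) {k})"
    by (rule indep_var_restrict[OF indep]) (use k in auto)
  hence "indep_var borel (G \<circ> (\<lambda>\<omega>. restrict (\<lambda>i. \<eta> i \<omega>) {..<k}))
        borel ((\<lambda>w. w k ^ n) \<circ> (\<lambda>\<omega>. restrict (\<lambda>i. \<eta> i \<omega>) {k}))"
    by (rule indep_var_compose[OF _ G]) measurable
  \<comment> \<open>\<open>restrict\<close> replaces the increments from index \<open>k\<close> on
    by \<open>undefined\<close>; \<open>cong\<close> says that \<open>G\<close> does not see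
    this.\<close>
  moreover have "G \<circ> (\<lambda>\<omega>. restrict (\<lambda>i. \<eta> i \<omega>) {..<k}) = (\<lambda>\<omega>. G (W \<omega>))"
    by (auto simp: fun_eq_iff intro!: cong)
  ultimately have *: "indep_var borel (\<lambda>\<omega>. G (W \<omega>)) borel (\<lambda>\<omega>. \<eta> k \<omega> ^ n)"
    by (simp add: comp_def)
  show "integrable M (\<lambda>\<omega>. G (W \<omega>) * \<eta> k \<omega> ^ n)"
    by (rule indep_var_integrable[OF * int integrable_eta_power[OF k n]])
  show "expectation (\<lambda>\<omega>. G (W \<omega>) * \<eta> k \<omega> ^ n) = expectation (\<lambda>\<omega>. G (W \<omega>)) * expectation (\<lambda>\<omega>. \<eta> k \<omega> ^ n)"
    by (rule indep_var_lebesgue_integral[OF * int integrable_eta_power[OF k n]])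
qed

lemma measurable_W:
  assumes "k \<le> N"
  shows "(\<lambda>\<omega>. wmax (W \<omega>) k) \<in> borel_measurable M" "(\<lambda>\<omega>. wgap (W \<omega>) k) \<in> borel_measurable M"
    "(\<lambda>\<omega>. wweight m s h (W \<omega>) k) \<in> borel_measurable M"
  using assms by (auto intro!: measurable_wmax measurable_wgap measurable_wweight measurable_eta)

lemma measurable_wincr: "k < N \<Longrightarrow> (\<lambda>\<omega>. wincr (W \<omega>) k) \<in> borel_measurable M"
  unfolding wincr_def using measurable_eta[of k] measurable_W(2)[of k] by measurable

lemma integrable_wincr: "k < N \<Longrightarrow> integrable M (\<lambda>\<omega>. wincr (W \<omega>) k)"
proof (rule Bochner_Integration.integrable_bound[OF integrable_eta_power[of k 1]])
  show "AE \<omega> in M. norm (wincr (W \<omega>) k) \<le> norm (\<eta> k \<omega> ^ 1)"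
  proof (rule AE_I2)
    fix \<omega>
    show "norm (wincr (W \<omega>) k) \<le> norm (\<eta> k \<omega> ^ 1)" using wincr_bounds[of "W \<omega>" k] by simp
  qed
qed (auto intro: measurable_wincr)

lemma integrable_wmax: "k \<le> N \<Longrightarrow> integrable M (\<lambda>\<omega>. wmax (W \<omega>) k)"
proof (induction k)
  case (Suc k)
  thus ?case unfolding wmax_Suc using integrable_wincr[of k] by simp
qed simp

text \<open>Before reflection a step adds exactly \<open>h\<close> to the second moment: the cross
  term vanishes since the next increment is centred and independent of the gap. Reflection only
  decreases the square.\<close>

lemma second_moment_wgap: "k \<le> N \<Longrightarrow> integrable M (\<lambda>\<omega>. (wgap (W \<omega>) k)\<^sup>2) \<and>
    expectation (\<lambda>\<omega>. (wgap (W \<omega>) k)\<^sup>2) \<le> real k * h"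
proof (induction k)
  case 0
  thus ?case by (simp add: wgap_def)
next
  case (Suc k)
  hence k: "k < N" and IH: "integrable M (\<lambda>\<omega>. (wgap (W \<omega>) k)\<^sup>2)"
    "expectation (\<lambda>\<omega>. (wgap (W \<omega>) k)\<^sup>2) \<le> real k * h" by auto
  note [measurable] = measurable_W(2)[of k] measurable_eta[OF k]
  have gap: "integrable M (\<lambda>\<omega>. wgap (W \<omega>) k)"
  proof (rule square_integrable_imp_integrable)
    show "(\<lambda>\<omega>. wgap (W \<omega>) k) \<in> borel_measurable M" using k by (intro measurable_W) auto
  qed (rule IH)
  have G: "(\<lambda>w. wgap w k) \<in> borel_measurable (PiM {..<k} (\<lambda>_. borel))"
    by (rule measurable_wgap) (rule measurable_component_singleton, simp)
  note pst = expectation_past_mult[OF k G wgap_cong gap, of 1, simplified]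
  have i2: "integrable M (\<lambda>\<omega>. (\<eta> k \<omega>)\<^sup>2)" using integrable_eta_power[OF k, of 2] by simp
  have eq: "(wgap (W \<omega>) k - \<eta> k \<omega>)\<^sup>2 = (wgap (W \<omega>) k)\<^sup>2 - 2 * (wgap (W \<omega>) k * \<eta> k \<omega>) + (\<eta> k \<omega>)\<^sup>2" for \<omega>
    by (simp add: power2_eq_square algebra_simps)
  have int: "integrable M (\<lambda>\<omega>. (wgap (W \<omega>) k - \<eta> k \<omega>)\<^sup>2)"
    unfolding eq using IH(1) pst(1) i2 by simp
  have "expectation (\<lambda>\<omega>. (wgap (W \<omega>) k - \<eta> k \<omega>)\<^sup>2) =
     expectation (\<lambda>\<omega>. (wgap (W \<omega>) k)\<^sup>2) - 2 * expectation (\<lambda>\<omega>. wgap (W \<omega>) k * \<eta> k \<omega>) + h"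
    unfolding eq using IH(1) pst(1) i2 moment_2[OF k] by simp
  also have "\<dots> \<le> real (Suc k) * h"
    using IH(2) pst(2) moment_1[OF k] by (simp add: algebra_simps)
  finally have E: "expectation (\<lambda>\<omega>. (wgap (W \<omega>) k - \<eta> k \<omega>)\<^sup>2) \<le> real (Suc k) * h" .
  have int': "integrable M (\<lambda>\<omega>. (wgap (W \<omega>) (Suc k))\<^sup>2)"
    by (rule Bochner_Integration.integrable_bound[OF int])
       (use wgap_Suc_sq measurable_W(2)[of "Suc k"] k in \<open>auto\<close>)
  moreover have "expectation (\<lambda>\<omega>. (wgap (W \<omega>) (Suc k))\<^sup>2) \<le> expectation (\<lambda>\<omega>. (wgap (W \<omega>) k - \<eta> k \<omega>)\<^sup>2)"
    by (rule integral_mono[OF int' int]) (rule wgap_Suc_sq)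
  ultimately show ?case using E by simp
qed

text \<open>The maximum and the gap differ by the centred position, so they have the same mean, and the gap is
  controlled by its second moment: no maximal inequality is needed.\<close>

lemma expectation_wmax_le:
  assumes "k \<le> N"
  shows "expectation (\<lambda>\<omega>. wmax (W \<omega>) k) \<le> (1 + real N * h) / 2"
proof -
  have gapi: "integrable M (\<lambda>\<omega>. wgap (W \<omega>) k)"
    by (rule square_integrable_imp_integrable) (use second_moment_wgap measurable_W assms in auto)
  have "integrable M (\<lambda>\<omega>. \<Sum>i<k. \<eta> i \<omega>)" "expectation (\<lambda>\<omega>. \<Sum>i<k. \<eta> i \<omega>) = 0"
    using integrable_eta_power[of _ 1] moment_1 assms by (auto simp: Bochner_Integration.integral_sum)
  hence "expectation (\<lambda>\<omega>. wgap (W \<omega>) k + (\<Sum>i<k. \<eta> i \<omega>)) = expectation (\<lambda>\<omega>. wgap (W \<omega>) k)"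
    using gapi by simp
  hence "expectation (\<lambda>\<omega>. wmax (W \<omega>) k) = expectation (\<lambda>\<omega>. wgap (W \<omega>) k)" by (simp add: wgap_def)
  also have "\<dots> \<le> expectation (\<lambda>\<omega>. (1 + (wgap (W \<omega>) k)\<^sup>2) / 2)"
  proof (rule integral_mono[OF gapi])
    show "integrable M (\<lambda>\<omega>. (1 + (wgap (W \<omega>) k)\<^sup>2) / 2)" using second_moment_wgap[OF assms] by simp
    fix \<omega>
    show "wgap (W \<omega>) k \<le> (1 + (wgap (W \<omega>) k)\<^sup>2) / 2"
      using sum_squares_bound[of 1 "wgap (W \<omega>) k"] by simp
  qed
  also have "\<dots> = (1 + expectation (\<lambda>\<omega>. (wgap (W \<omega>) k)\<^sup>2)) / 2"
    using second_moment_wgap[OF assms] prob_space by simp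
  also have "\<dots> \<le> (1 + real N * h) / 2"
  proof -
    have "real k * h \<le> real N * h" using assms h_nonneg by (intro mult_right_mono) auto
    hence "expectation (\<lambda>\<omega>. (wgap (W \<omega>) k)\<^sup>2) \<le> real N * h"
      using second_moment_wgap[OF assms] by (auto intro: order_trans)
    thus ?thesis by simp
  qed
  finally show ?thesis .
qed

lemma abs_wF_le:
  assumes "m \<ge> 0" "s \<ge> 0"
  shows "\<bar>wF m s h w k\<bar> \<le> exp (- (real k * h / 2)) * (1 + 2 * m)"
  unfolding wF_def abs_mult
  using assms h_nonneg wweight_bounds[OF assms h_nonneg, of w k] wmax_nonneg[of w k] wgap_nonneg[of w k]
  by (intro mult_mono abs_gfun_le) auto

lemma integrable_wF: "m \<ge> 0 \<Longrightarrow> s \<ge> 0 \<Longrightarrow> k \<le> N \<Longrightarrow> integrable M (\<lambda>\<omega>. wF m s h (W \<omega>) k)"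
proof (rule integrable_const_bound)
  assume a: "m \<ge> 0" "s \<ge> 0" "k \<le> N"
  show "AE \<omega> in M. norm (wF m s h (W \<omega>) k) \<le> exp (- (real k * h / 2)) * (1 + 2 * m)"
    using abs_wF_le[OF a(1,2)] by simp
  show "(\<lambda>\<omega>. wF m s h (W \<omega>) k) \<in> borel_measurable M"
    using measurable_W[OF a(3)] unfolding wF_def by measurable
qed

lemma integrable_wweight: "m \<ge> 0 \<Longrightarrow> s \<ge> 0 \<Longrightarrow> k \<le> N \<Longrightarrow> integrable M (\<lambda>\<omega>. wweight m s h (W \<omega>) k)"
  by (rule integrable_const_bound[where B=1])
     (use wweight_bounds h_nonneg measurable_W in auto)

text \<open>The coefficients depend on the past, while the next increment has mean 0 and its square
  has mean \<open>h\<close>. So the linear and the centred quadratic term are martingale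
  increments.\<close>

lemma expectation_coeff_mult:
  assumes "m \<ge> 0" "s \<ge> 0" "k < N"
  shows "integrable M (\<lambda>\<omega>. wlin m s h (W \<omega>) k * \<eta> k \<omega>)"
    "expectation (\<lambda>\<omega>. wlin m s h (W \<omega>) k * \<eta> k \<omega>) = 0"
    "integrable M (\<lambda>\<omega>. wquad m s h (W \<omega>) k * ((\<eta> k \<omega>)\<^sup>2 - h))"
    "expectation (\<lambda>\<omega>. wquad m s h (W \<omega>) k * ((\<eta> k \<omega>)\<^sup>2 - h)) = 0"
proof -
  \<comment> \<open>Both coefficients contain the weight with index \<open>Suc k\<close>; rewriting
    it through index \<open>k\<close> exhibits them as functions of the first \<open>k\<close>
    increments.\<close>
  have W': "wweight m s h w (Suc k) = wweight m s h w k * exp (- (h * (kap m (s + wmax w k))\<^sup>2 / 2))" for w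
    by (rule wweight_Suc[OF assms(1,2)])
  have meas: "(\<lambda>x. wlin m s h (f x) k) \<in> borel_measurable N'"
    "(\<lambda>x. wquad m s h (f x) k) \<in> borel_measurable N'"
    if "\<And>i. i < k \<Longrightarrow> (\<lambda>x. f x i) \<in> borel_measurable N'" for f and N' :: "'b measure"
    using measurable_wmax[OF that] measurable_wgap[OF that] measurable_wweight[OF that]
    unfolding wlin_def wquad_def W' by measurable
  have cong: "wlin m s h w k = wlin m s h w' k" "wquad m s h w k = wquad m s h w' k"
    if "\<And>i. i < k \<Longrightarrow> w i = w' i" for w w'
    unfolding wlin_def wquad_def W' using wmax_cong[OF that] wgap_cong[OF that] wweight_cong[OF that]
    by simp_all
  have ms: "(\<lambda>\<omega>. wlin m s h (W \<omega>) k) \<in> borel_measurable M" "(\<lambda>\<omega>. wquad m s h (W \<omega>) k) \<in> borel_measurable M"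
    using assms by (auto intro!: meas measurable_eta)
  have il: "integrable M (\<lambda>\<omega>. wlin m s h (W \<omega>) k)"
    by (rule integrable_const_bound[where B="2 * m"])
       (use wlin_wquad_bounds assms h_nonneg ms in auto)
  have iq: "integrable M (\<lambda>\<omega>. wquad m s h (W \<omega>) k)"
    by (rule integrable_const_bound[where B="2 * m"])
       (use wlin_wquad_bounds assms h_nonneg ms in auto)
  have Gl: "(\<lambda>w. wlin m s h w k) \<in> borel_measurable (PiM {..<k} (\<lambda>_. borel))"
    by (rule meas) (rule measurable_component_singleton, simp)
  have Gq: "(\<lambda>w. wquad m s h w k) \<in> borel_measurable (PiM {..<k} (\<lambda>_. borel))"
    by (rule meas) (rule measurable_component_singleton, simp)
  note pl = expectation_past_mult[OF assms(3) Gl cong(1) il, of 1, simplified]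
  note pq = expectation_past_mult[OF assms(3) Gq cong(2) iq, of 2, simplified]
  show "integrable M (\<lambda>\<omega>. wlin m s h (W \<omega>) k * \<eta> k \<omega>)" by (rule pl(1))
  show "expectation (\<lambda>\<omega>. wlin m s h (W \<omega>) k * \<eta> k \<omega>) = 0"
    using pl(2) moment_1[OF assms(3)] by simp
  show "integrable M (\<lambda>\<omega>. wquad m s h (W \<omega>) k * ((\<eta> k \<omega>)\<^sup>2 - h))"
    using pq(1) iq by (simp add: right_diff_distrib)
  show "expectation (\<lambda>\<omega>. wquad m s h (W \<omega>) k * ((\<eta> k \<omega>)\<^sup>2 - h)) = 0"
    using pq iq moment_2[OF assms(3)] by (simp add: right_diff_distrib)
qed

text \<open>Averaging \<open>wF_step\<close> removes the martingale terms;
  \<open>6 * h\<^sup>2\<close> is twice the fourth moment.\<close>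

lemma expected_step:
  assumes ms: "m \<ge> 0" "s \<ge> 0" and k: "k < N" and eps: "0 < eps" "eps \<le> 1"
  shows "\<bar>expectation (\<lambda>\<omega>. wF m s h (W \<omega>) (Suc k)) - expectation (\<lambda>\<omega>. wF m s h (W \<omega>) k)
        + h / 2 * expectation (\<lambda>\<omega>. wweight m s h (W \<omega>) k)\<bar>
      \<le> (5 * m\<^sup>2 + 5 * m) * (eps * h + 6 * h\<^sup>2 / eps\<^sup>2 + eps * expectation (\<lambda>\<omega>. wincr (W \<omega>) k))
        + h\<^sup>2 * ((1 + 2 * m * (s + (1 + real N * h) / 2)) / 8 + m / 2)"
proof -
  define C where "C = 5 * m\<^sup>2 + 5 * m"
  define f where "f \<omega> = wF m s h (W \<omega>) (Suc k) - wF m s h (W \<omega>) k + h / 2 * wweight m s h (W \<omega>) k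
        - wlin m s h (W \<omega>) k * \<eta> k \<omega> - wquad m s h (W \<omega>) k * ((\<eta> k \<omega>)\<^sup>2 - h)" for \<omega>
  define g where "g \<omega> = C * (eps * (\<eta> k \<omega>)\<^sup>2 + 2 * (\<eta> k \<omega>) ^ 4 / eps\<^sup>2 + eps * wincr (W \<omega>) k)
        + h\<^sup>2 * ((1 + 2 * m * (s + wmax (W \<omega>) k)) / 8 + m / 2)" for \<omega>
  note ints = integrable_wF[OF ms, of "Suc k"] integrable_wF[OF ms, of k] integrable_wweight[OF ms, of k]
     expectation_coeff_mult[OF ms k]
  have f: "integrable M f" unfolding f_def
    using ints k by (intro Bochner_Integration.integrable_add Bochner_Integration.integrable_diff integrable_mult_right) auto
  have Ef: "expectation f = expectation (\<lambda>\<omega>. wF m s h (W \<omega>) (Suc k)) - expectation (\<lambda>\<omega>. wF m s h (W \<omega>) k)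
        + h / 2 * expectation (\<lambda>\<omega>. wweight m s h (W \<omega>) k)"
    unfolding f_def using ints k by simp
  note gi = integrable_eta_power[OF k, of 2] integrable_eta_power[OF k, of 4] integrable_wincr[OF k] integrable_wmax[of k]
  have g: "integrable M g" unfolding g_def using gi k by simp
  have "expectation g = C * (eps * h + 2 * (3 * h\<^sup>2) / eps\<^sup>2 + eps * expectation (\<lambda>\<omega>. wincr (W \<omega>) k))
        + h\<^sup>2 * ((1 + 2 * m * (s + expectation (\<lambda>\<omega>. wmax (W \<omega>) k))) / 8 + m / 2)"
    unfolding g_def using gi k prob_space by (simp add: moment_2[OF k] moment_4[OF k])
  also have "\<dots> \<le> C * (eps * h + 2 * (3 * h\<^sup>2) / eps\<^sup>2 + eps * expectation (\<lambda>\<omega>. wincr (W \<omega>) k))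
        + h\<^sup>2 * ((1 + 2 * m * (s + (1 + real N * h) / 2)) / 8 + m / 2)"
    using ms k expectation_wmax_le[of k]
    by (intro add_left_mono mult_left_mono add_right_mono divide_right_mono) auto
  finally have Eg: "expectation g \<le> C * (eps * h + 6 * h\<^sup>2 / eps\<^sup>2 + eps * expectation (\<lambda>\<omega>. wincr (W \<omega>) k))
        + h\<^sup>2 * ((1 + 2 * m * (s + (1 + real N * h) / 2)) / 8 + m / 2)" by simp
  have "norm (expectation f) \<le> expectation g"
    by (rule order_trans[OF integral_norm_bound integral_mono[OF integrable_norm[OF f] g]])
       (use wF_step[OF ms h_nonneg eps] in \<open>simp add: f_def g_def C_def\<close>)
  thus ?thesis using Eg unfolding Ef C_def by simp
qed

text \<open>In the telescoping sum of \<open>expected_step\<close> the initial value is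
  \<open>psi m s\<close> and the final one is exponentially small in \<open>N * h\<close>. The
  increases \<open>wincr\<close> telescope as well, to the final maximum, so the terms
  \<open>eps * wincr\<close> together cost only \<open>eps\<close> times its mean.\<close>

lemma psi_approx:
  assumes ms: "m \<ge> 0" "s \<ge> 0" and eps: "0 < eps" "eps \<le> 1"
  shows "\<bar>psi m s - h / 2 * (\<Sum>k<N. expectation (\<lambda>\<omega>. wweight m s h (W \<omega>) k))\<bar>
      \<le> exp (- (real N * h / 2)) * (1 + 2 * m)
        + (5 * m\<^sup>2 + 5 * m) * (real N * (eps * h + 6 * h\<^sup>2 / eps\<^sup>2) + eps * ((1 + real N * h) / 2))
        + real N * (h\<^sup>2 * ((1 + 2 * m * (s + (1 + real N * h) / 2)) / 8 + m / 2))"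
proof -
  define C where "C = 5 * m\<^sup>2 + 5 * m"
  define D where "D = h\<^sup>2 * ((1 + 2 * m * (s + (1 + real N * h) / 2)) / 8 + m / 2)"
  define F where "F k = expectation (\<lambda>\<omega>. wF m s h (W \<omega>) k)" for k
  define E where "E k = expectation (\<lambda>\<omega>. wweight m s h (W \<omega>) k)" for k
  define d where "d k = expectation (\<lambda>\<omega>. wincr (W \<omega>) k)" for k
  have step: "\<bar>F (Suc k) - F k + h / 2 * E k\<bar> \<le> C * (eps * h + 6 * h\<^sup>2 / eps\<^sup>2 + eps * d k) + D" if "k < N" for k
    using expected_step[OF ms that eps] by (simp add: F_def E_def d_def C_def D_def)
  have F0: "F 0 = psi m s"
    using prob_space by (simp add: F_def wF_def wweight_def wgap_def gfun_0[OF ms])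
  have "\<bar>F N\<bar> \<le> expectation (\<lambda>\<omega>. \<bar>wF m s h (W \<omega>) N\<bar>)"
    unfolding F_def by (rule integral_abs_bound)
  also have "\<dots> \<le> expectation (\<lambda>\<omega>. exp (- (real N * h / 2)) * (1 + 2 * m))"
    by (rule integral_mono) (use integrable_wF[OF ms] abs_wF_le[OF ms] in auto)
  finally have FN: "\<bar>F N\<bar> \<le> exp (- (real N * h / 2)) * (1 + 2 * m)" using prob_space by simp
  have "(\<Sum>k<n. d k) = expectation (\<lambda>\<omega>. wmax (W \<omega>) n)" if "n \<le> N" for n
    using that
  proof (induction n)
    case (Suc n)
    have "expectation (\<lambda>\<omega>. wmax (W \<omega>) (Suc n)) = expectation (\<lambda>\<omega>. wmax (W \<omega>) n) + d n"
      unfolding wmax_Suc d_def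
      by (rule Bochner_Integration.integral_add) (use Suc.prems integrable_wmax integrable_wincr in auto)
    thus ?case using Suc by simp
  qed simp
  hence sd: "(\<Sum>k<N. d k) \<le> (1 + real N * h) / 2" using expectation_wmax_le[of N] by simp
  have "(\<Sum>k<N. F (Suc k) - F k) = F N - F 0" by (rule sum_lessThan_telescope)
  hence "psi m s - h / 2 * (\<Sum>k<N. E k) = F N - (\<Sum>k<N. F (Suc k) - F k + h / 2 * E k)"
    by (simp add: F0 sum.distrib sum_distrib_left)
  also have "\<bar>\<dots>\<bar> \<le> \<bar>F N\<bar> + (\<Sum>k<N. \<bar>F (Suc k) - F k + h / 2 * E k\<bar>)"
    using sum_abs[of "\<lambda>k. F (Suc k) - F k + h / 2 * E k" "{..<N}"] by linarith
  also have "(\<Sum>k<N. \<bar>F (Suc k) - F k + h / 2 * E k\<bar>) \<le> (\<Sum>k<N. C * (eps * h + 6 * h\<^sup>2 / eps\<^sup>2 + eps * d k) + D)"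
    by (rule sum_mono) (use step in auto)
  also have "\<dots> = C * (real N * (eps * h + 6 * h\<^sup>2 / eps\<^sup>2) + eps * (\<Sum>k<N. d k)) + real N * D"
    by (simp add: sum.distrib sum_distrib_left algebra_simps)
  also have "\<dots> \<le> C * (real N * (eps * h + 6 * h\<^sup>2 / eps\<^sup>2) + eps * ((1 + real N * h) / 2)) + real N * D"
    using sd eps ms by (intro add_right_mono add_left_mono mult_left_mono) (auto simp: C_def)
  finally show ?thesis using FN unfolding E_def C_def D_def by linarith
qed

end

section \<open>Gamma function identities\<close>

text \<open>The \<open>3 * n\<close> factors on the left are grouped by their index modulo 3, with a
  factor 3 taken out of each.\<close>

lemma pochhammer_triple:
  fixes z :: "'a :: field_char_0"
  shows "pochhammer (3 * z) (3 * n)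
    = 3 ^ (3 * n) * pochhammer z n * pochhammer (z + 1/3) n * pochhammer (z + 2/3) n"
proof (induction n)
  case (Suc n)
  have "3 * Suc n = Suc (Suc (Suc (3 * n)))" by simp
  hence "pochhammer (3 * z) (3 * Suc n) = pochhammer (3 * z) (3 * n)
      * (3 * z + of_nat (3 * n)) * (3 * z + of_nat (3 * n) + 1) * (3 * z + of_nat (3 * n) + 2)"
    by (simp only: pochhammer_Suc) (simp add: algebra_simps)
  also have "\<dots> = pochhammer (3 * z) (3 * n) * (27 * (z + of_nat n) * (z + 1/3 + of_nat n) * (z + 2/3 + of_nat n))"
    by (simp add: algebra_simps)
  also have "\<dots> = 3 ^ (3 * Suc n) * pochhammer z (Suc n) * pochhammer (z + 1/3) (Suc n) * pochhammer (z + 2/3) (Suc n)"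
    unfolding Suc by (simp only: pochhammer_Suc) (simp add: power_add)
  finally show ?case .
qed simp

text \<open>The factor of \<open>Gamma_series_triple\<close> that is free of \<open>z\<close>. Its
  limit is the constant of Gauss's formula, common to all \<open>z\<close>.\<close>

definition triple_const :: "nat \<Rightarrow> complex" where
  "triple_const n = fact n ^ 3 * of_nat n * 3 ^ (3 * n + 3) / fact (3 * n + 2)"

text \<open>Three products of \<open>n + 1\<close> factors make \<open>3 * n + 3\<close> factors,
  which is the product in \<open>Gamma_series\<close> of index \<open>3 * n + 2\<close>. The
  exponential corrects for \<open>n\<close> and \<open>3 * n + 2\<close> being raised to the power
  \<open>3 * z\<close>; the offsets \<open>1/3\<close> and \<open>2/3\<close> contribute the factor
  \<open>n\<close> of \<open>triple_const\<close>.\<close>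

lemma Gamma_series_triple:
  fixes z :: complex
  assumes "n > 0"
  shows "Gamma_series z n * Gamma_series (z + 1/3) n * Gamma_series (z + 2/3) n
    = triple_const n * exp (3 * z * of_real (ln (real n) - ln (real (3 * n + 2)))) * Gamma_series (3 * z) (3 * n + 2)"
proof -
  define l where "l = complex_of_real (ln (real n))"
  define l' where "l' = complex_of_real (ln (real (3 * n + 2)))"
  have el: "exp l = of_nat n" using assms by (simp add: l_def exp_of_real)
  have e: "exp (z * l) * exp ((z + 1/3) * l) * exp ((z + 2/3) * l) = of_nat n * exp (3 * z * l)"
    unfolding el[symmetric] by (simp add: algebra_simps flip: exp_add)
  have e': "exp (3 * z * (l - l')) * exp (3 * z * l') = exp (3 * z * l)"
    by (simp add: algebra_simps flip: exp_add)
  have p: "pochhammer (3 * z) (3 * n + 3) = 3 ^ (3 * n + 3) * pochhammer z (n + 1) * pochhammer (z + 1/3) (n + 1) * pochhammer (z + 2/3) (n + 1)"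
    using pochhammer_triple[of z "n + 1"] by (simp add: algebra_simps)
  have "Gamma_series z n * Gamma_series (z + 1/3) n * Gamma_series (z + 2/3) n
     = fact n ^ 3 * (exp (z * l) * exp ((z + 1/3) * l) * exp ((z + 2/3) * l)) / 
        (pochhammer z (n + 1) * pochhammer (z + 1/3) (n + 1) * pochhammer (z + 2/3) (n + 1))"
    by (simp add: Gamma_series_def l_def power3_eq_cube)
  also have "\<dots> = fact n ^ 3 * of_nat n * exp (3 * z * l) * 3 ^ (3 * n + 3) / pochhammer (3 * z) (3 * n + 3)"
    unfolding e p by simp
  also have "\<dots> = triple_const n * exp (3 * z * (l - l')) * (fact (3 * n + 2) * exp (3 * z * l') / pochhammer (3 * z) (3 * n + 3))"
  proof -
    have "a * n' * (X * X') * p / q = (a * n' * p / f) * X * (f * X' / q)" if "f \<noteq> 0" for a n' X X' p q f :: complex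
      using that by simp
    thus ?thesis unfolding e'[symmetric] triple_const_def using fact_nonzero by blast
  qed
  also have "fact (3 * n + 2) * exp (3 * z * l') / pochhammer (3 * z) (3 * n + 3) = Gamma_series (3 * z) (3 * n + 2)"
    unfolding Gamma_series_def l'_def by (simp add: numeral_3_eq_3)
  finally show ?thesis by (simp add: l_def l'_def)
qed

lemma not_nonpos_Int_if_Re_pos: "Re z > 0 \<Longrightarrow> z \<notin> \<int>\<^sub>\<le>\<^sub>0"
  by (auto elim!: nonpos_Ints_cases)

text \<open>Solving \<open>Gamma_series_triple\<close> for the constant leaves convergent factors
  only: the logarithm of \<open>n / (3 * n + 2)\<close> tends to \<open>- ln 3\<close>. The sequence
  is free of \<open>z\<close>, so the expression on the right is too.\<close>

lemma triple_const_limit: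
  fixes z :: complex
  assumes z: "Re z > 0"
  shows "triple_const \<longlonglongrightarrow> Gamma z * Gamma (z + 1/3) * Gamma (z + 2/3) / Gamma (3 * z) * exp (3 * z * of_real (ln 3))"
proof -
  have nz: "Gamma (3 * z) \<noteq> 0"
    using z not_nonpos_Int_if_Re_pos[of "3 * z"] by (simp add: Gamma_eq_zero_iff)
  have sub: "filterlim (\<lambda>n::nat. 3 * n + 2) sequentially sequentially"
    by (rule filterlim_subseq) (simp add: strict_mono_def)
  have t3: "(\<lambda>n. Gamma_series (3 * z) (3 * n + 2)) \<longlonglongrightarrow> Gamma (3 * z)"
    by (rule filterlim_compose[OF Gamma_series_LIMSEQ sub])
  have "(\<lambda>n. ln (real n) - ln (real (3 * n + 2))) \<longlonglongrightarrow> - ln 3" by real_asymp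
  hence ex: "(\<lambda>n. exp (- (3 * z * of_real (ln (real n) - ln (real (3 * n + 2)))))) \<longlonglongrightarrow> exp (- (3 * z * of_real (- ln 3)))"
    by (intro tendsto_intros)
  have "(\<lambda>n. Gamma_series z n * Gamma_series (z + 1/3) n * Gamma_series (z + 2/3) n
      / Gamma_series (3 * z) (3 * n + 2) * exp (- (3 * z * of_real (ln (real n) - ln (real (3 * n + 2))))))
    \<longlonglongrightarrow> Gamma z * Gamma (z + 1/3) * Gamma (z + 2/3) / Gamma (3 * z) * exp (- (3 * z * of_real (- ln 3)))"
    by (intro tendsto_mult tendsto_divide Gamma_series_LIMSEQ t3 ex nz)
  moreover have "\<forall>\<^sub>F n in sequentially. Gamma_series z n * Gamma_series (z + 1/3) n * Gamma_series (z + 2/3) n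
      / Gamma_series (3 * z) (3 * n + 2) * exp (- (3 * z * of_real (ln (real n) - ln (real (3 * n + 2))))) = triple_const n"
    using tendsto_imp_eventually_ne[OF t3 nz] eventually_gt_at_top[of 0]
  proof eventually_elim
    case (elim n)
    have "exp (3 * z * of_real (ln (real n) - ln (real (3 * n + 2)))) * exp (- (3 * z * of_real (ln (real n) - ln (real (3 * n + 2))))) = 1"
      by (simp flip: exp_add)
    thus ?case unfolding Gamma_series_triple[OF elim(2)] using elim(1)
      by (simp add: mult.assoc)
  qed
  ultimately show ?thesis by (simp add: filterlim_cong)
qed

text \<open>Gauss's multiplication formula for the factor 3, up to its constant.\<close>

lemma Gamma_triplication_ratio:
  fixes z w :: complex
  assumes "Re z > 0" "Re w > 0"
  shows "Gamma z * Gamma (z + 1/3) * Gamma (z + 2/3) / Gamma (3 * z) * exp (3 * z * of_real (ln 3))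
    = Gamma w * Gamma (w + 1/3) * Gamma (w + 2/3) / Gamma (3 * w) * exp (3 * w * of_real (ln 3))"
  using triple_const_limit[OF assms(1)] triple_const_limit[OF assms(2)] by (rule LIMSEQ_unique)

text \<open>The formulas of the theorem without \<^const>\<open>remove_sings\<close>.\<close>

definition moment_expr1 :: "complex \<Rightarrow> complex" where
  "moment_expr1 = (\<lambda>s. Gamma (s + 1) * Gamma (s + 2/3) / (Gamma (2/3) * Gamma (3 * s / 2 + 1))
       * of_real (3 / sqrt 8) powr s)"

definition moment_expr2 :: "complex \<Rightarrow> complex" where
  "moment_expr2 = (\<lambda>s. Gamma (s + 1) * Gamma (s + 5/3) / (Gamma (5/3) * Gamma (3 * s / 2 + 2))
       * of_real (3 / sqrt 8) powr s)"

definition moment_expr3 :: "complex \<Rightarrow> complex" where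
  "moment_expr3 = (\<lambda>s. of_real (2 * Gamma (1/3) / (3 * sqrt pi))
       * (Gamma (3 * s / 2 + 3/2) / Gamma (s + 4/3))
       * of_real (sqrt 8 / 9) powr s)"

definition moment_expr4 :: "complex \<Rightarrow> complex" where
  "moment_expr4 = (\<lambda>s. of_real (Gamma (1/3) / (2 powr (1/3) * pi))
       * (Gamma (s / 2 + 1/2) * Gamma (s / 2 + 5/6) / Gamma (s / 2 + 2/3))
       * (2/3) powr (s / 2))"

lemma Gamma_neq_0_if_Re_pos: "Re z > 0 \<Longrightarrow> Gamma z \<noteq> (0::complex)"
  using not_nonpos_Int_if_Re_pos[of z] by (simp add: Gamma_eq_zero_iff)

lemma of_real_powr_exp: "a > 0 \<Longrightarrow> of_real a powr z = exp (z * of_real (ln a))" for z :: complex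
  by (simp add: powr_def Ln_of_real)

lemma ln_sqrt8: "ln (sqrt 8) = 3/2 * ln (2::real)"
proof -
  have "ln (sqrt 8) = ln (8::real) / 2" by (simp add: ln_sqrt)
  also have "(8::real) = 2 ^ 3" by simp
  finally show ?thesis by (simp only: ln_realpow) simp
qed

lemma Gamma_rec_complex: "Re z > 0 \<Longrightarrow> Gamma (z + 1) = z * Gamma (z::complex)"
  using not_nonpos_Int_if_Re_pos[of z] by (intro Gamma_plus1) auto

text \<open>With \<open>u = s / 2\<close>, duplication at \<open>u + 1/2\<close> and
  \<open>u + 5/6\<close> splits the two Gammas of the numerator, and triplication at
  \<open>u + 2/3\<close> treats \<open>Gamma (3 * u + 2)\<close>; the values at \<open>u + 1\<close>
  and \<open>u + 4/3\<close> cancel. The constant is found by comparing with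
  \<open>u = 0\<close>.\<close>

lemma moment_expr2_eq_4:
  assumes "Re s > -1"
  shows "moment_expr2 s = moment_expr4 s"
proof -
  define u where "u = s / 2"
  have s: "s = 2 * u" by (simp add: u_def)
  have u: "Re u > -1/2" using assms by (simp add: u_def)
  define l2 l3 where "l2 = complex_of_real (ln 2)" and "l3 = complex_of_real (ln 3)"
  define sp where "sp = complex_of_real (sqrt pi)"
  have sp: "sp \<noteq> 0" "sp * sp = of_real pi" by (simp_all add: sp_def flip: of_real_mult)
  have d1: "Gamma (u + 1/2) * Gamma (u + 1) = exp (- 2 * u * l2) * sp * Gamma (2 * u + 1)"
    using Gamma_legendre_duplication[of "u + 1/2"] u
      not_nonpos_Int_if_Re_pos[of "u + 1/2"] not_nonpos_Int_if_Re_pos[of "u + 1"]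
    by (simp add: algebra_simps l2_def sp_def)
  have d2: "Gamma (u + 5/6) * Gamma (u + 4/3) = exp ((- 2 * u - 2/3) * l2) * sp * Gamma (2 * u + 5/3)"
    using Gamma_legendre_duplication[of "u + 5/6"] u
      not_nonpos_Int_if_Re_pos[of "u + 5/6"] not_nonpos_Int_if_Re_pos[of "u + 4/3"]
    by (simp add: algebra_simps l2_def sp_def)
  have G1: "Gamma (4/3) = Gamma (1/3) / (3::complex)" using Gamma_rec_complex[of "1/3"] by simp
  have G2: "Gamma (5/3) = 2/3 * (Gamma (2/3) :: complex)" using Gamma_rec_complex[of "2/3"] by simp
  have t: "Gamma (u + 2/3) * Gamma (u + 1) * Gamma (u + 4/3) / Gamma (3 * u + 2) * exp ((3 * u + 2) * l3)
     = Gamma (2/3) * (Gamma (1/3) / 3) * exp (2 * l3)"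
    using Gamma_triplication_ratio[of "u + 2/3" "2/3"] u
    by (simp add: algebra_simps l3_def G1 Gamma_numeral)
  define g1 g2 g3 g4 g5 where g_def: "g1 = Gamma (u + 1/2)" "g2 = Gamma (u + 1)" "g3 = Gamma (u + 5/6)"
    "g4 = Gamma (u + 4/3)" "g5 = Gamma (u + 2/3)"
  define h1 h2 h3 where h_def: "h1 = Gamma (2 * u + 1)" "h2 = Gamma (2 * u + 5/3)" "h3 = Gamma (3 * u + 2)"
  define c1 c2 where c_def: "c1 = (Gamma (1/3) :: complex)" "c2 = (Gamma (2/3) :: complex)"
  have nz: "g1 \<noteq> 0" "g2 \<noteq> 0" "g3 \<noteq> 0" "g4 \<noteq> 0" "g5 \<noteq> 0" "h1 \<noteq> 0" "h2 \<noteq> 0" "h3 \<noteq> 0" "c1 \<noteq> 0" "c2 \<noteq> 0"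
    unfolding g_def h_def c_def using u by (auto intro!: Gamma_neq_0_if_Re_pos)
  have e1: "h1 = g1 * g2 * exp (2 * u * l2) / sp"
    using d1 sp unfolding g_def h_def by (simp add: field_simps exp_minus)
  have e2: "h2 = g3 * g4 * exp ((2 * u + 2/3) * l2) / sp"
  proof -
    have "exp ((2 * u + 2/3) * l2) * exp ((- 2 * u - 2/3) * l2) = 1" by (simp add: algebra_simps flip: exp_add)
    thus ?thesis using d2 sp unfolding g_def h_def by (simp add: field_simps)
  qed
  have e3: "g2 * g4 / h3 = c2 * (c1 / 3) * exp (- 3 * u * l3) / g5"
  proof -
    have t': "g5 * g2 * g4 / h3 * exp ((3 * u + 2) * l3) = c2 * (c1 / 3) * exp (2 * l3)"
      unfolding g_def h_def c_def by (rule t)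
    have x: "exp ((3 * u + 2) * l3) * exp (- (3 * u + 2) * l3) = 1"
      "exp (2 * l3) * exp (- (3 * u + 2) * l3) = exp (- 3 * u * l3)"
      by (simp_all add: algebra_simps flip: exp_add)
    have "g5 * g2 * g4 / h3 = g5 * g2 * g4 / h3 * (exp ((3 * u + 2) * l3) * exp (- (3 * u + 2) * l3))"
      unfolding x by simp
    also have "\<dots> = c2 * (c1 / 3) * (exp (2 * l3) * exp (- (3 * u + 2) * l3))"
      unfolding mult.assoc[symmetric] t' ..
    finally have "g5 * g2 * g4 / h3 = c2 * (c1 / 3) * exp (- 3 * u * l3)" unfolding x .
    thus ?thesis using nz by (simp add: field_simps)
  qed
  have a: "of_real (3 / sqrt 8) powr (2 * u) = exp (2 * u * l3 - 3 * u * l2)"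
    using of_real_powr_exp[of "3 / sqrt 8" "2 * u"] by (simp add: ln_div ln_sqrt8 l2_def l3_def algebra_simps)
  have b: "(2/3) powr u = exp (u * l2 - u * l3)"
    using of_real_powr_exp[of "2/3" u] by (simp add: ln_div l2_def l3_def algebra_simps)
  have c: "complex_of_real (2 powr (1/3)) = exp (l2 / 3)"
    by (simp add: powr_def l2_def flip: exp_of_real)
  have "moment_expr2 s = h1 * h2 / (2/3 * c2 * h3) * exp (2 * u * l3 - 3 * u * l2)"
    unfolding moment_expr2_def s a[symmetric] h_def c_def G2 by simp
  also have "\<dots> = g1 * g3 * (g2 * g4 / h3) * (exp (2 * u * l2) * exp ((2 * u + 2/3) * l2) * exp (2 * u * l3 - 3 * u * l2)) * 3 / (2 * c2 * (sp * sp))"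
    unfolding e1 e2 using nz sp(1) by (simp add: field_simps)
  also have "\<dots> = g1 * g3 / g5 * c1 / (2 * of_real pi) * (exp (- 3 * u * l3) * exp (2 * u * l2) * exp ((2 * u + 2/3) * l2) * exp (2 * u * l3 - 3 * u * l2))"
    unfolding e3 sp(2) using nz by (simp add: field_simps)
  also have "exp (- 3 * u * l3) * exp (2 * u * l2) * exp ((2 * u + 2/3) * l2) * exp (2 * u * l3 - 3 * u * l2)
     = exp l2 * exp (- l2 / 3) * exp (u * l2 - u * l3)"
    by (simp add: algebra_simps flip: exp_add)
  also have "exp l2 = 2" by (simp add: l2_def exp_of_real)
  also have "g1 * g3 / g5 * c1 / (2 * of_real pi) * (2 * exp (- l2 / 3) * exp (u * l2 - u * l3))
     = c1 / (exp (l2 / 3) * of_real pi) * (g1 * g3 / g5) * exp (u * l2 - u * l3)"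
    by (simp add: exp_minus field_simps)
  also have "\<dots> = moment_expr4 s"
    unfolding moment_expr4_def s g_def c_def b[symmetric] c[symmetric] using Gamma_complex_of_real[of "1/3"] by simp
  finally show ?thesis .
qed

text \<open>Duplication at \<open>u + 2/3\<close> treats the denominator of the third formula and
  triplication at \<open>u + 1/2\<close> its numerator; \<open>Gamma (u + 7/6)\<close> occurs in
  both and cancels.\<close>

lemma moment_expr3_eq_4:
  assumes "Re s > -1"
  shows "moment_expr3 s = moment_expr4 s"
proof -
  define u where "u = s / 2"
  have s: "s = 2 * u" by (simp add: u_def)
  have u: "Re u > -1/2" using assms by (simp add: u_def)
  define l2 l3 where "l2 = complex_of_real (ln 2)" and "l3 = complex_of_real (ln 3)"
  define sp where "sp = complex_of_real (sqrt pi)"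
  have sp: "sp \<noteq> 0" "sp * sp = of_real pi" by (simp_all add: sp_def flip: of_real_mult)
  have d: "Gamma (u + 2/3) * Gamma (u + 7/6) = exp ((- 2 * u - 1/3) * l2) * sp * Gamma (2 * u + 4/3)"
    using Gamma_legendre_duplication[of "u + 2/3"] u
      not_nonpos_Int_if_Re_pos[of "u + 2/3"] not_nonpos_Int_if_Re_pos[of "u + 7/6"]
    by (simp add: algebra_simps l2_def sp_def)
  \<comment> \<open>The constant of the triplication, read off at \<open>u = 0\<close>. Once
    \<open>Gamma (7/6)\<close> and \<open>Gamma (3/2)\<close> are shifted down by 1, it is the
    reflection formula at \<open>1/6\<close>, where the sine is \<open>1/2\<close>.\<close>
  have K: "Gamma (1/2) * Gamma (5/6) * Gamma (7/6) / Gamma (3/2) = 2 * complex_of_real pi / 3"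
  proof -
    have 1: "Gamma (3/2) = 1/2 * (Gamma (1/2) :: complex)" using Gamma_rec_complex[of "1/2"] by simp
    have 2: "Gamma (7/6) = 1/6 * (Gamma (1/6) :: complex)" using Gamma_rec_complex[of "1/6"] by simp
    have 3: "Gamma (1/2) \<noteq> (0::complex)" by (rule Gamma_neq_0_if_Re_pos) simp
    have "sin (of_real pi * (1/6)) = complex_of_real (sin (pi / 6))" by (simp flip: sin_of_real)
    hence 4: "sin (of_real pi * (1/6)) = (1/2 :: complex)" by (simp add: sin_30)
    have "Gamma (1/6) * Gamma (5/6) = 2 * complex_of_real pi"
      using Gamma_reflection_complex[of "1/6"] unfolding 4 by simp
    thus ?thesis unfolding 1 2 using 3 by (simp add: field_simps)
  qed
  have t: "Gamma (u + 1/2) * Gamma (u + 5/6) * Gamma (u + 7/6) / Gamma (3 * u + 3/2) * exp ((3 * u + 3/2) * l3)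
     = 2 * of_real pi / 3 * exp (3/2 * l3)"
  proof -
    have "Gamma (u + 1/2) * Gamma (u + 5/6) * Gamma (u + 7/6) / Gamma (3 * u + 3/2) * exp ((3 * u + 3/2) * l3)
       = Gamma (1/2) * Gamma (5/6) * Gamma (7/6) / Gamma (3/2) * exp (3/2 * l3)"
      using Gamma_triplication_ratio[of "u + 1/2" "1/2"] u by (simp add: algebra_simps l3_def)
    thus ?thesis unfolding K .
  qed
  define g1 g3 g4 g5 where g_def: "g1 = Gamma (u + 1/2)" "g3 = Gamma (u + 5/6)"
    "g4 = Gamma (u + 7/6)" "g5 = Gamma (u + 2/3)"
  define h1 h3 where h_def: "h1 = Gamma (2 * u + 4/3)" "h3 = Gamma (3 * u + 3/2)"
  define c1 where c_def: "c1 = (Gamma (1/3) :: complex)"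
  have nz: "g1 \<noteq> 0" "g3 \<noteq> 0" "g4 \<noteq> 0" "g5 \<noteq> 0" "h1 \<noteq> 0" "h3 \<noteq> 0" "c1 \<noteq> 0"
    unfolding g_def h_def c_def using u by (auto intro!: Gamma_neq_0_if_Re_pos)
  have e1: "h1 = g5 * g4 * exp ((2 * u + 1/3) * l2) / sp"
  proof -
    have "exp ((2 * u + 1/3) * l2) * exp ((- 2 * u - 1/3) * l2) = 1" by (simp add: algebra_simps flip: exp_add)
    thus ?thesis using d sp unfolding g_def h_def by (simp add: field_simps)
  qed
  have e3: "g1 * g3 = h3 / g4 * (2 * of_real pi / 3 * exp (- 3 * u * l3))"
  proof -
    have t': "g1 * g3 * g4 / h3 * exp ((3 * u + 3/2) * l3) = 2 * of_real pi / 3 * exp (3/2 * l3)"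
      unfolding g_def h_def by (rule t)
    have x: "exp ((3 * u + 3/2) * l3) * exp (- (3 * u + 3/2) * l3) = 1"
      "exp (3/2 * l3) * exp (- (3 * u + 3/2) * l3) = exp (- 3 * u * l3)"
      by (simp_all add: algebra_simps flip: exp_add)
    have "g1 * g3 * g4 / h3 = g1 * g3 * g4 / h3 * (exp ((3 * u + 3/2) * l3) * exp (- (3 * u + 3/2) * l3))"
      unfolding x by simp
    also have "\<dots> = 2 * of_real pi / 3 * (exp (3/2 * l3) * exp (- (3 * u + 3/2) * l3))"
      unfolding mult.assoc[symmetric] t' ..
    finally have "g1 * g3 * g4 / h3 = 2 * of_real pi / 3 * exp (- 3 * u * l3)" unfolding x .
    thus ?thesis using nz by (simp add: field_simps)
  qed
  have a: "of_real (sqrt 8 / 9) powr (2 * u) = exp (3 * u * l2 - 4 * u * l3)"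
  proof -
    have "ln (9::real) = ln (3 ^ 2)" by simp
    also have "\<dots> = 2 * ln 3" by (subst ln_realpow) simp_all
    finally show ?thesis using of_real_powr_exp[of "sqrt 8 / 9" "2 * u"] by (simp add: ln_div ln_sqrt8 l2_def l3_def algebra_simps)
  qed
  have b: "(2/3) powr u = exp (u * l2 - u * l3)"
    using of_real_powr_exp[of "2/3" u] by (simp add: ln_div l2_def l3_def algebra_simps)
  have c: "complex_of_real (2 powr (1/3)) = exp (l2 / 3)"
    by (simp add: powr_def l2_def flip: exp_of_real)
  have "moment_expr4 s = c1 / (exp (l2 / 3) * of_real pi) * (g1 * g3 / g5) * exp (u * l2 - u * l3)"
    unfolding moment_expr4_def s g_def c_def b[symmetric] c[symmetric] using Gamma_complex_of_real[of "1/3"] by simp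
  also have "\<dots> = c1 * (2 / 3) * (h3 / (g4 * g5)) * (exp (- (l2 / 3)) * exp (- 3 * u * l3) * exp (u * l2 - u * l3))"
    unfolding e3 by (simp add: exp_minus field_simps)
  also have "exp (- (l2 / 3)) * exp (- 3 * u * l3) * exp (u * l2 - u * l3)
     = exp (- ((2 * u + 1/3) * l2)) * exp (3 * u * l2 - 4 * u * l3)"
    by (simp add: algebra_simps flip: exp_add)
  also have "c1 * (2 / 3) * (h3 / (g4 * g5)) * (exp (- ((2 * u + 1/3) * l2)) * exp (3 * u * l2 - 4 * u * l3))
     = 2 * c1 / (3 * sp) * (h3 / h1) * exp (3 * u * l2 - 4 * u * l3)"
    unfolding e1 using nz sp(1) by (simp add: exp_minus field_simps)
  also have "\<dots> = moment_expr3 s"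
    unfolding moment_expr3_def s h_def c_def a[symmetric] sp_def using Gamma_complex_of_real[of "1/3"] by simp
  finally show ?thesis ..
qed

text \<open>Shifting \<open>s + 2/3\<close> and \<open>3 * s / 2 + 1\<close> up by 1 produces the
  factors \<open>s + 2/3\<close> and \<open>3/2 * (s + 2/3)\<close>, and \<open>Gamma (5/3)\<close>
  supplies the missing \<open>2/3\<close>. At the excluded point both shifted Gammas start from the
  pole 0, where \<open>Gamma\<close> has the value 0 by convention.\<close>

lemma moment_expr1_eq_2:
  assumes "Re s > -1" "s \<noteq> -2/3"
  shows "moment_expr1 s = moment_expr2 s"
proof -
  define v where "v = s + 2/3"
  have 1: "s + 2/3 \<noteq> 0" using assms(2) by (metis add_eq_0_iff2 minus_divide_left)
  have n: "z \<notin> \<int>\<^sub>\<le>\<^sub>0" if "Re z > -1" "z \<noteq> 0" for z :: complex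
    using that by (auto elim!: nonpos_Ints_cases)
  have a: "Gamma (s + 2/3 + 1) = (s + 2/3) * Gamma (s + 2/3)"
    by (rule Gamma_plus1, rule n) (use assms 1 in auto)
  have b: "Gamma (3 * s / 2 + 1 + 1) = (3 * s / 2 + 1) * Gamma (3 * s / 2 + 1)"
    by (rule Gamma_plus1, rule n) (use assms 1 in \<open>auto simp: field_simps\<close>)
  have c: "Gamma (2/3 + 1) = 2/3 * (Gamma (2/3) :: complex)" by (rule Gamma_rec_complex) simp
  have e: "s + 5/3 = s + 2/3 + 1" "3 * s / 2 + 2 = 3 * s / 2 + 1 + 1" "(5/3::complex) = 2/3 + 1" by simp_all
  have f: "3 * s / 2 + 1 = 3/2 * (s + 2/3)" by (simp add: algebra_simps)
  show ?thesis unfolding moment_expr1_def moment_expr2_def e(1) unfolding e(2,3) a b c unfolding f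
    unfolding v_def[symmetric] using 1[folded v_def] by simp
qed

text \<open>Formulas 2 to 4 are analytic on the half-plane, so \<open>remove_sings\<close> leaves
  them unchanged there. For formula 1 it suffices that \<open>moment_expr1\<close> agrees with the
  analytic \<open>moment_expr2\<close> in a punctured neighbourhood of \<open>s\<close>, which also
  settles \<open>s = -2/3\<close>.\<close>

lemma moment_formulas:
  assumes s: "Re s > -1"
  shows "moment_formula1 s = moment_expr2 s" "moment_formula2 s = moment_expr2 s"
    "moment_formula3 s = moment_expr2 s" "moment_formula4 s = moment_expr2 s"
proof -
  have powr: "(\<lambda>z. of_real a powr f z) analytic_on {s}" if "a > 0" "f analytic_on {s}" for a f
    unfolding of_real_powr_exp[OF that(1)] by (intro analytic_intros that)
  have rp: "(2/3 :: complex) = of_real (2/3)" by simp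
  have nn: "Re z \<le> 0" if "z \<in> \<int>\<^sub>\<le>\<^sub>0" for z
    using that not_nonpos_Int_if_Re_pos[of z] by linarith
  note intros = analytic_on_mult analytic_on_divide analytic_on_const analytic_on_add analytic_on_ident
    analytic_on_Gamma' powr no_zero_divisors Gamma_neq_0_if_Re_pos
  have a2: "moment_expr2 analytic_on {s}" unfolding moment_expr2_def
    using s by (intro intros) (auto dest!: nn)
  have a3: "moment_expr3 analytic_on {s}" unfolding moment_expr3_def
    using s by (intro intros) (auto dest!: nn)
  have a4: "moment_expr4 analytic_on {s}" unfolding moment_expr4_def rp
    using s by (intro intros) (auto dest!: nn)
  show m2: "moment_formula2 s = moment_expr2 s"
    unfolding moment_formula2_def moment_expr2_def[symmetric] by (rule remove_sings_at_analytic[OF a2])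
  show "moment_formula3 s = moment_expr2 s"
    unfolding moment_formula3_def moment_expr3_def[symmetric] remove_sings_at_analytic[OF a3]
    using moment_expr3_eq_4[OF s] moment_expr2_eq_4[OF s] by simp
  show "moment_formula4 s = moment_expr2 s"
    unfolding moment_formula4_def moment_expr4_def[symmetric] remove_sings_at_analytic[OF a4]
    using moment_expr2_eq_4[OF s] by simp
  have "open ({z. Re z > -1} - {-2/3 :: complex})"
    by (intro open_Diff open_halfspace_Re_gt) auto
  have "\<forall>\<^sub>F z in at s. z \<in> {z. Re z > -1}"
    using s by (intro eventually_at_in_open' open_halfspace_Re_gt) auto
  moreover have "\<forall>\<^sub>F z in at s. z \<noteq> -2/3"
    by (cases "s = -2/3") (auto intro: eventually_neq_at_within)
  ultimately have ev: "\<forall>\<^sub>F z in at s. moment_expr1 z = moment_expr2 z"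
    by eventually_elim (auto intro: moment_expr1_eq_2)
  have "remove_sings moment_expr1 s = remove_sings moment_expr2 s"
    by (rule remove_sings_cong[OF ev]) simp
  thus "moment_formula1 s = moment_expr2 s"
    unfolding moment_formula1_def moment_expr1_def[symmetric] remove_sings_at_analytic[OF a2] .
qed

section \<open>From walks to the Brownian path\<close>

text \<open>With Riemann sums written as integrals of step functions, their limits follow by
  dominated convergence. This serves both the area over \<open>[0,1]\<close> and the time integral
  of the transform. The half-open cells match the floor function exactly.\<close>

lemma has_bochner_integral_step:
  fixes c :: "nat \<Rightarrow> real"
  assumes h: "h > 0"
  shows "has_bochner_integral lborel
    (\<lambda>t. indicator {0..<real N * h} t * c (nat \<lfloor>t / h\<rfloor>)) (h * (\<Sum>k<N. c k))"
proof -
  have eq: "indicator {0..<real N * h} t * c (nat \<lfloor>t / h\<rfloor>)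
      = (\<Sum>k<N. c k * indicator {real k * h..<real (Suc k) * h} t)" for t :: real
  proof (cases "t \<in> {0..<real N * h}")
    case True
    define q where "q = nat \<lfloor>t / h\<rfloor>"
    have q: "real q \<le> t / h" "t / h < real (Suc q)"
      using True h by (auto simp: q_def) linarith+
    have "t / h < real N" using True h by (simp add: field_simps)
    hence qN: "q < N" using q by linarith
    have ind: "indicator {real k * h..<real (Suc k) * h} t = (if k = q then 1 else 0 :: real)" for k
    proof -
      have "t \<in> {real k * h..<real (Suc k) * h} \<longleftrightarrow> real k \<le> t / h \<and> t / h < real (Suc k)"
        using h by (simp add: field_simps)
      also have "\<dots> \<longleftrightarrow> k = q" using q by (auto simp: not_less)
      finally show ?thesis by (simp add: indicator_def)
    qed
    have "(\<Sum>k<N. c k * indicator {real k * h..<real (Suc k) * h} t) = (\<Sum>k<N. if k = q then c k else 0)"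
      by (intro sum.cong refl) (unfold ind, simp)
    also have "\<dots> = c q" using qN by (simp add: sum.delta)
    finally show ?thesis using True by (simp add: q_def)
  next
    case False
    have "t \<notin> {real k * h..<real (Suc k) * h}" if "k < N" for k
    proof
      assume a: "t \<in> {real k * h..<real (Suc k) * h}"
      have "real (Suc k) * h \<le> real N * h" using that h by (intro mult_right_mono) auto
      moreover have "0 \<le> real k * h" using h by simp
      ultimately show False using a False by simp
    qed
    hence "(\<Sum>k<N. c k * indicator {real k * h..<real (Suc k) * h} t) = 0"
      by (intro sum.neutral ballI) (metis indicator_simps(2) lessThan_iff mult_zero_right)
    moreover have "indicator {0..<real N * h} t = (0 :: real)" using False by simp
    ultimately show ?thesis by (simp only: mult_zero_left)
  qed
  have "has_bochner_integral lborel (\<lambda>t. \<Sum>k<N. c k * indicator {real k * h..<real (Suc k) * h} t) (\<Sum>k<N. c k * h)"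
  proof (rule has_bochner_integral_sum)
    fix k
    have le: "real k * h \<le> real (Suc k) * h" using h by (intro mult_right_mono) auto
    have "has_bochner_integral lborel (indicator {real k * h..<real (Suc k) * h}) (measure lborel {real k * h..<real (Suc k) * h})"
      by (rule has_bochner_integral_real_indicator) (use emeasure_lborel_Ico[OF le] in auto)
    moreover have "measure lborel {real k * h..<real (Suc k) * h} = h"
      unfolding measure_lborel_Ico[OF le] by (simp add: algebra_simps)
    ultimately show "has_bochner_integral lborel (\<lambda>t. c k * indicator {real k * h..<real (Suc k) * h} t) (c k * h)"
      by (simp add: has_bochner_integral_mult_right)
  qed
  thus ?thesis unfolding eq by (simp add: sum_distrib_left mult.commute)
qed

section \<open>Maxima over a grid\<close>

definition grid_max :: "(nat \<Rightarrow> real) \<Rightarrow> nat \<Rightarrow> real" where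
  "grid_max b j = Max (b ` {..j})"

lemma wmax_increments: "wmax (\<lambda>i. b (Suc i) - b i) j = grid_max b j - b 0"
proof (induction j)
  case (Suc j)
  have "grid_max b (Suc j) = max (b (Suc j)) (grid_max b j)"
    unfolding grid_max_def atMost_Suc image_insert by (rule Max_insert) auto
  moreover have "(\<Sum>i<Suc j. b (Suc i) - b i) = b (Suc j) - b 0" by (rule sum_lessThan_telescope)
  ultimately show ?case unfolding wmax.simps Suc by simp
qed (simp add: grid_max_def)

text \<open>For \<open>k = 0\<close> the value is 0.\<close>

definition grid_area :: "(real \<Rightarrow> 'a \<Rightarrow> real) \<Rightarrow> nat \<Rightarrow> 'a \<Rightarrow> real" where
  "grid_area B k \<omega> = (1 / real k) * (\<Sum>j<k. grid_max (\<lambda>i. B (real i / real k) \<omega>) j)"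

text \<open>Grid points up to \<open>t\<close> never overshoot the supremum. Conversely each
  \<open>u \<le> t\<close> has a grid point less than \<open>1 / real k\<close> to its left, of
  index at most \<open>nat \<lfloor>t * real k\<rfloor>\<close>, and uniform continuity compares the
  two values.\<close>

lemma grid_max_floor_tendsto:
  fixes b :: "real \<Rightarrow> real"
  assumes cont: "continuous_on {0..1} b" and t: "0 \<le> t" "t < 1"
  shows "(\<lambda>k. grid_max (\<lambda>i. b (real i / real k)) (nat \<lfloor>t * real k\<rfloor>)) \<longlonglongrightarrow> (SUP u\<in>{0..t}. b u)"
proof (rule LIMSEQ_I)
  fix r :: real assume r: "r > 0"
  have "uniformly_continuous_on {0..1} b"
    by (rule compact_uniformly_continuous[OF cont]) auto
  then obtain \<delta> where \<delta>: "\<delta> > 0"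
    and uc: "\<And>x y. x \<in> {0..1} \<Longrightarrow> y \<in> {0..1} \<Longrightarrow> dist y x < \<delta> \<Longrightarrow> dist (b y) (b x) < r / 2"
    unfolding uniformly_continuous_on_def using r by (meson half_gt_zero)
  have bdd: "bdd_above (b ` {0..t})"
  proof (rule bounded_imp_bdd_above, rule compact_imp_bounded, rule compact_continuous_image)
    show "continuous_on {0..t} b" using cont t by (auto intro: continuous_on_subset)
  qed auto
  obtain k0 :: nat where k0: "1 / \<delta> < real k0" using reals_Archimedean2 by blast
  show "\<exists>no. \<forall>k\<ge>no. norm (grid_max (\<lambda>i. b (real i / real k)) (nat \<lfloor>t * real k\<rfloor>) - (SUP u\<in>{0..t}. b u)) < r"
  proof (intro exI allI impI)
    fix k assume k: "k \<ge> Suc k0"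
    hence kp: "real k > 0" by simp
    have k1: "1 / real k < \<delta>" 
    proof -
      have "1 / \<delta> < real k" using k0 k by linarith
      thus ?thesis using \<delta> kp by (simp add: field_simps)
    qed
    define q where "q = nat \<lfloor>t * real k\<rfloor>"
    define m where "m = grid_max (\<lambda>i. b (real i / real k)) q"
    have q: "real q \<le> t * real k" using t kp by (simp add: q_def)
    have up: "m \<le> (SUP u\<in>{0..t}. b u)"
      unfolding m_def grid_max_def
    proof (rule Max.boundedI)
      fix a assume "a \<in> (\<lambda>i. b (real i / real k)) ` {..q}"
      then obtain i where i: "i \<le> q" "a = b (real i / real k)" by auto
      have "real i \<le> t * real k" using i q by linarith
      hence "real i / real k \<in> {0..t}" using kp by (simp add: field_simps)
      thus "a \<le> (SUP u\<in>{0..t}. b u)" unfolding i(2) by (intro cSUP_upper bdd)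
    qed auto
    have "(SUP u\<in>{0..t}. b u) \<le> m + r / 2"
    proof (rule cSUP_least)
      fix u assume u: "u \<in> {0..t}"
      define i where "i = nat \<lfloor>u * real k\<rfloor>"
      have "u * real k \<ge> 0" using u kp by simp
      hence i: "real i \<le> u * real k" "u * real k < real i + 1" by (auto simp: i_def)
      have "i \<le> q" unfolding i_def q_def using u kp by (intro nat_mono floor_mono mult_right_mono) auto
      hence im: "b (real i / real k) \<le> m" unfolding m_def grid_max_def by (intro Max_ge) auto
      have iu: "real i / real k \<le> u" "u < real i / real k + 1 / real k"
        using i kp by (auto simp: field_simps)
      have "dist (b u) (b (real i / real k)) < r / 2"
        by (rule uc) (use iu u t k1 in \<open>auto simp: dist_real_def\<close>)
      hence "\<bar>b u - b (real i / real k)\<bar> < r / 2" by (simp only: dist_real_def)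
      thus "b u \<le> m + r / 2" using im by linarith
    qed (use t in auto)
    thus "norm (grid_max (\<lambda>i. b (real i / real k)) (nat \<lfloor>t * real k\<rfloor>) - (SUP u\<in>{0..t}. b u)) < r"
      using up r by (simp add: m_def q_def)
  qed
qed

lemma grid_max_bound:
  assumes "\<And>i. i \<le> j \<Longrightarrow> \<bar>b i\<bar> \<le> C"
  shows "\<bar>grid_max b j\<bar> \<le> C"
proof -
  have "grid_max b j \<in> b ` {..j}" unfolding grid_max_def by (rule Max_in) auto
  thus ?thesis using assms by auto
qed

context standard_brownian_motion
begin

text \<open>Dominated convergence in time along one fixed path, with the bound of the continuous
  path on \<open>[0,1]\<close>. Measurability of the running maximum in \<open>t\<close> is
  inherited from the step functions.\<close>

lemma grid_area_tendsto:
  assumes \<omega>: "\<omega> \<in> space M"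
  shows "(\<lambda>k. grid_area B k \<omega>) \<longlonglongrightarrow> sup_area B \<omega>"
proof -
  define b where "b t = B t \<omega>" for t
  have cont: "continuous_on {0..1} b"
    unfolding b_def using continuous_paths[OF \<omega>] by (rule continuous_on_subset) auto
  have "bounded (b ` {0..1})"
    by (rule compact_imp_bounded, rule compact_continuous_image[OF cont]) auto
  then obtain C where "\<forall>x\<in>b ` {0..1}. norm x \<le> C"
    unfolding bounded_iff by blast
  hence C: "\<bar>b u\<bar> \<le> C" if "u \<in> {0..1}" for u using that by auto
  define f where "f k t = indicator {0..<1} t * grid_max (\<lambda>i. b (real i / real k)) (nat \<lfloor>t * real k\<rfloor>)" for k t
  define g where "g t = indicator {0..<1} t * (SUP u\<in>{0..t}. b u)" for t :: real
  have hbi: "has_bochner_integral lborel (f k) (grid_area B k \<omega>)" if "k > 0" for k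
    using has_bochner_integral_step[of "1 / real k" k "grid_max (\<lambda>i. b (real i / real k))"] that
    by (simp add: f_def[abs_def] grid_area_def b_def)
  have lim: "(\<lambda>k. f (Suc k) t) \<longlonglongrightarrow> g t" for t
  proof (cases "t \<in> {0..<1}")
    case True
    have "(\<lambda>k. grid_max (\<lambda>i. b (real i / real k)) (nat \<lfloor>t * real k\<rfloor>)) \<longlonglongrightarrow> (SUP u\<in>{0..t}. b u)"
      by (rule grid_max_floor_tendsto[OF cont]) (use True in auto)
    from LIMSEQ_Suc[OF this] show ?thesis using True by (simp add: f_def g_def)
  qed (simp add: f_def g_def)
  have fm: "f (Suc k) \<in> borel_measurable lborel" for k
    using hbi[of "Suc k"] by (auto intro: borel_measurable_has_bochner_integral)
  have gm: "g \<in> borel_measurable lborel"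
    by (rule borel_measurable_LIMSEQ_metric[OF fm lim])
  have "(\<lambda>k. \<integral>t. f (Suc k) t \<partial>lborel) \<longlonglongrightarrow> (\<integral>t. g t \<partial>lborel)"
  proof (rule integral_dominated_convergence[where w="\<lambda>t. C * indicator {0..<1} t"])
    show "integrable lborel (\<lambda>t. C * indicator {0..<1::real} t)" by simp
    show "AE t in lborel. norm (f (Suc k) t) \<le> C * indicator {0..<1} t" for k
    proof (rule AE_I2)
      fix t :: real
      show "norm (f (Suc k) t) \<le> C * indicator {0..<1} t"
      proof (cases "t \<in> {0..<1}")
        case True
        have "\<bar>grid_max (\<lambda>i. b (real i / real (Suc k))) (nat \<lfloor>t * real (Suc k)\<rfloor>)\<bar> \<le> C"
        proof (rule grid_max_bound, rule C)
          fix i assume i: "i \<le> nat \<lfloor>t * real (Suc k)\<rfloor>"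
          have "real i \<le> t * real (Suc k)" using i True by (simp add: le_nat_floor le_nat_iff le_floor_iff)
          also have "\<dots> \<le> 1 * real (Suc k)" using True by (intro mult_right_mono) auto
          finally show "real i / real (Suc k) \<in> {0..1}" by (simp add: field_simps)
        qed
        thus ?thesis using True by (simp add: f_def abs_mult)
      qed (simp add: f_def)
    qed
  qed (use fm gm lim in auto)
  moreover have "(\<integral>t. f (Suc k) t \<partial>lborel) = grid_area B (Suc k) \<omega>" for k
    by (rule has_bochner_integral_integral_eq[OF hbi]) simp
  moreover have "(\<integral>t. g t \<partial>lborel) = sup_area B \<omega>"
  proof -
    define r where "r t = indicator {0..1} t * (SUP u\<in>{0..t}. b u)" for t :: real
    \<comment> \<open>The step functions live on the half-open interval; the endpoint 1 is a null
      set.\<close>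
    have r: "r = (\<lambda>t. g t + indicator {1} t * (SUP u\<in>{0..1}. b u))"
      by (auto simp: r_def g_def fun_eq_iff split: split_indicator)
    have rm: "r \<in> borel_measurable lborel" unfolding r using gm by measurable
    have "(\<integral>t. g t \<partial>lborel) = (\<integral>t. r t \<partial>lborel)"
    proof (rule integral_cong_AE[OF gm rm])
      show "AE t in lborel. g t = r t"
        using AE_lborel_singleton[of 1] by eventually_elim (simp add: r)
    qed
    thus ?thesis
      by (simp add: sup_area_def set_lebesgue_integral_def running_max_def r_def[abs_def] b_def)
  qed
  ultimately have "(\<lambda>k. grid_area B (Suc k) \<omega>) \<longlonglongrightarrow> sup_area B \<omega>" by simp
  thus ?thesis by (rule LIMSEQ_imp_Suc)
qed

section \<open>Scaling of the increments\<close>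

definition incr :: "real \<Rightarrow> nat \<Rightarrow> 'a \<Rightarrow> real" where
  "incr r i \<omega> = B (real (Suc i) * r) \<omega> - B (real i * r) \<omega>"

definition std_incr :: "real \<Rightarrow> nat \<Rightarrow> 'a \<Rightarrow> real" where
  "std_incr r i \<omega> = incr r i \<omega> / sqrt r"

lemma indep_incr: "r > 0 \<Longrightarrow> indep_vars (\<lambda>_. borel) (incr r) {..<n}"
  unfolding incr_def[abs_def]
  by (rule independent_increments[of "\<lambda>i. real i * r" n]) (auto simp: mono_on_def mult_right_mono)

lemma indep_std_incr: "r > 0 \<Longrightarrow> indep_vars (\<lambda>_. borel) (std_incr r) {..<n}"
  unfolding std_incr_def[abs_def] by (rule indep_vars_compose2[OF indep_incr]) auto

lemma distributed_incr:
  assumes "r > 0"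
  shows "distributed M lborel (incr r i) (normal_density 0 (sqrt r))"
proof -
  have "real (Suc i) * r - real i * r = r" by (simp add: algebra_simps)
  thus ?thesis
    using normal_increments[of "real i * r" "real (Suc i) * r"] assms
    by (simp add: incr_def[abs_def])
qed

lemma distr_std_incr:
  assumes "r > 0"
  shows "distr M borel (std_incr r i) = density lborel std_normal_density"
proof -
  have "distributed M lborel (\<lambda>\<omega>. (incr r i \<omega> - 0) / sqrt r) std_normal_density"
    using normal_standard_normal_convert[of "sqrt r" "incr r i" 0] distributed_incr[OF assms] assms by simp
  hence "distr M lborel (std_incr r i) = density lborel std_normal_density"
    by (simp add: distributed_distr_eq_density std_incr_def[abs_def])
  thus ?thesis by (simp cong: distr_cong)
qed

text \<open>For every step size the standardized increments are independent standard normal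
  variables, so their joint law is one and the same product measure. This is Brownian scaling on a
  grid.\<close>

lemma expectation_std_incr_cong:
  assumes r: "r > 0" "r' > 0" and f: "f \<in> borel_measurable (PiM {..<n} (\<lambda>_. borel))"
  shows "expectation (\<lambda>\<omega>. f (\<lambda>i\<in>{..<n}. std_incr r i \<omega>)) = expectation (\<lambda>\<omega>. f (\<lambda>i\<in>{..<n}. std_incr r' i \<omega>) :: real)"
proof (cases "n = 0")
  \<comment> \<open>The characterisation of independence by product measures requires a nonempty
    index set.\<close>
  case False
  have *: "expectation (\<lambda>\<omega>. f (\<lambda>i\<in>{..<n}. std_incr r i \<omega>))
      = (\<integral>x. f x \<partial>(PiM {..<n} (\<lambda>_. density lborel std_normal_density)))" if r: "r > 0" for r
  proof -
    have m: "std_incr r i \<in> borel_measurable M" if "i \<in> {..<n}" for i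
      using indep_std_incr[OF r, of n] that unfolding indep_vars_def by auto
    hence "(\<lambda>\<omega>. \<lambda>i\<in>{..<n}. std_incr r i \<omega>) \<in> measurable M (PiM {..<n} (\<lambda>_. borel))"
      by (intro measurable_restrict)
    hence "expectation (\<lambda>\<omega>. f (\<lambda>i\<in>{..<n}. std_incr r i \<omega>))
      = (\<integral>x. f x \<partial>(distr M (PiM {..<n} (\<lambda>_. borel)) (\<lambda>\<omega>. \<lambda>i\<in>{..<n}. std_incr r i \<omega>)))"
      by (rule integral_distr[symmetric]) (rule f)
    also have "distr M (PiM {..<n} (\<lambda>_. borel)) (\<lambda>\<omega>. \<lambda>i\<in>{..<n}. std_incr r i \<omega>)
        = PiM {..<n} (\<lambda>i. distr M borel (std_incr r i))"
      by (rule indep_vars_iff_distr_eq_PiM'[THEN iffD1]) (use indep_std_incr[OF r] m False in auto)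
    finally show ?thesis unfolding distr_std_incr[OF r] .
  qed
  show ?thesis using *[OF r(1)] *[OF r(2)] by simp
qed (simp add: restrict_def)

lemma expectation_wmax_cong:
  assumes r: "r > 0" "r' > 0"
  shows "expectation (\<lambda>\<omega>. exp (- c * (\<Sum>j<k. wmax (\<lambda>i. std_incr r i \<omega>) j)))
    = expectation (\<lambda>\<omega>. exp (- c * (\<Sum>j<k. wmax (\<lambda>i. std_incr r' i \<omega>) j)))"
proof -
  define f where "f w = exp (- c * (\<Sum>j<k. wmax w j))" for w
  have f: "f \<in> borel_measurable (PiM {..<k} (\<lambda>_. borel))"
  proof -
    have [measurable]: "(\<lambda>w. \<Sum>j<k. wmax w j) \<in> borel_measurable (PiM {..<k} (\<lambda>_. borel))"
      by (intro borel_measurable_sum measurable_wmax measurable_component_singleton) auto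
    show ?thesis unfolding f_def[abs_def] by measurable
  qed
  have fr: "f (\<lambda>i\<in>{..<k}. w i) = f w" for w
  proof -
    have "(\<Sum>j<k. wmax (\<lambda>i\<in>{..<k}. w i) j) = (\<Sum>j<k. wmax w j)"
      by (intro sum.cong wmax_cong) auto
    thus ?thesis by (simp add: f_def)
  qed
  show ?thesis using expectation_std_incr_cong[OF r f] unfolding fr unfolding f_def .
qed

lemma walk_incr:
  assumes h: "h > 0"
  shows "walk M (incr h) h N"
proof -
  have s: "sqrt h > 0" using h by simp
  have int: "integrable M (\<lambda>\<omega>. incr h i \<omega> ^ n)" for i n
    using distributed_integrable[OF distributed_incr[OF h], of "\<lambda>x. x ^ n" i] integrable_normal_moment[OF s, of 0 n]
    by simp
  have E: "expectation (\<lambda>\<omega>. incr h i \<omega> ^ n) = (\<integral>x. normal_density 0 (sqrt h) x * (x - 0) ^ n \<partial>lborel)" for i n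
    using distributed_integral[OF distributed_incr[OF h], of "\<lambda>x. x ^ n" i] by simp
  show ?thesis
  proof
    show "indep_vars (\<lambda>_. borel) (incr h) {..<N}" by (rule indep_incr[OF h])
    show "h \<ge> 0" using h by simp
    fix i
    show "integrable M (\<lambda>\<omega>. incr h i \<omega> ^ 4)" by (rule int)
    show "expectation (incr h i) = 0"
      using E[of i 1] integral_normal_moment_odd[OF s, of 0 0] by simp
    show "expectation (\<lambda>\<omega>. (incr h i \<omega>)\<^sup>2) = h"
      using E[of i 2] integral_normal_moment_even[OF s, of 0 1] h by simp
    show "expectation (\<lambda>\<omega>. incr h i \<omega> ^ 4) = 3 * h\<^sup>2"
      using E[of i 4] integral_normal_moment_even[OF s, of 0 2] h
      by (simp add: fact_numeral power_divide)
  qed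
qed

text \<open>One factor \<open>1 / real k\<close> comes from averaging and one factor
  \<open>1 / sqrt (real k)\<close> from the size of the increments. The walk starts at 0, whereas
  \<open>B 0\<close> is 0 only almost surely.\<close>

lemma AE_grid_area:
  assumes k: "k > 0"
  shows "AE \<omega> in M. grid_area B k \<omega> = (\<Sum>j<k. wmax (\<lambda>i. std_incr (1 / real k) i \<omega>) j) / (real k * sqrt (real k))"
  using start_zero
proof eventually_elim
  case (elim \<omega>)
  define b where "b i = B (real i / real k) \<omega>" for i :: nat
  have *: "b (Suc i) - b i = (1 / sqrt (real k)) * std_incr (1 / real k) i \<omega>" for i
    using k by (simp add: std_incr_def incr_def b_def real_sqrt_divide)
  have "grid_max b j = (1 / sqrt (real k)) * wmax (\<lambda>i. std_incr (1 / real k) i \<omega>) j" for j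
  proof -
    have "grid_max b j = wmax (\<lambda>i. b (Suc i) - b i) j" using elim by (subst wmax_increments) (simp add: b_def)
    also have "\<dots> = (1 / sqrt (real k)) * wmax (\<lambda>i. std_incr (1 / real k) i \<omega>) j"
      unfolding * by (rule wmax_scale) simp
    finally show ?thesis .
  qed
  hence "grid_area B k \<omega> = (1 / real k) * ((1 / sqrt (real k)) * (\<Sum>j<k. wmax (\<lambda>i. std_incr (1 / real k) i \<omega>) j))"
    unfolding grid_area_def b_def[symmetric] by (simp add: sum_distrib_left)
  thus ?case by simp
qed

lemma measurable_grid_area [measurable]: "grid_area B k \<in> borel_measurable M"
proof -
  have [measurable]: "(\<lambda>\<omega>. grid_max (\<lambda>i. B (real i / real k) \<omega>) j) \<in> borel_measurable M" for j
  proof -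
    have "(\<lambda>\<omega>. grid_max (\<lambda>i. B (real i / real k) \<omega>) j)
        = (\<lambda>\<omega>. wmax (\<lambda>i. B (real (Suc i) / real k) \<omega> - B (real i / real k) \<omega>) j + B (real 0 / real k) \<omega>)"
      using wmax_increments[of "\<lambda>i. B (real i / real k) \<omega>" j for \<omega>] by (simp del: of_nat_Suc)
    also have "\<dots> \<in> borel_measurable M"
      by (intro borel_measurable_add measurable_wmax borel_measurable_diff measurable_B) auto
    finally show ?thesis .
  qed
  show ?thesis unfolding grid_area_def[abs_def] by measurable
qed

lemma measurable_sup_area [measurable]: "sup_area B \<in> borel_measurable M"
  by (rule borel_measurable_LIMSEQ_metric[OF measurable_grid_area grid_area_tendsto])

lemma AE_grid_area_nonneg: "AE \<omega> in M. grid_area B k \<omega> \<ge> 0"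
proof (cases "k = 0")
  case False
  hence "AE \<omega> in M. grid_area B k \<omega> = (\<Sum>j<k. wmax (\<lambda>i. std_incr (1 / real k) i \<omega>) j) / (real k * sqrt (real k))"
    by (intro AE_grid_area) simp
  thus ?thesis by eventually_elim (auto intro!: divide_nonneg_nonneg sum_nonneg wmax_nonneg)
qed (simp add: grid_area_def)

lemma AE_sup_area_nonneg: "AE \<omega> in M. sup_area B \<omega> \<ge> 0"
proof -
  have "AE \<omega> in M. \<forall>k. grid_area B k \<omega> \<ge> 0" by (simp add: AE_all_countable AE_grid_area_nonneg)
  thus ?thesis using AE_space
    by eventually_elim (auto intro: LIMSEQ_le_const[OF grid_area_tendsto])
qed

section \<open>Laplace transforms of the area\<close>

definition area_lap :: "real \<Rightarrow> real" where
  "area_lap \<theta> = expectation (\<lambda>\<omega>. exp (- \<theta> * sup_area B \<omega>))"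

definition grid_lap :: "nat \<Rightarrow> real \<Rightarrow> real" where
  "grid_lap k \<theta> = expectation (\<lambda>\<omega>. exp (- \<theta> * grid_area B k \<omega>))"

lemma grid_lap_bounds:
  assumes "\<theta> \<ge> 0"
  shows "0 \<le> grid_lap k \<theta>" "grid_lap k \<theta> \<le> 1"
proof -
  show "0 \<le> grid_lap k \<theta>" unfolding grid_lap_def by (rule integral_nonneg_AE) simp
  have AE: "AE \<omega> in M. exp (- \<theta> * grid_area B k \<omega>) \<le> 1"
    using AE_grid_area_nonneg[of k] by eventually_elim (use assms in simp)
  have "grid_lap k \<theta> \<le> expectation (\<lambda>_. 1)"
    unfolding grid_lap_def
  proof (rule integral_mono_AE[OF _ _ AE])
    show "integrable M (\<lambda>\<omega>. exp (- \<theta> * grid_area B k \<omega>))"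
      by (rule integrable_const_bound[where B=1]) (use AE in auto)
  qed simp
  thus "grid_lap k \<theta> \<le> 1" using prob_space by simp
qed

lemma area_lap_bounds:
  assumes "\<theta> \<ge> 0"
  shows "0 \<le> area_lap \<theta>" "area_lap \<theta> \<le> 1"
proof -
  show "0 \<le> area_lap \<theta>" unfolding area_lap_def by (rule integral_nonneg_AE) simp
  have AE: "AE \<omega> in M. exp (- \<theta> * sup_area B \<omega>) \<le> 1"
    using AE_sup_area_nonneg by eventually_elim (use assms in simp)
  have "area_lap \<theta> \<le> expectation (\<lambda>_. 1)"
    unfolding area_lap_def
  proof (rule integral_mono_AE[OF _ _ AE])
    show "integrable M (\<lambda>\<omega>. exp (- \<theta> * sup_area B \<omega>))"
      by (rule integrable_const_bound[where B=1]) (use AE in auto)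
  qed simp
  thus "area_lap \<theta> \<le> 1" using prob_space by simp
qed

text \<open>The integrands are almost surely bounded by 1 and converge pointwise. The argument
  varies with the grid because a time \<open>t\<close> will be approximated by grid times.\<close>

lemma grid_lap_tendsto:
  assumes "filterlim K sequentially sequentially" "\<theta> \<longlonglongrightarrow> l" "\<And>n. \<theta> n \<ge> 0"
  shows "(\<lambda>n::nat. grid_lap (K n) (\<theta> n)) \<longlonglongrightarrow> area_lap l"
  unfolding grid_lap_def area_lap_def
proof (rule integral_dominated_convergence[where w="\<lambda>_. 1"])
  show "AE \<omega> in M. (\<lambda>n. exp (- \<theta> n * grid_area B (K n) \<omega>)) \<longlonglongrightarrow> exp (- l * sup_area B \<omega>)"
  proof (rule AE_I2)
    fix \<omega> assume \<omega>: "\<omega> \<in> space M"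
    show "(\<lambda>n. exp (- \<theta> n * grid_area B (K n) \<omega>)) \<longlonglongrightarrow> exp (- l * sup_area B \<omega>)"
      by (intro tendsto_exp tendsto_mult tendsto_minus assms
          filterlim_compose[OF grid_area_tendsto[OF \<omega>] assms(1)])
  qed
  fix n
  show "AE \<omega> in M. norm (exp (- \<theta> n * grid_area B (K n) \<omega>)) \<le> 1"
    using AE_grid_area_nonneg[of "K n"] by eventually_elim (use assms(3)[of n] in simp)
qed auto

text \<open>Brownian scaling: the walk with steps of length \<open>h\<close> is compared with the path on the grid of \<open>[0,1]\<close>
  with \<open>k\<close> steps.\<close>

lemma expectation_wweight:
  assumes h: "h > 0"
  shows "expectation (\<lambda>\<omega>. wweight m s h (\<lambda>i. incr h i \<omega>) k)
    = exp (- (real k * h * (1/2 + m * s))) * grid_lap k (m * (real k * h * sqrt (real k * h)))"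
proof (cases "k = 0")
  case True
  thus ?thesis using prob_space by (simp add: wweight_def grid_lap_def)
next
  case False
  hence k: "k > 0" by simp
  define c where "c = m * h * sqrt h"
  define T where "T r \<omega> = (\<Sum>j<k. wmax (\<lambda>i. std_incr r i \<omega>) j)" for r \<omega>
  have *: "wweight m s h (\<lambda>i. incr h i \<omega>) k = exp (- (real k * h * (1/2 + m * s))) * exp (- c * T h \<omega>)" for \<omega>
  proof -
    have "(\<lambda>i. incr h i \<omega>) = (\<lambda>i. sqrt h * std_incr h i \<omega>)" using h by (simp add: std_incr_def)
    hence "wmax (\<lambda>i. incr h i \<omega>) j = sqrt h * wmax (\<lambda>i. std_incr h i \<omega>) j" for j
      using h by (simp add: wmax_scale)
    hence "(\<Sum>j<k. s + wmax (\<lambda>i. incr h i \<omega>) j) = real k * s + sqrt h * T h \<omega>"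
      by (simp add: sum.distrib sum_distrib_left T_def)
    thus ?thesis unfolding wweight_def c_def
      by (simp add: algebra_simps flip: exp_add)
  qed
  \<comment> \<open>The step length changes from \<open>h\<close> to \<open>1 / real k\<close>,
    which leaves the law of the standardized increments unchanged.\<close>
  have "expectation (\<lambda>\<omega>. exp (- c * T h \<omega>)) = expectation (\<lambda>\<omega>. exp (- c * T (1 / real k) \<omega>))"
    unfolding T_def using h k by (intro expectation_wmax_cong) auto
  also have "\<dots> = grid_lap k (m * (real k * h * sqrt (real k * h)))"
    unfolding grid_lap_def
  proof (rule integral_cong_AE)
    show mT: "(\<lambda>\<omega>. exp (- c * T (1 / real k) \<omega>)) \<in> borel_measurable M"
    proof -
      have "std_incr (1 / real k) i \<in> borel_measurable M" if "i < k" for i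
        using indep_std_incr[of "1 / real k" k] k that unfolding indep_vars_def by auto
      hence [measurable]: "T (1 / real k) \<in> borel_measurable M" unfolding T_def[abs_def]
        by (intro borel_measurable_sum measurable_wmax) auto
      show ?thesis by measurable
    qed
    show "AE \<omega> in M. exp (- c * T (1 / real k) \<omega>) = exp (- (m * (real k * h * sqrt (real k * h))) * grid_area B k \<omega>)"
      using AE_grid_area[OF k]
    proof eventually_elim
      case (elim \<omega>)
      have "m * (real k * h * sqrt (real k * h)) * grid_area B k \<omega> = c * T (1 / real k) \<omega>"
        unfolding elim T_def[symmetric] c_def using k by (simp add: real_sqrt_mult)
      thus ?case by simp
    qed
  qed auto
  finally show ?thesis unfolding * by simp
qed

text \<open>Step size of a walk with \<open>(n+1)\<^sup>9\<close> steps, which therefore runs up to time \<open>n+1\<close>. The exponent is chosen so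
  that all errors vanish.\<close>

definition mesh :: "nat \<Rightarrow> real" where
  "mesh n = 1 / real (Suc n) ^ 8"

lemma mesh_facts: "mesh n > 0" "mesh n \<le> 1" "real (Suc n ^ 9) * mesh n = real (Suc n)"
proof -
  show "mesh n > 0" by (simp add: mesh_def)
  have "1 \<le> real (Suc n) ^ 8" by (rule one_le_power) simp
  thus "mesh n \<le> 1" by (simp add: mesh_def)
  have "real (Suc n ^ 9) = real (Suc n) * real (Suc n) ^ 8" by (simp only: of_nat_power flip: power_Suc) simp
  thus "real (Suc n ^ 9) * mesh n = real (Suc n)" by (simp add: mesh_def)
qed

lemma mesh_tendsto: "mesh \<longlonglongrightarrow> 0"
  unfolding mesh_def by real_asymp

lemma expectation_wweight_sum_tendsto:
  assumes m: "m > 0" and s: "s \<ge> 0"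
  shows "(\<lambda>n. mesh n / 2 * (\<Sum>k<Suc n ^ 9. expectation (\<lambda>\<omega>. wweight m s (mesh n) (\<lambda>i. incr (mesh n) i \<omega>) k)))
    \<longlonglongrightarrow> psi m s"
proof -
  define E where "E n = mesh n / 2 * (\<Sum>k<Suc n ^ 9. expectation (\<lambda>\<omega>. wweight m s (mesh n) (\<lambda>i. incr (mesh n) i \<omega>) k))" for n
  define C where "C = 5 * m\<^sup>2 + 5 * m"
  \<comment> \<open>With time horizon \<open>T = n + 1\<close> the error terms are of the orders
    \<open>exp (-T/2)\<close>, \<open>T * eps = 1/T\<close>,
    \<open>T * mesh / eps\<^sup>2 = 1/T^3\<close> and
    \<open>T\<^sup>2 * mesh = 1/T^6\<close>.\<close>
  define eps where "eps n = 1 / real (Suc n) ^ 2" for n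
  define R where "R n = exp (- (real (Suc n ^ 9) * mesh n / 2)) * (1 + 2 * m)
        + C * (real (Suc n ^ 9) * (eps n * mesh n + 6 * (mesh n)\<^sup>2 / (eps n)\<^sup>2) + eps n * ((1 + real (Suc n ^ 9) * mesh n) / 2))
        + real (Suc n ^ 9) * ((mesh n)\<^sup>2 * ((1 + 2 * m * (s + (1 + real (Suc n ^ 9) * mesh n) / 2)) / 8 + m / 2))" for n
  have eps: "0 < eps n" "eps n \<le> 1" for n
    using one_le_power[of "real (Suc n)" 2] by (simp_all add: eps_def)
  have bound: "norm (E n - psi m s) \<le> R n" for n
    using walk.psi_approx[OF walk_incr[OF mesh_facts(1)] _ s eps, of m n "Suc n ^ 9" n] m
    by (simp add: E_def R_def C_def abs_minus_commute del: power_Suc of_nat_power of_nat_Suc)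
  have R: "R n = exp (- (real (Suc n) / 2)) * (1 + 2 * m)
        + C * (real (Suc n) * eps n + 6 * (real (Suc n) * mesh n / (eps n)\<^sup>2) + eps n * ((1 + real (Suc n)) / 2))
        + real (Suc n) * mesh n * ((1 + 2 * m * (s + (1 + real (Suc n)) / 2)) / 8 + m / 2)" for n
  proof -
    define T where "T = real (Suc n)"
    define N where "N = real (Suc n ^ 9)"
    have T: "T = N * mesh n" using mesh_facts(3)[of n] by (simp add: T_def N_def)
    show ?thesis unfolding R_def N_def[symmetric] unfolding T_def[symmetric]
      unfolding T by (simp add: power2_eq_square algebra_simps)
  qed
  have l1: "(\<lambda>n. exp (- (real (Suc n) / 2))) \<longlonglongrightarrow> 0" by real_asymp
  have l2: "(\<lambda>n. real (Suc n) * eps n) \<longlonglongrightarrow> 0" unfolding eps_def by real_asymp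
  have l3: "(\<lambda>n. real (Suc n) * mesh n / (eps n)\<^sup>2) \<longlonglongrightarrow> 0" unfolding eps_def mesh_def by real_asymp
  have l4: "(\<lambda>n. eps n * ((1 + real (Suc n)) / 2)) \<longlonglongrightarrow> 0" unfolding eps_def by real_asymp
  have l5: "(\<lambda>n. real (Suc n) * mesh n * ((1 + 2 * m * (s + (1 + real (Suc n)) / 2)) / 8 + m / 2)) \<longlonglongrightarrow> 0"
  proof -
    have a: "(\<lambda>n. real (Suc n) * mesh n) \<longlonglongrightarrow> 0" unfolding mesh_def by real_asymp
    have b: "(\<lambda>n. real (Suc n) * mesh n * ((1 + real (Suc n)) / 2)) \<longlonglongrightarrow> 0" unfolding mesh_def by real_asymp
    have "(\<lambda>n. real (Suc n) * mesh n * ((1 + 2 * m * s) / 8 + m / 2)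
        + 2 * m / 8 * (real (Suc n) * mesh n * ((1 + real (Suc n)) / 2)))
      \<longlonglongrightarrow> 0 * ((1 + 2 * m * s) / 8 + m / 2) + 2 * m / 8 * 0"
      by (intro tendsto_intros a b)
    moreover have "real (Suc n) * mesh n * ((1 + 2 * m * s) / 8 + m / 2)
        + 2 * m / 8 * (real (Suc n) * mesh n * ((1 + real (Suc n)) / 2))
      = real (Suc n) * mesh n * ((1 + 2 * m * (s + (1 + real (Suc n)) / 2)) / 8 + m / 2)" for n
      by (simp add: algebra_simps add_divide_distrib del: of_nat_Suc)
    ultimately show ?thesis by (simp del: of_nat_Suc)
  qed
  have "R \<longlonglongrightarrow> 0 * (1 + 2 * m) + C * (0 + 6 * 0 + 0) + 0"
    unfolding R by (intro tendsto_intros l1 l2 l3 l4 l5)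
  hence "R \<longlonglongrightarrow> 0" by simp
  hence "(\<lambda>n. E n - psi m s) \<longlonglongrightarrow> 0"
    by (rule Lim_null_comparison[rotated]) (use bound in auto)
  thus ?thesis unfolding E_def by (rule LIM_zero_cancel)
qed

text \<open>By \<open>expectation_wweight\<close> the sums of
  \<open>expectation_wweight_sum_tendsto\<close> are Riemann sums of this integral; the factor 2
  undoes the \<open>1/2\<close> in front of them. The argument \<open>m * (t * sqrt t)\<close>
  reflects that the area up to time \<open>t\<close> is distributed as \<open>t * sqrt t\<close>
  times the area up to time 1.\<close>

lemma area_transform:
  assumes m: "m > 0" and s: "s \<ge> 0"
  defines "a \<equiv> 1/2 + m * s"
  shows "has_bochner_integral lborel
    (\<lambda>t. indicator {0..} t * (exp (- (t * a)) * area_lap (m * (t * sqrt t)))) (2 * psi m s)"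
proof -
  have a: "a > 0" using m s by (simp add: a_def add_pos_nonneg)
  define c where "c n k = exp (- (real k * mesh n * a)) * grid_lap k (m * (real k * mesh n * sqrt (real k * mesh n)))" for n k
  define f where "f n t = indicator {0..<real (Suc n ^ 9) * mesh n} t * c n (nat \<lfloor>t / mesh n\<rfloor>)" for n t
  define g where "g t = indicator {0..} t * (exp (- (t * a)) * area_lap (m * (t * sqrt t)))" for t :: real
  \<comment> \<open>Rounding \<open>t\<close> down to the grid loses at most
    \<open>mesh n \<le> 1\<close>, which costs the factor \<open>exp a\<close>.\<close>
  define w where "w t = exp a * (indicator {0..} t * exp (- (t * a)))" for t :: real
  have hbi: "has_bochner_integral lborel (f n) (mesh n * (\<Sum>k<Suc n ^ 9. c n k))" for n
    unfolding f_def[abs_def] by (rule has_bochner_integral_step[OF mesh_facts(1)])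
  have c01: "0 \<le> c n k" "c n k \<le> exp (- (real k * mesh n * a))" for n k
  proof -
    have "m * (real k * mesh n * sqrt (real k * mesh n)) \<ge> 0"
      using m mesh_facts(1)[of n] by (intro mult_nonneg_nonneg) auto
    from grid_lap_bounds[OF this, of k] show "0 \<le> c n k" "c n k \<le> exp (- (real k * mesh n * a))"
      unfolding c_def using mult_left_mono[of _ 1 "exp (- (real k * mesh n * a))"] by auto
  qed
  \<comment> \<open>At \<open>t = 0\<close> the grid index stays 0 instead of tending to infinity,
    so this null set is left out.\<close>
  have lim: "(\<lambda>n. f n t) \<longlonglongrightarrow> g t" if "t \<noteq> 0" for t
  proof (cases "t > 0")
    case True
    define K where "K n = nat \<lfloor>t / mesh n\<rfloor>" for n
    have K: "real (K n) \<le> t / mesh n" "t / mesh n < real (K n) + 1" for n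
      using True mesh_facts(1)[of n] by (auto simp: K_def)
    have Kh: "real (K n) * mesh n \<le> t" "t - mesh n \<le> real (K n) * mesh n" for n
      using K[of n] mesh_facts(1)[of n] by (auto simp: field_simps)
    have Kt: "(\<lambda>n. real (K n) * mesh n) \<longlonglongrightarrow> t"
    proof (rule tendsto_sandwich)
      show "(\<lambda>n. t - mesh n) \<longlonglongrightarrow> t" using tendsto_diff[OF tendsto_const mesh_tendsto, of t] by simp
    qed (use Kh in auto)
    have Ks: "filterlim K sequentially sequentially"
    proof -
      have "filterlim (\<lambda>n. t / mesh n - 1) at_top sequentially"
        unfolding mesh_def using True by real_asymp
      hence "filterlim (\<lambda>n. real (K n)) at_top sequentially"
      proof (rule filterlim_at_top_mono)
        show "\<forall>\<^sub>F n in sequentially. t / mesh n - 1 \<le> real (K n)"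
          using K(2) by (intro always_eventually allI) (simp add: algebra_simps less_imp_le)
      qed
      thus ?thesis by (simp add: filterlim_sequentially_iff_filterlim_real)
    qed
    have Th: "(\<lambda>n. m * (real (K n) * mesh n * sqrt (real (K n) * mesh n))) \<longlonglongrightarrow> m * (t * sqrt t)"
      by (intro tendsto_intros Kt)
    have "(\<lambda>n. c n (K n)) \<longlonglongrightarrow> exp (- (t * a)) * area_lap (m * (t * sqrt t))"
      unfolding c_def
    proof (intro tendsto_mult)
      show "(\<lambda>n. exp (- (real (K n) * mesh n * a))) \<longlonglongrightarrow> exp (- (t * a))"
        by (intro tendsto_intros Kt)
      show "(\<lambda>n. grid_lap (K n) (m * (real (K n) * mesh n * sqrt (real (K n) * mesh n)))) \<longlonglongrightarrow> area_lap (m * (t * sqrt t))"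
        by (rule grid_lap_tendsto[OF Ks Th]) (use m mesh_facts(1) in \<open>auto intro!: mult_nonneg_nonneg simp: less_imp_le\<close>)
    qed
    moreover have "\<forall>\<^sub>F n in sequentially. c n (K n) = f n t"
    proof -
      have "\<forall>\<^sub>F n in sequentially. t < real (Suc n)"
        using reals_Archimedean2[of t] by (metis (mono_tags, lifting) eventually_sequentiallyI less_le_trans of_nat_le_iff le_SucI)
      thus ?thesis by eventually_elim (use True mesh_facts(3) in \<open>simp add: f_def K_def\<close>)
    qed
    ultimately have "(\<lambda>n. f n t) \<longlonglongrightarrow> exp (- (t * a)) * area_lap (m * (t * sqrt t))"
      by (rule Lim_transform_eventually)
    thus ?thesis using True by (simp add: g_def)
  qed (use that in \<open>simp add: f_def g_def\<close>)
  have AElim: "AE t in lborel. (\<lambda>n. f n t) \<longlonglongrightarrow> g t"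
    using AE_lborel_singleton[of 0] by eventually_elim (rule lim)
  have fm: "f n \<in> borel_measurable lborel" for n
    using hbi[of n] by (auto intro: borel_measurable_has_bochner_integral)
  have gm: "g \<in> borel_measurable lborel"
  proof -
    define f' where "f' n t = (if t = 0 then g 0 else f n t)" for n t
    have "f' n \<in> borel_measurable lborel" for n
      unfolding f'_def[abs_def] using fm[of n] by measurable
    moreover have "(\<lambda>n. f' n t) \<longlonglongrightarrow> g t" for t
      using lim[of t] by (cases "t = 0") (auto simp: f'_def)
    ultimately show ?thesis by (rule borel_measurable_LIMSEQ_metric)
  qed
  have w: "integrable lborel w"
  proof -
    have "set_integrable lborel {0<..} (\<lambda>x. exp (-(x * a)))" by (rule integrable_I0i_exp_mscale[OF a])
    hence "integrable lborel (\<lambda>t. indicator {0<..} t * exp (- (t * a)))" by (simp add: set_integrable_def)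
    hence "integrable lborel (\<lambda>t. indicator {0..} t * exp (- (t * a)))"
    proof (rule integrable_cong_AE_imp)
      show "AE t in lborel. indicator {0<..} t * exp (- (t * a)) = indicator {0..} t * exp (- (t * a))"
        using AE_lborel_singleton[of 0] by eventually_elim (auto split: split_indicator)
    qed measurable
    thus ?thesis unfolding w_def[abs_def] by simp
  qed
  have fw: "AE t in lborel. norm (f n t) \<le> w t" for n
  proof (rule AE_I2)
    fix t :: real
    show "norm (f n t) \<le> w t"
    proof (cases "t \<ge> 0")
      case True
      define k where "k = nat \<lfloor>t / mesh n\<rfloor>"
      have "t / mesh n < real k + 1" using True mesh_facts(1)[of n] by (auto simp: k_def)
      hence "t - mesh n \<le> real k * mesh n" using mesh_facts(1)[of n] by (auto simp: field_simps)
      hence "t - 1 \<le> real k * mesh n" using mesh_facts(2)[of n] by linarith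
      hence "(t - 1) * a \<le> real k * mesh n * a" using a by (intro mult_right_mono) auto
      hence "exp (- (real k * mesh n * a)) \<le> exp a * exp (- (t * a))"
        by (simp add: algebra_simps flip: exp_add)
      hence "\<bar>c n k\<bar> \<le> exp a * exp (- (t * a))" using c01[of n k] by linarith
      moreover have "\<bar>f n t\<bar> \<le> \<bar>c n k\<bar>" by (simp add: f_def k_def split: split_indicator)
      ultimately show ?thesis using True by (simp add: w_def)
    qed (simp add: f_def w_def)
  qed
  have "integrable lborel g" by (rule integrable_dominated_convergence[OF gm fm w AElim fw])
  moreover have "(\<integral>t. g t \<partial>lborel) = 2 * psi m s"
  proof (rule LIMSEQ_unique)
    show "(\<lambda>n. \<integral>t. f n t \<partial>lborel) \<longlonglongrightarrow> (\<integral>t. g t \<partial>lborel)"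
      by (rule integral_dominated_convergence[OF gm fm w AElim fw])
    have "c n k = expectation (\<lambda>\<omega>. wweight m s (mesh n) (\<lambda>i. incr (mesh n) i \<omega>) k)" for n k
      by (simp only: expectation_wweight[OF mesh_facts(1)] c_def a_def)
    hence "(\<integral>t. f n t \<partial>lborel) = 2 * (mesh n / 2 * (\<Sum>k<Suc n ^ 9. expectation (\<lambda>\<omega>. wweight m s (mesh n) (\<lambda>i. incr (mesh n) i \<omega>) k)))" for n
      using has_bochner_integral_integral_eq[OF hbi[of n]] by simp
    thus "(\<lambda>n. \<integral>t. f n t \<partial>lborel) \<longlonglongrightarrow> 2 * psi m s"
      using tendsto_mult[OF tendsto_const expectation_wweight_sum_tendsto[OF m s], of 2] by simp
  qed
  ultimately show ?thesis unfolding g_def by (simp add: has_bochner_integral_iff)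
qed

end

section \<open>Gamma distributions and Laplace transforms\<close>

definition gam_dens :: "real \<Rightarrow> real \<Rightarrow> real" where
  "gam_dens a t = indicator {0..} t * t powr (a - 1) * exp (- t) / Gamma a"

definition gam :: "real \<Rightarrow> real measure" where
  "gam a = density lborel (\<lambda>t. ennreal (gam_dens a t))"

lemma measurable_gam_dens [measurable]: "gam_dens a \<in> borel_measurable borel"
  unfolding gam_dens_def[abs_def] by measurable

lemma sets_gam [simp, measurable_cong]: "sets (gam a) = sets borel"
  by (simp add: gam_def)

lemma space_gam [simp]: "space (gam a) = UNIV"
  by (simp add: gam_def)

lemma gam_dens_nonneg: "a > 0 \<Longrightarrow> gam_dens a t \<ge> 0"
  using Gamma_real_pos[of a] by (simp add: gam_dens_def)

lemma nn_integral_gam_dens: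
  assumes a: "a > 0"
  shows "(\<integral>\<^sup>+t. ennreal (gam_dens a t) \<partial>lborel) = 1"
proof -
  have G: "Gamma a > 0" using a by (rule Gamma_real_pos)
  have "(\<integral>\<^sup>+t. ennreal (gam_dens a t) \<partial>lborel)
      = (\<integral>\<^sup>+t. ennreal (1 / Gamma a) * ennreal (indicator {0..} t * t powr (a - 1) / exp t) \<partial>lborel)"
    using G by (intro nn_integral_cong, subst ennreal_mult'[symmetric]) (auto simp: gam_dens_def exp_minus field_simps)
  also have "\<dots> = ennreal (1 / Gamma a) * ennreal (Gamma a)"
    by (subst nn_integral_cmult) (auto simp: Gamma_conv_nn_integral_real[OF a])
  also have "\<dots> = 1" using G by (simp flip: ennreal_mult')
  finally show ?thesis .
qed

lemma prob_space_gam: "a > 0 \<Longrightarrow> prob_space (gam a)"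
  by (rule prob_spaceI) (simp add: gam_def emeasure_density nn_integral_gam_dens)

lemma AE_gam_nonneg: "AE t in gam a. 0 \<le> t"
  unfolding gam_def by (subst AE_density) (auto simp: gam_dens_def split: split_indicator_asm)

lemma nn_integral_gam:
  assumes "a > 0" and [measurable]: "f \<in> borel_measurable borel"
  shows "(\<integral>\<^sup>+t. ennreal (f t) \<partial>gam a) = (\<integral>\<^sup>+t. ennreal (gam_dens a t * f t) \<partial>lborel)"
  unfolding gam_def using assms
  by (subst nn_integral_density) (auto simp: ennreal_mult' gam_dens_nonneg)

text \<open>Multiplying the density by \<open>t powr s\<close> only shifts its parameter from
  \<open>a\<close> to \<open>a + s\<close>, up to the normalising constants.\<close>

lemma nn_integral_gam_powr:
  assumes a: "a > 0" and s: "a + s > 0"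
  shows "(\<integral>\<^sup>+t. ennreal (t powr s) \<partial>gam a) = ennreal (Gamma (a + s) / Gamma a)"
proof -
  have G: "Gamma a > 0" "Gamma (a + s) > 0" using a s by (auto intro: Gamma_real_pos)
  have *: "gam_dens a t * t powr s = Gamma (a + s) / Gamma a * gam_dens (a + s) t" for t
  proof (cases "t > 0")
    case True
    have "a + s - 1 = (a - 1) + s" by simp
    hence "t powr (a + s - 1) = t powr (a - 1) * t powr s" by (simp only: powr_add)
    thus ?thesis using G by (simp add: gam_dens_def)
  qed (auto simp: gam_dens_def split: split_indicator)
  have "(\<integral>\<^sup>+t. ennreal (t powr s) \<partial>gam a) = (\<integral>\<^sup>+t. ennreal (Gamma (a + s) / Gamma a) * ennreal (gam_dens (a + s) t) \<partial>lborel)"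
    using G by (subst nn_integral_gam[OF a], simp, unfold *)
      (auto intro!: nn_integral_cong ennreal_mult' simp del: times_divide_eq_left)
  also have "\<dots> = ennreal (Gamma (a + s) / Gamma a)"
    by (subst nn_integral_cmult) (auto simp: nn_integral_gam_dens[OF s])
  finally show ?thesis .
qed

text \<open>Otherwise \<open>Gamma\<close> would be bounded near 0.\<close>

lemma nn_integral_gam_inverse: "(\<integral>\<^sup>+t. ennreal (t powr (-1)) \<partial>gam 1) = \<infinity>"
proof (rule ccontr)
  assume "(\<integral>\<^sup>+t. ennreal (t powr (-1)) \<partial>gam 1) \<noteq> \<infinity>"
  then obtain J where J: "(\<integral>\<^sup>+t. ennreal (t powr (-1)) \<partial>gam 1) = ennreal J" "J \<ge> 0"
    by (cases "(\<integral>\<^sup>+t. ennreal (t powr (-1)) \<partial>gam 1)") auto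
  interpret prob_space "gam 1" by (rule prob_space_gam) simp
  have bound: "Gamma c \<le> J + 1" if c: "0 < c" "c < 1" for c :: real
  proof -
    have "ennreal (Gamma c) = (\<integral>\<^sup>+t. ennreal (t powr (c - 1)) \<partial>gam 1)"
      using nn_integral_gam_powr[of 1 "c - 1"] c by simp
    also have "\<dots> \<le> (\<integral>\<^sup>+t. ennreal (t powr (-1)) + 1 \<partial>gam 1)"
    proof (rule nn_integral_mono_AE, use AE_gam_nonneg[of 1] in eventually_elim)
      case (elim t)
      consider "t = 0" | "0 < t" "t \<le> 1" | "t > 1" using elim by linarith
      thus "ennreal (t powr (c - 1)) \<le> ennreal (t powr (-1)) + 1"
      proof cases
        case 2
        have "t powr (c - 1) \<le> t powr (-1)" using 2 c by (intro powr_mono') auto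
        hence "ennreal (t powr (c - 1)) \<le> ennreal (t powr (-1))" by (rule ennreal_leI)
        also have "\<dots> \<le> ennreal (t powr (-1)) + 1" by simp
        finally show ?thesis .
      next
        case 3
        have "t powr (c - 1) \<le> 1" using 3 c by (intro powr_neg_le_1) auto
        hence "ennreal (t powr (c - 1)) \<le> 1" by simp
        also have "\<dots> \<le> ennreal (t powr (-1)) + 1" by simp
        finally show ?thesis .
      qed auto
    qed
    also have "\<dots> = (\<integral>\<^sup>+t. ennreal (t powr (-1)) \<partial>gam 1) + (\<integral>\<^sup>+t. 1 \<partial>gam 1)"
      by (rule nn_integral_add) auto
    also have "\<dots> = ennreal J + 1"
      unfolding J(1) using emeasure_space_1 by simp
    also have "\<dots> = ennreal (J + 1)" using J(2) by (simp add: ennreal_plus)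
    finally show ?thesis using J(2) by (subst (asm) ennreal_le_iff) auto
  qed
  have "isCont Gamma (1::real)" 
    by (rule DERIV_isCont, rule has_field_derivative_Gamma) auto
  hence "((\<lambda>n. Gamma (1 + 1 / real (Suc n))) \<longlonglongrightarrow> Gamma 1)"
    by (rule isCont_tendsto_compose) real_asymp
  hence "(\<lambda>n. inverse (Gamma (1 + 1 / real (Suc n)))) \<longlonglongrightarrow> inverse (Gamma 1)"
    by (rule tendsto_inverse) simp
  hence l: "(\<lambda>n. (J + 1) * (1 / real (Suc n)) * inverse (Gamma (1 + 1 / real (Suc n)))) \<longlonglongrightarrow> (J + 1) * 0 * inverse (Gamma 1)"
    by (intro tendsto_mult tendsto_const) real_asymp
  \<comment> \<open>\<open>Gamma (1 + c) = c * Gamma c\<close> stays below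
    \<open>c * (J + 1)\<close>, which tends to 0 with \<open>c\<close>, although
    \<open>Gamma (1 + c)\<close> tends to 1. The condition \<open>n > 0\<close> ensures
    \<open>c < 1\<close>.\<close>
  have "1 \<le> (J + 1) * (1 / real (Suc n)) * inverse (Gamma (1 + 1 / real (Suc n)))" if "n > 0" for n
  proof -
    define c where "c = 1 / real (Suc n)"
    have c: "0 < c" "c < 1" using that by (auto simp: c_def)
    have "Gamma (c + 1) = c * Gamma c" using c by (intro Gamma_plus1) (auto elim!: nonpos_Ints_cases)
    hence "Gamma (1 + c) \<le> c * (J + 1)" using bound[OF c] c by (simp add: add.commute)
    moreover have "Gamma (1 + c) > 0" using c by (intro Gamma_real_pos) auto
    ultimately show ?thesis unfolding c_def[symmetric] by (simp add: field_simps)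
  qed
  hence "1 \<le> (J + 1) * 0 * inverse (Gamma (1::real))"
    by (intro LIMSEQ_le_const[OF l]) (auto intro!: exI[of _ 1])
  thus False by simp
qed

text \<open>Rescaling the argument by \<open>1 + \<theta>\<close> turns the density into the
  exponentially tilted one, up to a power of \<open>1 + \<theta>\<close>; comparing total masses
  gives the value.\<close>

lemma gam_laplace:
  assumes a: "a > 0" and \<theta>: "\<theta> \<ge> 0"
  shows "(\<integral>t. exp (- \<theta> * t) \<partial>gam a) = (1 + \<theta>) powr (- a)"
proof -
  define c where "c = 1 + \<theta>"
  have c: "c > 0" using \<theta> by (simp add: c_def)
  have meas: "(\<lambda>t. exp (- \<theta> * t)) \<in> borel_measurable borel" by measurable
  define J where "J = (\<integral>\<^sup>+t. ennreal (exp (- \<theta> * t)) \<partial>gam a)"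
  have d: "gam_dens a (0 + c * t) = c powr (a - 1) * (gam_dens a t * exp (- \<theta> * t))" for t
  proof (cases "t \<ge> 0")
    case True
    have "exp (- (c * t)) = exp (- t) * exp (- \<theta> * t)" by (simp add: c_def algebra_simps flip: exp_add)
    thus ?thesis using True c by (simp add: gam_dens_def powr_mult)
  next
    case False
    hence "c * t < 0" using c by (simp add: mult_pos_neg)
    thus ?thesis using False by (simp add: gam_dens_def)
  qed
  have "1 = ennreal c * (\<integral>\<^sup>+t. ennreal (gam_dens a (0 + c * t)) \<partial>lborel)"
    using nn_integral_real_affine[of "\<lambda>t. ennreal (gam_dens a t)" c 0] nn_integral_gam_dens[OF a] c by simp
  also have "(\<integral>\<^sup>+t. ennreal (gam_dens a (0 + c * t)) \<partial>lborel) = ennreal (c powr (a - 1)) * J"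
    unfolding d J_def nn_integral_gam[OF a meas]
    by (subst nn_integral_cmult[symmetric]) (auto simp: ennreal_mult')
  also have "ennreal c * (ennreal (c powr (a - 1)) * J) = ennreal (c powr a) * J"
    using c by (simp add: mult.assoc[symmetric] flip: ennreal_mult') (simp add: powr_mult_base)
  finally have "1 = ennreal (c powr a) * J" .
  hence "ennreal (c powr (- a)) * 1 = (ennreal (c powr (- a)) * ennreal (c powr a)) * J"
    by (simp add: mult.assoc)
  hence "J = ennreal (c powr (- a))" using c by (simp flip: ennreal_mult' powr_add)
  thus ?thesis unfolding J_def c_def
    by (subst integral_eq_nn_integral) auto
qed

lemma exp_measure_eq_gam: "exp_measure = gam 1"
  unfolding gam_def
proof (rule density_cong)
  \<comment> \<open>The densities differ at 0, where \<open>0 powr 0\<close> is 0.\<close>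
  show "AE t in lborel. ennreal (exponential_density 1 t) = ennreal (gam_dens 1 t)"
    using AE_lborel_singleton[of 0]
    by eventually_elim (auto simp: exponential_density_def gam_dens_def split: split_indicator)
qed auto

lemma gam_complex_moment:
  assumes a: "a > 0" and s: "Re s > - a"
  shows "(\<integral>t. complex_of_real t powr s \<partial>gam a) = Gamma (of_real a + s) / Gamma (of_real a)"
proof -
  define z where "z = of_real a + s"
  have z: "Re z > 0" using s by (simp add: z_def)
  define f where "f t = complex_of_real t powr (z - 1) / of_real (exp t)" for t
  have [measurable]: "f \<in> borel_measurable borel" unfolding f_def[abs_def] by measurable
  have "set_integrable lebesgue {0<..} f"
    unfolding f_def[abs_def] by (rule absolutely_integrable_Gamma_integral'[OF z])
  hence si: "set_integrable lborel {0<..} f"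
    unfolding set_integrable_def by (subst (asm) integrable_completion) auto
  have "(LINT t:{0<..}|lborel. f t) = integral {0<..} f" by (rule set_borel_integral_eq_integral(2)[OF si])
  also have "\<dots> = Gamma z" using Gamma_integral_complex'[OF z] by (simp add: f_def[abs_def] integral_unique)
  finally have I: "(\<integral>t. indicator {0<..} t *\<^sub>R f t \<partial>lborel) = Gamma z" by (simp add: set_lebesgue_integral_def)
  have *: "gam_dens a t *\<^sub>R (complex_of_real t powr s) = (1 / of_real (Gamma a)) * (indicator {0<..} t *\<^sub>R f t)" for t
  proof (cases "t > 0")
    case True
    have "complex_of_real (t powr (a - 1)) * of_real t powr s = of_real t powr (z - 1)"
    proof -
      have "complex_of_real (t powr (a - 1)) = of_real t powr of_real (a - 1)"
        using True powr_of_real[of t "a - 1"] by simp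
      moreover have "z - 1 = of_real (a - 1) + s" by (simp add: z_def)
      ultimately show ?thesis by (simp only: powr_add)
    qed
    thus ?thesis using True
      by (simp add: gam_dens_def f_def scaleR_conv_of_real exp_minus field_simps)
  qed (auto simp: gam_dens_def split: split_indicator)
  have "(\<integral>t. complex_of_real t powr s \<partial>gam a) = (\<integral>t. gam_dens a t *\<^sub>R (complex_of_real t powr s) \<partial>lborel)"
    unfolding gam_def by (rule integral_density) (auto simp: gam_dens_nonneg[OF a])
  also have "\<dots> = (1 / of_real (Gamma a)) * Gamma z"
    unfolding * by (simp only: integral_mult_right_zero I)
  finally show ?thesis by (simp add: z_def Gamma_complex_of_real)
qed

text \<open>The transforms at integers are the moments of the bounded variable \<open>exp (-X)\<close>, hence determine its law.\<close>

lemma distr_eq_if_laplace_eq: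
  fixes X1 :: "'a \<Rightarrow> real" and X2 :: "'b \<Rightarrow> real"
  assumes p: "prob_space M1" "prob_space M2"
    and m[measurable]: "X1 \<in> borel_measurable M1" "X2 \<in> borel_measurable M2"
    and nonneg: "AE x in M1. X1 x \<ge> 0" "AE x in M2. X2 x \<ge> 0"
    and lap: "\<And>n. n > 0 \<Longrightarrow> (\<integral>x. exp (- real n * X1 x) \<partial>M1) = (\<integral>x. exp (- real n * X2 x) \<partial>M2)"
  shows "distr M1 borel X1 = distr M2 borel X2"
proof -
  \<comment> \<open>Taylor expansion of the characteristic function of \<open>exp (- X)\<close>.
    This variable is almost surely at most 1, so the remainder is bounded independently of the law
    and vanishes as \<open>n\<close> grows.\<close>
  have approx: "cmod (char (distr M borel (\<lambda>x. exp (- X x))) t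
      - (\<Sum>k\<le>n. ((\<i> * t)^k / fact k) * (\<integral>x. exp (- real k * X x) \<partial>M))) \<le> 2 * (inverse (fact n) * \<bar>t\<bar>^n)"
    if "prob_space M" and [measurable]: "X \<in> borel_measurable M" and nn: "AE x in M. X x \<ge> 0"
    for M :: "'c measure" and X t n
  proof -
    interpret prob_space M by fact
    have b: "AE x in M. norm (exp (- X x) ^ k) \<le> 1" for k
      using nn by eventually_elim (simp add: power_le_one)
    have i: "integrable M (\<lambda>x. exp (- X x) ^ k)" for k
      by (rule integrable_const_bound[OF b]) measurable
    have e: "exp (- X x) ^ k = exp (- real k * X x)" for x k by (simp flip: exp_of_nat_mult)
    have "cmod (char (distr M borel (\<lambda>x. exp (- X x))) t
        - (\<Sum>k\<le>n. ((\<i> * t)^k / fact k) * (\<integral>x. exp (- X x) ^ k \<partial>M)))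
        \<le> (2 * \<bar>t\<bar>^n / fact n) * (\<integral>x. \<bar>exp (- X x)\<bar> ^ n \<partial>M)"
      by (rule char_approx1'[OF i _ refl]) measurable
    also have "(\<integral>x. \<bar>exp (- X x)\<bar> ^ n \<partial>M) \<le> (\<integral>x. 1 \<partial>M)"
      by (rule integral_mono_AE) (use i b in auto)
    hence "(2 * \<bar>t\<bar>^n / fact n) * (\<integral>x. \<bar>exp (- X x)\<bar> ^ n \<partial>M) \<le> (2 * \<bar>t\<bar>^n / fact n) * 1"
      using prob_space by (intro mult_left_mono) auto
    finally show ?thesis unfolding e by (simp add: field_simps)
  qed
  have "(\<integral>x. exp (- real k * X1 x) \<partial>M1) = (\<integral>x. exp (- real k * X2 x) \<partial>M2)" for k
    using lap[of k] prob_space.prob_space[OF p(1)] prob_space.prob_space[OF p(2)] by (cases "k = 0") auto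
  note lap' = this
  have "char (distr M1 borel (\<lambda>x. exp (- X1 x))) t = char (distr M2 borel (\<lambda>x. exp (- X2 x))) t" for t
  proof -
    let ?D = "char (distr M1 borel (\<lambda>x. exp (- X1 x))) t - char (distr M2 borel (\<lambda>x. exp (- X2 x))) t"
    let ?T = "\<lambda>n. \<Sum>k\<le>n. ((\<i> * t)^k / fact k) * (\<integral>x. exp (- real k * X2 x) \<partial>M2)"
    let ?e = "\<lambda>n. 2 * (inverse (fact n) * \<bar>t\<bar>^n)"
    have D: "norm ?D \<le> 4 * (inverse (fact n) * \<bar>t\<bar>^n)" for n
      using approx[OF p(1) m(1) nonneg(1), of t n] approx[OF p(2) m(2) nonneg(2), of t n]
      unfolding lap'
    proof -
      assume "cmod (char (distr M1 borel (\<lambda>x. exp (- X1 x))) t - ?T n) \<le> ?e n"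
        and "cmod (char (distr M2 borel (\<lambda>x. exp (- X2 x))) t - ?T n) \<le> ?e n"
      thus ?thesis
        using norm_triangle_ineq4[of "char (distr M1 borel (\<lambda>x. exp (- X1 x))) t - ?T n"
          "char (distr M2 borel (\<lambda>x. exp (- X2 x))) t - ?T n"] by simp
    qed
    have L: "(\<lambda>n. 4 * (inverse (fact n) * \<bar>t\<bar>^n)) \<longlonglongrightarrow> 4 * 0"
      by (intro tendsto_mult tendsto_const summable_LIMSEQ_zero summable_exp)
    have "norm ?D \<le> 4 * 0" by (rule LIMSEQ_le_const[OF L]) (use D in blast)
    thus ?thesis by simp
  qed
  hence "distr M1 borel (\<lambda>x. exp (- X1 x)) = distr M2 borel (\<lambda>x. exp (- X2 x))"
    using p by (intro Levy_uniqueness prob_space.real_distribution_distr) auto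
  hence "distr (distr M1 borel (\<lambda>x. exp (- X1 x))) borel (\<lambda>z. - ln z)
       = distr (distr M2 borel (\<lambda>x. exp (- X2 x))) borel (\<lambda>z. - ln z)" by simp
  thus ?thesis by (simp add: distr_distr comp_def)
qed

section \<open>Moments of the area\<close>

context standard_brownian_motion
begin

lemma measurable_area_lap [measurable]: "area_lap \<in> borel_measurable borel"
  unfolding area_lap_def[abs_def] by (rule borel_measurable_lebesgue_integral) measurable

text \<open>The derivative of \<open>area_transform\<close> at \<open>s = 0\<close>. The identity at \<open>s = 0\<close> itself would lead to a Gamma
  variable with parameter \<open>2/3\<close> and reach only \<open>Re s > -2/3\<close>.\<close>

lemma area_transform_deriv:
  assumes m: "m > 0"
  shows "(\<integral>t. indicator {0..} t * (t * exp (- (t * (1/2))) * area_lap (m * (t * sqrt t))) \<partial>lborel)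
    = 4 * (\<integral>v. (1 + 3 * m * v) powr (-5/3) \<partial>exp_measure)"
proof -
  define J where "J = (\<integral>v. (1 + 3 * m * v) powr (-5/3) \<partial>exp_measure)"
  define L where "L t = area_lap (m * (t * sqrt t))" for t
  define d where "d n = 1 / real (Suc n)" for n
  \<comment> \<open>The negated difference quotient of the integrand of
    \<open>area_transform\<close> between \<open>s = 0\<close> and \<open>s = d n\<close>.\<close>
  define F where "F n t = (1 / d n) * (indicator {0..} t * (exp (- (t * (1/2 + m * 0))) * L t)
      - indicator {0..} t * (exp (- (t * (1/2 + m * d n))) * L t))" for n t
  define g where "g t = m * (indicator {0..} t * (t * exp (- (t * (1/2))) * L t))" for t :: real
  \<comment> \<open>Dominates the quotients because \<open>1 - exp (-x) \<le> x\<close>. It is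
    integrable, being \<open>2 * m\<close> times \<open>gam_dens 2\<close> at
    \<open>t / 2\<close>.\<close>
  define w where "w t = m * (indicator {0..} t * (t * exp (- (t * (1/2)))))" for t :: real
  have d: "d n > 0" for n by (simp add: d_def)
  have L: "0 \<le> L t" "L t \<le> 1" if "t \<ge> 0" for t
    using area_lap_bounds[of "m * (t * sqrt t)"] m that by (auto simp: L_def)
  have [measurable]: "L \<in> borel_measurable borel" unfolding L_def[abs_def] by measurable
  have hbi: "has_bochner_integral lborel (F n) ((1 / d n) * (2 * psi m 0 - 2 * psi m (d n)))" for n
    unfolding F_def[abs_def] L_def using d[of n]
    by (intro has_bochner_integral_mult_right has_bochner_integral_diff area_transform m) auto
  have F: "F n t = indicator {0..} t * (exp (- (t * (1/2))) * L t * ((1 - exp (- (m * t * d n))) / d n))" for n t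
  proof -
    have "exp (- (t * (1/2 + m * d n))) = exp (- (t * (1/2))) * exp (- (m * t * d n))"
      by (simp add: algebra_simps flip: exp_add)
    thus ?thesis by (simp add: F_def algebra_simps diff_divide_distrib)
  qed
  have lim: "(\<lambda>n. F n t) \<longlonglongrightarrow> g t" for t
  proof -
    have "(\<lambda>n. (1 - exp (- (m * t * d n))) / d n) \<longlonglongrightarrow> m * t"
      unfolding d_def by real_asymp
    hence "(\<lambda>n. F n t) \<longlonglongrightarrow> indicator {0..} t * (exp (- (t * (1/2))) * L t * (m * t))"
      unfolding F by (intro tendsto_mult tendsto_const)
    thus ?thesis by (simp add: g_def mult_ac)
  qed
  have w: "integrable lborel w"
  proof -
    have "integrable lborel (gam_dens 2)"
      by (rule integrableI_nn_integral_finite[where x=1]) (auto simp: gam_dens_nonneg nn_integral_gam_dens)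
    hence "integrable lborel (\<lambda>t. gam_dens 2 (0 + (1/2) * t))"
      by (subst lborel_integrable_real_affine_iff) auto
    hence "integrable lborel (\<lambda>t. (2 * m) * gam_dens 2 (0 + (1/2) * t))" by simp
    also have "(\<lambda>t. (2 * m) * gam_dens 2 (0 + (1/2) * t)) = w"
      by (auto simp: fun_eq_iff gam_dens_def w_def Gamma_numeral split: split_indicator)
    finally show ?thesis .
  qed
  have Fw: "AE t in lborel. norm (F n t) \<le> w t" for n
  proof (rule AE_I2)
    fix t :: real
    show "norm (F n t) \<le> w t"
    proof (cases "t \<ge> 0")
      case True
      have "1 - exp (- (m * t * d n)) \<le> m * t * d n" using exp_ge_add_one_self[of "- (m * t * d n)"] by simp
      hence 1: "(1 - exp (- (m * t * d n))) / d n \<le> m * t" using d[of n] by (simp add: field_simps)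
      have 2: "(1 - exp (- (m * t * d n))) / d n \<ge> 0" using True m d[of n] by simp
      have "exp (- (t * (1/2))) * L t * ((1 - exp (- (m * t * d n))) / d n) \<le> exp (- (t * (1/2))) * 1 * (m * t)"
        using L[OF True] 1 2 by (intro mult_mono) auto
      moreover have "F n t = exp (- (t * (1/2))) * L t * ((1 - exp (- (m * t * d n))) / d n)"
        unfolding F using True by simp
      moreover have "0 \<le> exp (- (t * (1/2))) * L t * ((1 - exp (- (m * t * d n))) / d n)"
        by (intro mult_nonneg_nonneg L True 2) auto
      moreover have "w t = exp (- (t * (1/2))) * 1 * (m * t)" using True by (simp add: w_def)
      ultimately show ?thesis by (simp only: real_norm_def abs_of_nonneg)
    qed (simp add: F w_def)
  qed
  have Fm: "F n \<in> borel_measurable lborel" for n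
    using hbi[of n] by (auto intro: borel_measurable_has_bochner_integral)
  have gm: "g \<in> borel_measurable lborel" unfolding g_def[abs_def] by measurable
  have l1: "(\<lambda>n. \<integral>t. F n t \<partial>lborel) \<longlonglongrightarrow> (\<integral>t. g t \<partial>lborel)"
    by (rule integral_dominated_convergence[OF gm Fm w _ Fw]) (use lim in auto)
  have k0: "kap m 0 = 1" by (simp add: kap_def)
  have c0: "chi m 0 = - 2 * m * J" by (simp add: chi_def J_def k0)
  \<comment> \<open>The second evaluation of the limit, through \<open>psi\<close>: it is
    \<open>-2\<close> times the derivative \<open>kap m 0 * chi m 0\<close> of \<open>psi m\<close>
    at 0.\<close>
  have l2: "(\<lambda>n. \<integral>t. F n t \<partial>lborel) \<longlonglongrightarrow> 4 * m * J"
  proof -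
    have b: "norm ((\<integral>t. F n t \<partial>lborel) - 4 * m * J) \<le> 10 * m\<^sup>2 * d n" for n
    proof -
      have "(\<integral>t. F n t \<partial>lborel) - 4 * m * J = (- 2 / d n) * (psi m (0 + d n) - psi m 0 - d n * kap m 0 * chi m 0)"
        unfolding has_bochner_integral_integral_eq[OF hbi[of n]] c0 k0 using d[of n] by (simp add: field_simps)
      also have "norm \<dots> = (2 / d n) * \<bar>psi m (0 + d n) - psi m 0 - d n * kap m 0 * chi m 0\<bar>"
        unfolding real_norm_def abs_mult using d[of n] by simp
      also have "\<dots> \<le> (2 / d n) * (5 * m\<^sup>2 * (d n)\<^sup>2)"
        using d[of n] m by (intro mult_left_mono psi_taylor) auto
      also have "\<dots> = 10 * m\<^sup>2 * d n" using d[of n] by (simp add: power2_eq_square)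
      finally show ?thesis .
    qed
    have "(\<lambda>n. 10 * m\<^sup>2 * d n) \<longlonglongrightarrow> 0" unfolding d_def by real_asymp
    with always_eventually[OF allI[OF b]] have "(\<lambda>n. (\<integral>t. F n t \<partial>lborel) - 4 * m * J) \<longlonglongrightarrow> 0"
      by (rule Lim_null_comparison)
    thus ?thesis by (rule LIM_zero_cancel)
  qed
  have "m * (\<integral>t. indicator {0..} t * (t * exp (- (t * (1/2))) * L t) \<partial>lborel) = (\<integral>t. g t \<partial>lborel)"
    unfolding g_def by simp
  also have "\<dots> = m * (4 * J)" using LIMSEQ_unique[OF l1 l2] by simp
  finally show ?thesis using m by (simp add: L_def J_def)
qed

text \<open>If \<open>u\<close> has law \<open>gam 2\<close>, then \<open>2 * u\<close> has the
  density \<open>t/4 exp (-t/2)\<close> of the random time \<open>T\<close>.\<close>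

definition randomized_area :: "real \<times> 'a \<Rightarrow> real" where
  "randomized_area = (\<lambda>(u, \<omega>). (2 * u) powr (3/2) * sup_area B \<omega>)"

definition gamma_product :: "real \<times> real \<Rightarrow> real" where
  "gamma_product = (\<lambda>(v, g). 3 * (v * g))"

abbreviation area_space :: "(real \<times> 'a) measure" where
  "area_space \<equiv> gam 2 \<Otimes>\<^sub>M M"

abbreviation gamma_space :: "(real \<times> real) measure" where
  "gamma_space \<equiv> gam 1 \<Otimes>\<^sub>M gam (5/3)"

lemma measurable_randomized_area [measurable]: "randomized_area \<in> borel_measurable area_space"
  unfolding randomized_area_def by measurable

lemma measurable_gamma_product [measurable]: "gamma_product \<in> borel_measurable gamma_space"
  unfolding gamma_product_def by measurable

lemma pair_prob_space_area: "pair_prob_space (gam 2) M"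
  unfolding pair_prob_space_def pair_sigma_finite_def
  using prob_space_gam[of 2] prob_space_axioms by (simp add: prob_space_imp_sigma_finite)

lemma pair_prob_space_gamma: "pair_prob_space (gam 1) (gam (5/3))"
  unfolding pair_prob_space_def pair_sigma_finite_def
  using prob_space_gam[of 1] prob_space_gam[of "5/3"] by (simp add: prob_space_imp_sigma_finite)

lemma AE_area_space: "AE x in area_space. 0 \<le> fst x \<and> 0 \<le> sup_area B (snd x)"
proof -
  interpret pair_prob_space "gam 2" M by (rule pair_prob_space_area)
  show ?thesis
  proof (rule AE_pair_measure)
    show "{x \<in> space area_space. 0 \<le> fst x \<and> 0 \<le> sup_area B (snd x)} \<in> sets area_space" by measurable
    show "AE u in gam 2. AE \<omega> in M. 0 \<le> fst (u, \<omega>) \<and> 0 \<le> sup_area B (snd (u, \<omega>))"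
      using AE_gam_nonneg AE_sup_area_nonneg by (auto elim!: eventually_mono)
  qed
qed

lemma AE_gamma_space: "AE x in gamma_space. 0 \<le> fst x \<and> 0 \<le> snd x"
proof -
  interpret pair_prob_space "gam 1" "gam (5/3)" by (rule pair_prob_space_gamma)
  show ?thesis
  proof (rule AE_pair_measure)
    show "{x \<in> space gamma_space. 0 \<le> fst x \<and> 0 \<le> snd x} \<in> sets gamma_space" by measurable
    show "AE v in gam 1. AE g in gam (5/3). 0 \<le> fst (v, g) \<and> 0 \<le> snd (v, g)"
      using AE_gam_nonneg AE_gam_nonneg[of "5/3"] by (auto elim!: eventually_mono)
  qed
qed

text \<open>Integrating out the path first leaves \<open>area_lap\<close> at
  \<open>m * (2 * u) powr (3/2)\<close>, and \<open>t = 2 * u\<close> leads to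
  \<open>area_transform_deriv\<close>. One half from the density and one half from the substitution
  cancel the factor 4 there.\<close>

lemma laplace_randomized_area:
  assumes m: "m > 0"
  shows "(\<integral>x. exp (- m * randomized_area x) \<partial>area_space) = (\<integral>v. (1 + 3 * m * v) powr (-5/3) \<partial>exp_measure)"
proof -
  interpret P: pair_prob_space "gam 2" M by (rule pair_prob_space_area)
  define L where "L u = area_lap (m * (2 * u) powr (3/2))" for u
  have [measurable]: "L \<in> borel_measurable borel" unfolding L_def[abs_def] by measurable
  have i: "integrable area_space (\<lambda>x. exp (- m * randomized_area x))"
  proof (rule P.integrable_const_bound[where B=1])
    show "AE x in area_space. norm (exp (- m * randomized_area x)) \<le> 1"
      using AE_area_space
      by eventually_elim (use m in \<open>auto simp: randomized_area_def case_prod_unfold\<close>)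
  qed measurable
  have "(\<integral>x. exp (- m * randomized_area x) \<partial>area_space) = (\<integral>u. (\<integral>\<omega>. exp (- m * randomized_area (u, \<omega>)) \<partial>M) \<partial>gam 2)"
    by (rule P.integral_fst'[OF i, symmetric])
  also have "\<dots> = (\<integral>u. L u \<partial>gam 2)"
    by (simp add: randomized_area_def L_def area_lap_def mult.assoc)
  also have "\<dots> = (\<integral>u. gam_dens 2 u * L u \<partial>lborel)"
    unfolding gam_def by (subst integral_density) (auto simp: gam_dens_nonneg)
  also have "\<dots> = (1/4) * (2 * (\<integral>u. indicator {0..} (0 + 2 * u) * ((0 + 2 * u) * exp (- ((0 + 2 * u) * (1/2))) * area_lap (m * ((0 + 2 * u) * sqrt (0 + 2 * u)))) \<partial>lborel))"
  proof -
    have "gam_dens 2 u * L u = (1/2) * (indicator {0..} (0 + 2 * u) * ((0 + 2 * u) * exp (- ((0 + 2 * u) * (1/2))) * area_lap (m * ((0 + 2 * u) * sqrt (0 + 2 * u)))))" for u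
    proof (cases "u \<ge> 0")
      case True
      have "(2 * u) powr (3/2) = (2 * u) * sqrt (2 * u)"
      proof (cases "u = 0")
        case False
        hence "(2 * u) powr (1 + 1/2) = (2 * u) * sqrt (2 * u)"
          using True by (subst powr_add) (simp add: powr_half_sqrt)
        thus ?thesis by simp
      qed simp
      thus ?thesis using True by (simp add: gam_dens_def L_def Gamma_numeral)
    qed (simp add: gam_dens_def)
    moreover have "(1/2) * x = (1/4) * (2 * x)" for x :: real by simp
    ultimately show ?thesis by (simp only: integral_mult_right_zero)
  qed
  also have "2 * (\<integral>u. indicator {0..} (0 + 2 * u) * ((0 + 2 * u) * exp (- ((0 + 2 * u) * (1/2))) * area_lap (m * ((0 + 2 * u) * sqrt (0 + 2 * u)))) \<partial>lborel)
      = (\<integral>t. indicator {0..} t * (t * exp (- (t * (1/2))) * area_lap (m * (t * sqrt t))) \<partial>lborel)"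
    using lborel_integral_real_affine[of 2 "\<lambda>t. indicator {0..} t * (t * exp (- (t * (1/2))) * area_lap (m * (t * sqrt t)))" 0]
    by simp
  also have "\<dots> = 4 * (\<integral>v. (1 + 3 * m * v) powr (-5/3) \<partial>exp_measure)"
    by (rule area_transform_deriv[OF m])
  finally show ?thesis by simp
qed

text \<open>For fixed \<open>v\<close> the inner integral is the Gamma transform at
  \<open>3 * m * v\<close>; the exponent \<open>-5/3\<close> of the explicit solution dictates the
  parameter \<open>5/3\<close> of the second factor.\<close>

lemma laplace_gamma_product:
  assumes m: "m > 0"
  shows "(\<integral>x. exp (- m * gamma_product x) \<partial>gamma_space) = (\<integral>v. (1 + 3 * m * v) powr (-5/3) \<partial>exp_measure)"
proof -
  interpret P: pair_prob_space "gam 1" "gam (5/3)" by (rule pair_prob_space_gamma)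
  have i: "integrable gamma_space (\<lambda>x. exp (- m * gamma_product x))"
  proof (rule P.integrable_const_bound[where B=1])
    show "AE x in gamma_space. norm (exp (- m * gamma_product x)) \<le> 1"
      using AE_gamma_space
      by eventually_elim (use m in \<open>auto simp: gamma_product_def case_prod_unfold\<close>)
  qed measurable
  have "(\<integral>x. exp (- m * gamma_product x) \<partial>gamma_space) = (\<integral>v. (\<integral>g. exp (- m * gamma_product (v, g)) \<partial>gam (5/3)) \<partial>gam 1)"
    by (rule P.integral_fst'[OF i, symmetric])
  also have "\<dots> = (\<integral>v. (1 + 3 * m * v) powr (-5/3) \<partial>gam 1)"
  proof (rule integral_cong_AE)
    show "(\<lambda>v. \<integral>g. exp (- m * gamma_product (v, g)) \<partial>gam (5/3)) \<in> borel_measurable (gam 1)"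
      unfolding gamma_product_def by measurable
    show "AE v in gam 1. (\<integral>g. exp (- m * gamma_product (v, g)) \<partial>gam (5/3)) = (1 + 3 * m * v) powr (-5/3)"
      using AE_gam_nonneg
    proof eventually_elim
      case (elim v)
      show ?case using gam_laplace[of "5/3" "3 * m * v"] m elim
        by (simp add: gamma_product_def mult_ac)
    qed
  qed measurable
  finally show ?thesis by (simp add: exp_measure_eq_gam)
qed

section \<open>Equality in law and its consequences for moments\<close>

lemma distr_randomized_area: "distr area_space borel randomized_area = distr gamma_space borel gamma_product"
proof (rule distr_eq_if_laplace_eq)
  show "prob_space area_space" "prob_space gamma_space"
  proof -
    interpret P: pair_prob_space "gam 2" M by (rule pair_prob_space_area)
    show "prob_space area_space" by (rule P.prob_space_axioms)
    interpret Q: pair_prob_space "gam 1" "gam (5/3)" by (rule pair_prob_space_gamma)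
    show "prob_space gamma_space" by (rule Q.prob_space_axioms)
  qed
  show "AE x in area_space. 0 \<le> randomized_area x"
    using AE_area_space by eventually_elim (auto simp: randomized_area_def case_prod_unfold)
  show "AE x in gamma_space. 0 \<le> gamma_product x"
    using AE_gamma_space by eventually_elim (auto simp: gamma_product_def case_prod_unfold)
  fix n :: nat assume "n > 0"
  thus "(\<integral>x. exp (- real n * randomized_area x) \<partial>area_space) = (\<integral>x. exp (- real n * gamma_product x) \<partial>gamma_space)"
    using laplace_randomized_area[of "real n"] laplace_gamma_product[of "real n"] by simp
qed measurable

text \<open>Equality in law, with both sides factored by independence. Nonnegative integrals keep
  infinite values meaningful, so one identity serves for finite and infinite moments alike.\<close>

lemma nn_moment_identity:
  "(\<integral>\<^sup>+u. ennreal ((2 * u) powr (3/2 * p)) \<partial>gam 2) * (\<integral>\<^sup>+\<omega>. ennreal (sup_area B \<omega> powr p) \<partial>M)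
    = ennreal (3 powr p) * (\<integral>\<^sup>+v. ennreal (v powr p) \<partial>gam 1) * (\<integral>\<^sup>+g. ennreal (g powr p) \<partial>gam (5/3))"
  "(\<integral>\<^sup>+x. ennreal (randomized_area x powr p) \<partial>area_space)
    = (\<integral>\<^sup>+u. ennreal ((2 * u) powr (3/2 * p)) \<partial>gam 2) * (\<integral>\<^sup>+\<omega>. ennreal (sup_area B \<omega> powr p) \<partial>M)"
proof -
  interpret P: pair_prob_space "gam 2" M by (rule pair_prob_space_area)
  interpret Q: pair_prob_space "gam 1" "gam (5/3)" by (rule pair_prob_space_gamma)
  have "(\<integral>\<^sup>+x. ennreal (randomized_area x powr p) \<partial>area_space)
      = (\<integral>\<^sup>+x. ennreal ((2 * fst x) powr (3/2 * p)) * ennreal (sup_area B (snd x) powr p) \<partial>area_space)"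
  proof (rule nn_integral_cong_AE, use AE_area_space in eventually_elim)
    case (elim x)
    thus ?case by (simp add: randomized_area_def case_prod_unfold powr_mult powr_powr flip: ennreal_mult')
  qed
  also have "\<dots> = (\<integral>\<^sup>+u. \<integral>\<^sup>+\<omega>. ennreal ((2 * u) powr (3/2 * p)) * ennreal (sup_area B \<omega> powr p) \<partial>M \<partial>gam 2)"
    by (subst nn_integral_fst[symmetric]) auto
  also have "\<dots> = (\<integral>\<^sup>+u. ennreal ((2 * u) powr (3/2 * p)) \<partial>gam 2) * (\<integral>\<^sup>+\<omega>. ennreal (sup_area B \<omega> powr p) \<partial>M)"
    by (simp add: nn_integral_cmult nn_integral_multc)
  finally show X: "(\<integral>\<^sup>+x. ennreal (randomized_area x powr p) \<partial>area_space) = \<dots>" .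
  have "(\<integral>\<^sup>+x. ennreal (gamma_product x powr p) \<partial>gamma_space)
      = (\<integral>\<^sup>+x. ennreal (3 powr p) * ennreal (fst x powr p) * ennreal (snd x powr p) \<partial>gamma_space)"
  proof (rule nn_integral_cong_AE, use AE_gamma_space in eventually_elim)
    case (elim x)
    thus ?case by (simp add: gamma_product_def case_prod_unfold powr_mult mult.assoc flip: ennreal_mult')
  qed
  also have "\<dots> = (\<integral>\<^sup>+v. \<integral>\<^sup>+g. ennreal (3 powr p) * ennreal (v powr p) * ennreal (g powr p) \<partial>gam (5/3) \<partial>gam 1)"
    by (subst Q.M2.nn_integral_fst[symmetric]) auto
  also have "\<dots> = ennreal (3 powr p) * (\<integral>\<^sup>+v. ennreal (v powr p) \<partial>gam 1) * (\<integral>\<^sup>+g. ennreal (g powr p) \<partial>gam (5/3))"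
    by (simp add: nn_integral_cmult nn_integral_multc)
  finally have Y: "(\<integral>\<^sup>+x. ennreal (gamma_product x powr p) \<partial>gamma_space) = \<dots>" .
  have "(\<integral>\<^sup>+x. ennreal (randomized_area x powr p) \<partial>area_space) = (\<integral>\<^sup>+y. ennreal (y powr p) \<partial>distr area_space borel randomized_area)"
    by (simp add: nn_integral_distr)
  also have "\<dots> = (\<integral>\<^sup>+x. ennreal (gamma_product x powr p) \<partial>gamma_space)"
    unfolding distr_randomized_area by (simp add: nn_integral_distr)
  finally show "(\<integral>\<^sup>+u. ennreal ((2 * u) powr (3/2 * p)) \<partial>gam 2) * (\<integral>\<^sup>+\<omega>. ennreal (sup_area B \<omega> powr p) \<partial>M)
    = ennreal (3 powr p) * (\<integral>\<^sup>+v. ennreal (v powr p) \<partial>gam 1) * (\<integral>\<^sup>+g. ennreal (g powr p) \<partial>gam (5/3))"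
    unfolding X Y .
qed

lemma nn_integral_scaled_gam_2:
  assumes "2 + 3/2 * p > 0"
  shows "(\<integral>\<^sup>+u. ennreal ((2 * u) powr (3/2 * p)) \<partial>gam 2) = ennreal (2 powr (3/2 * p) * Gamma (2 + 3/2 * p))"
proof -
  have "(\<integral>\<^sup>+u. ennreal ((2 * u) powr (3/2 * p)) \<partial>gam 2)
      = (\<integral>\<^sup>+u. ennreal (2 powr (3/2 * p)) * ennreal (u powr (3/2 * p)) \<partial>gam 2)"
  proof (rule nn_integral_cong_AE, use AE_gam_nonneg[of 2] in eventually_elim)
    case (elim u)
    thus ?case by (simp add: powr_mult flip: ennreal_mult')
  qed
  also have "\<dots> = ennreal (2 powr (3/2 * p)) * ennreal (Gamma (2 + 3/2 * p) / Gamma 2)"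
    using assms by (simp add: nn_integral_cmult nn_integral_gam_powr del: times_divide_eq_left)
  finally show ?thesis by (simp add: Gamma_numeral flip: ennreal_mult')
qed

text \<open>The right side of \<open>nn_moment_identity(1)\<close> is finite for
  \<open>p > -1\<close>, and the moment of the random time is strictly positive, so an infinite
  moment of the area would make the left side infinite.\<close>

lemma nn_moment_finite:
  assumes p: "p > -1"
  shows "(\<integral>\<^sup>+\<omega>. ennreal (sup_area B \<omega> powr p) \<partial>M) < \<infinity>"
proof (rule ccontr)
  assume "\<not> ?thesis"
  hence inf: "(\<integral>\<^sup>+\<omega>. ennreal (sup_area B \<omega> powr p) \<partial>M) = \<infinity>" by (simp add: not_less top_unique)
  define c where "c = 2 powr (3/2 * p) * Gamma (2 + 3/2 * p)"
  have c: "c > 0" unfolding c_def using p by (intro mult_pos_pos Gamma_real_pos) auto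
  have "(\<integral>\<^sup>+u. ennreal ((2 * u) powr (3/2 * p)) \<partial>gam 2) = ennreal c"
    unfolding c_def using p by (intro nn_integral_scaled_gam_2) simp
  hence "(\<integral>\<^sup>+u. ennreal ((2 * u) powr (3/2 * p)) \<partial>gam 2) * (\<integral>\<^sup>+\<omega>. ennreal (sup_area B \<omega> powr p) \<partial>M) = \<infinity>"
    using c by (simp only: inf) (simp add: ennreal_mult_top)
  moreover have "ennreal (3 powr p) * (\<integral>\<^sup>+v. ennreal (v powr p) \<partial>gam 1) * (\<integral>\<^sup>+g. ennreal (g powr p) \<partial>gam (5/3)) < \<infinity>"
    using p by (subst nn_integral_gam_powr, simp, simp)+ (auto simp: ennreal_mult_less_top)
  ultimately show False unfolding nn_moment_identity(1) by simp
qed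

text \<open>The case \<open>p = -1\<close> is decisive, since
  \<open>x powr (-1) \<le> x powr p + 1\<close>. There the exponential factor has infinite inverse
  mean, whereas the moment of the random time is finite because \<open>2 - 3/2 > 0\<close>.\<close>

lemma nn_moment_infinite:
  assumes p: "p \<le> -1"
  shows "(\<integral>\<^sup>+\<omega>. ennreal (sup_area B \<omega> powr p) \<partial>M) = \<infinity>"
proof (rule ccontr)
  assume fin: "(\<integral>\<^sup>+\<omega>. ennreal (sup_area B \<omega> powr p) \<partial>M) \<noteq> \<infinity>"
  have "(\<integral>\<^sup>+\<omega>. ennreal (sup_area B \<omega> powr (-1)) \<partial>M) \<le> (\<integral>\<^sup>+\<omega>. ennreal (sup_area B \<omega> powr p) + 1 \<partial>M)"
  proof (rule nn_integral_mono_AE, use AE_sup_area_nonneg in eventually_elim)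
    case (elim \<omega>)
    define x where "x = sup_area B \<omega>"
    have "x powr (-1) \<le> x powr p + 1"
    proof -
      \<comment> \<open>\<open>0 powr a\<close> is 0, so both powers vanish at
        \<open>x = 0\<close>.\<close>
      consider "x = 0" | "0 < x" "x \<le> 1" | "x > 1" using elim by (force simp: x_def)
      thus ?thesis
      proof cases
        case 2
        have "x powr (-1) \<le> x powr p" using 2 p by (intro powr_mono') auto
        thus ?thesis by simp
      next
        case 3
        have "x powr (-1) \<le> 1" using 3 by (intro powr_neg_le_1) auto
        thus ?thesis by (smt (verit) powr_ge_zero)
      qed simp
    qed
    hence "ennreal (x powr (-1)) \<le> ennreal (x powr p + 1)" by (rule ennreal_leI)
    also have "\<dots> = ennreal (x powr p) + 1" by (subst ennreal_plus) auto
    finally show ?case by (simp only: x_def)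
  qed
  also have "\<dots> = (\<integral>\<^sup>+\<omega>. ennreal (sup_area B \<omega> powr p) \<partial>M) + (\<integral>\<^sup>+\<omega>. 1 \<partial>M)"
    by (rule nn_integral_add) auto
  also have "\<dots> < \<infinity>" using fin emeasure_space_1 by (simp add: less_top)
  finally have fin': "(\<integral>\<^sup>+\<omega>. ennreal (sup_area B \<omega> powr (-1)) \<partial>M) < \<infinity>" .
  have "(\<integral>\<^sup>+u. ennreal ((2 * u) powr (3/2 * (-1))) \<partial>gam 2) * (\<integral>\<^sup>+\<omega>. ennreal (sup_area B \<omega> powr (-1)) \<partial>M) < \<infinity>"
    using fin' by (subst nn_integral_scaled_gam_2) (auto simp: ennreal_mult_less_top)
  moreover have "ennreal (3 powr (-1)) * (\<integral>\<^sup>+v. ennreal (v powr (-1)) \<partial>gam 1) * (\<integral>\<^sup>+g. ennreal (g powr (-1)) \<partial>gam (5/3)) = \<infinity>"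
  proof -
    define c where "c = Gamma (5/3 + (-1)) / Gamma (5/3 :: real)"
    have c: "c > 0" unfolding c_def by (intro divide_pos_pos Gamma_real_pos) auto
    have "(\<integral>\<^sup>+g. ennreal (g powr (-1)) \<partial>gam (5/3)) = ennreal c"
      unfolding c_def by (rule nn_integral_gam_powr) auto
    thus ?thesis unfolding nn_integral_gam_inverse
      using c by (simp only:) (simp add: ennreal_mult_top ennreal_top_mult)
  qed
  ultimately show False unfolding nn_moment_identity(1) by simp
qed

lemma norm_of_real_powr: "x \<ge> 0 \<Longrightarrow> norm (complex_of_real x powr s) = x powr Re s"
  by (simp add: norm_powr_real_powr)

text \<open>Absolute integrability comes from the real moments with exponent \<open>Re s\<close>,
  and complex powers of products of nonnegative reals split. Equality in law then expresses the
  moment of the area as a quotient, whose denominator, the moment of the random time, is a nonzero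
  Gamma value times a power of 2.\<close>

lemma complex_moment:
  assumes s: "Re s > -1"
  shows "integrable M (\<lambda>\<omega>. complex_of_real (sup_area B \<omega>) powr s)"
    and "expectation (\<lambda>\<omega>. complex_of_real (sup_area B \<omega>) powr s) = moment_expr2 s"
proof -
  interpret P: pair_prob_space "gam 2" M by (rule pair_prob_space_area)
  interpret Q: pair_prob_space "gam 1" "gam (5/3)" by (rule pair_prob_space_gamma)
  show i: "integrable M (\<lambda>\<omega>. complex_of_real (sup_area B \<omega>) powr s)"
  proof (rule integrableI_bounded)
    have "(\<integral>\<^sup>+\<omega>. ennreal (norm (complex_of_real (sup_area B \<omega>) powr s)) \<partial>M) = (\<integral>\<^sup>+\<omega>. ennreal (sup_area B \<omega> powr Re s) \<partial>M)"
      by (rule nn_integral_cong_AE, use AE_sup_area_nonneg in eventually_elim) (simp add: norm_of_real_powr)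
    thus "(\<integral>\<^sup>+\<omega>. ennreal (norm (complex_of_real (sup_area B \<omega>) powr s)) \<partial>M) < \<infinity>"
      using nn_moment_finite[OF s] by simp
  qed measurable
  define E where "E = expectation (\<lambda>\<omega>. complex_of_real (sup_area B \<omega>) powr s)"
  have nnX: "AE x in area_space. 0 \<le> randomized_area x"
    using AE_area_space by eventually_elim (auto simp: randomized_area_def case_prod_unfold)
  have iX: "integrable area_space (\<lambda>x. complex_of_real (randomized_area x) powr s)"
  proof (rule integrableI_bounded)
    have "(\<integral>\<^sup>+x. ennreal (norm (complex_of_real (randomized_area x) powr s)) \<partial>area_space) = (\<integral>\<^sup>+x. ennreal (randomized_area x powr Re s) \<partial>area_space)"
      by (rule nn_integral_cong_AE, use nnX in eventually_elim) (simp add: norm_of_real_powr)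
    also have "\<dots> < \<infinity>" unfolding nn_moment_identity(2)
      using nn_moment_finite[OF s] s by (subst nn_integral_scaled_gam_2) (auto simp: ennreal_mult_less_top)
    finally show "(\<integral>\<^sup>+x. ennreal (norm (complex_of_real (randomized_area x) powr s)) \<partial>area_space) < \<infinity>" .
  qed measurable
  have iY: "integrable gamma_space (\<lambda>x. complex_of_real (gamma_product x) powr s)"
  proof -
    have "integrable (distr area_space borel randomized_area) (\<lambda>x. complex_of_real x powr s)"
      using iX by (subst integrable_distr_eq) auto
    thus ?thesis unfolding distr_randomized_area by (subst (asm) integrable_distr_eq) auto
  qed
  have eq: "(\<integral>x. complex_of_real (randomized_area x) powr s \<partial>area_space) = (\<integral>x. complex_of_real (gamma_product x) powr s \<partial>gamma_space)"
  proof -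
    have "(\<integral>x. complex_of_real (randomized_area x) powr s \<partial>area_space) = (\<integral>x. complex_of_real x powr s \<partial>distr area_space borel randomized_area)"
      by (rule integral_distr[symmetric]) measurable
    also have "\<dots> = (\<integral>x. complex_of_real (gamma_product x) powr s \<partial>gamma_space)"
      unfolding distr_randomized_area by (rule integral_distr) measurable
    finally show ?thesis .
  qed
  have g2: "(\<integral>u. complex_of_real ((2 * u) powr (3/2)) powr s \<partial>gam 2) = 2 powr (3/2 * s) * Gamma (2 + 3/2 * s)"
  proof -
    have "(\<integral>u. complex_of_real ((2 * u) powr (3/2)) powr s \<partial>gam 2) = (\<integral>u. 2 powr (3/2 * s) * complex_of_real u powr (3/2 * s) \<partial>gam 2)"
    proof (rule integral_cong_AE)
      show "AE u in gam 2. complex_of_real ((2 * u) powr (3/2)) powr s = 2 powr (3/2 * s) * complex_of_real u powr (3/2 * s)"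
        using AE_gam_nonneg
      proof eventually_elim
        case (elim u)
        show ?case
        proof (cases "u = 0")
          case False
          hence u: "u > 0" using elim by simp
          have "complex_of_real ((2 * u) powr (3/2)) powr s = exp (s * of_real (3/2 * ln (2 * u)))"
            using u by (simp add: of_real_powr_exp ln_powr)
          also have "\<dots> = exp (3/2 * s * of_real (ln 2)) * exp (3/2 * s * of_real (ln u))"
            using u by (simp add: ln_mult algebra_simps add_divide_distrib flip: exp_add)
          also have "\<dots> = of_real 2 powr (3/2 * s) * complex_of_real u powr (3/2 * s)"
            using u by (simp only: of_real_powr_exp)
          finally show ?thesis by simp
        qed simp
      qed
    qed measurable
    also have "\<dots> = 2 powr (3/2 * s) * Gamma (2 + 3/2 * s)"
      using gam_complex_moment[of 2 "3/2 * s"] s by (simp add: Gamma_numeral)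
    finally show ?thesis .
  qed
  have "(\<integral>x. complex_of_real (randomized_area x) powr s \<partial>area_space)
      = (\<integral>u. \<integral>\<omega>. complex_of_real (randomized_area (u, \<omega>)) powr s \<partial>M \<partial>gam 2)"
    by (rule P.integral_fst'[OF iX, symmetric])
  also have "\<dots> = (\<integral>u. complex_of_real ((2 * u) powr (3/2)) powr s * E \<partial>gam 2)"
  proof (rule Bochner_Integration.integral_cong[OF refl])
    fix u
    \<comment> \<open>The first factor is a nonnegative real, which is enough for the power to split
      at every \<open>\<omega>\<close>, not just almost surely.\<close>
    have "complex_of_real (randomized_area (u, \<omega>)) powr s = complex_of_real ((2 * u) powr (3/2)) powr s * complex_of_real (sup_area B \<omega>) powr s" for \<omega>
      using powr_times_real_left[of "complex_of_real ((2 * u) powr (3/2))" "complex_of_real (sup_area B \<omega>)" s]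
      by (simp add: randomized_area_def)
    thus "(\<integral>\<omega>. complex_of_real (randomized_area (u, \<omega>)) powr s \<partial>M) = complex_of_real ((2 * u) powr (3/2)) powr s * E"
      by (simp add: E_def)
  qed
  also have "\<dots> = 2 powr (3/2 * s) * Gamma (2 + 3/2 * s) * E" by (simp add: g2)
  finally have X: "(\<integral>x. complex_of_real (randomized_area x) powr s \<partial>area_space) = 2 powr (3/2 * s) * Gamma (2 + 3/2 * s) * E" .
  have "(\<integral>x. complex_of_real (gamma_product x) powr s \<partial>gamma_space)
      = (\<integral>v. \<integral>g. complex_of_real (gamma_product (v, g)) powr s \<partial>gam (5/3) \<partial>gam 1)"
    by (rule Q.integral_fst'[OF iY, symmetric])
  also have "\<dots> = (\<integral>v. 3 powr s * complex_of_real v powr s * (Gamma (5/3 + s) / Gamma (5/3)) \<partial>gam 1)"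
  proof (rule integral_cong_AE)
    show "AE v in gam 1. (\<integral>g. complex_of_real (gamma_product (v, g)) powr s \<partial>gam (5/3)) = 3 powr s * complex_of_real v powr s * (Gamma (5/3 + s) / Gamma (5/3))"
      using AE_gam_nonneg
    proof eventually_elim
      case (elim v)
      have "complex_of_real (gamma_product (v, g)) powr s = 3 powr s * complex_of_real v powr s * complex_of_real g powr s" for g
        using powr_times_real_left[of 3 "complex_of_real v * complex_of_real g" s]
          powr_times_real_left[of "complex_of_real v" "complex_of_real g" s] elim
        by (simp add: gamma_product_def mult.assoc)
      thus ?case using gam_complex_moment[of "5/3" s] s by simp
    qed
    show "(\<lambda>v. \<integral>g. complex_of_real (gamma_product (v, g)) powr s \<partial>gam (5/3)) \<in> borel_measurable (gam 1)"
      unfolding gamma_product_def by measurable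
  qed measurable
  also have "\<dots> = 3 powr s * Gamma (1 + s) * (Gamma (5/3 + s) / Gamma (5/3))"
    using gam_complex_moment[of 1 s] s by simp
  finally have Y: "(\<integral>x. complex_of_real (gamma_product x) powr s \<partial>gamma_space) = 3 powr s * Gamma (1 + s) * (Gamma (5/3 + s) / Gamma (5/3))" .
  have nz: "Gamma (2 + 3/2 * s) \<noteq> 0" using s by (intro Gamma_neq_0_if_Re_pos) simp
  have nz2: "(2 :: complex) powr (3/2 * s) \<noteq> 0" by simp
  have c: "of_real (3 / sqrt 8) powr s = 3 powr s / (2 :: complex) powr (3/2 * s)"
    using of_real_powr_exp[of "3 / sqrt 8" s] of_real_powr_exp[of 3 s] of_real_powr_exp[of 2 "3/2 * s"]
    by (simp add: ln_div ln_sqrt8 algebra_simps flip: exp_diff)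
  have *: "2 powr (3/2 * s) * Gamma (2 + 3/2 * s) * E = 3 powr s * Gamma (1 + s) * (Gamma (5/3 + s) / Gamma (5/3))"
    using X Y eq by simp
  have "E = 3 powr s * Gamma (1 + s) * (Gamma (5/3 + s) / Gamma (5/3)) / (2 powr (3/2 * s) * Gamma (2 + 3/2 * s))"
  proof -
    have "E = R / K" if "K * E = R" "K \<noteq> 0" for K R :: complex using that by auto
    moreover have "2 powr (3/2 * s) * Gamma (2 + 3/2 * s) \<noteq> 0" by (rule no_zero_divisors[OF nz2 nz])
    ultimately show ?thesis using * by blast
  qed
  also have "\<dots> = moment_expr2 s" unfolding moment_expr2_def c by (simp add: add.commute mult_ac)
  finally show "expectation (\<lambda>\<omega>. complex_of_real (sup_area B \<omega>) powr s) = moment_expr2 s" by (simp add: E_def)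
qed

end

theorem theorem1p6:
  fixes M :: "'a measure" and B :: "real \<Rightarrow> 'a \<Rightarrow> real"
  assumes "standard_brownian_motion M B"
  shows "(\<forall>s::complex. Re s > -1 \<longrightarrow>
            integrable M (\<lambda>\<omega>. complex_of_real (sup_area B \<omega>) powr s) \<and>
            (\<integral>\<omega>. complex_of_real (sup_area B \<omega>) powr s \<partial>M) = moment_formula1 s \<and>
            moment_formula1 s = moment_formula2 s \<and>
            moment_formula2 s = moment_formula3 s \<and>
            moment_formula3 s = moment_formula4 s) \<and>
         (\<forall>s::real. s \<le> -1 \<longrightarrow> (\<integral>\<^sup>+\<omega>. ennreal (sup_area B \<omega> powr s) \<partial>M) = \<infinity>)"
proof -
  interpret standard_brownian_motion M B by (rule assms)
  show ?thesis
  proof (intro conjI allI impI)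
    fix s :: complex assume s: "Re s > -1"
    show "integrable M (\<lambda>\<omega>. complex_of_real (sup_area B \<omega>) powr s)"
      by (rule complex_moment(1)[OF s])
    show "(\<integral>\<omega>. complex_of_real (sup_area B \<omega>) powr s \<partial>M) = moment_formula1 s"
      "moment_formula1 s = moment_formula2 s" "moment_formula2 s = moment_formula3 s"
      "moment_formula3 s = moment_formula4 s"
      unfolding moment_formulas[OF s] by (rule complex_moment(2)[OF s] refl)+
  next
    fix s :: real assume "s \<le> -1"
    thus "(\<integral>\<^sup>+\<omega>. ennreal (sup_area B \<omega> powr s) \<partial>M) = \<infinity>" by (rule nn_moment_infinite)
  qed
qed

end
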